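(* Let $E$ be any elliptic curve over $\mathbb{Q}$ with complex multiplication by an order $\mathcal{O}_{K,f}$ of conductor $f \geq 1$ in an imaginary quadratic field $K$. Assume that the discriminant $\Delta_K f^2$ of $\mathcal{O}_{K,f}$ is even. Then, for each integer $n \geq 2$, $$\mathbb{Q}(\zeta_{2^{n+1}}) \subseteq \mathbb{Q}(E[2^n]).$$
   Context: $K$ is an imaginary quadratic field with ring of integers $\mathcal{O}_K$ and discriminant $\Delta_K$; $\mathcal{O}_{K,f} = \mathbb{Z} + f\mathcal{O}_K \subseteq \mathcal{O}_K$ is the order of conductor (index) $f$, whose discriminant is $\Delta_K f^2$. An elliptic curve $E$ over $\mathbb{Q}$ has complex multiplication by $\mathcal{O}_{K,f}$ if its geometric endomorphism ring (the ring of endomorphisms defined over an algebraic closure $\overline{\mathbb{Q}}$) is isomorphic to $\mathcal{O}_{K,f}$. For a positive integer $m$, $E[m]$ denotes the $m$-torsion subgroup of $E(\overline{\mathbb{Q}})$, and $\mathbb{Q}(E[m]) \subseteq \overline{\mathbb{Q}}$ is the $m$-th division field of $E$, i.e. the field generated over $\mathbb{Q}$ by the coordinates of all points of $E[m]$ (equivalently, the fixed field of the kernel of the action of $\mathrm{Gal}(\overline{\mathbb{Q}}/\mathbb{Q})$ on $E[m]$). $\zeta_m \in \overline{\mathbb{Q}}$ denotes a primitive $m$-th root of unity. *)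

theory Defs
  imports
    Complex_Main
    "HOL-Library.FuncSet"
    "HOL-Computational_Algebra.Computational_Algebra"
    "HOL-Algebra.QuotRing"
    "HOL-Algebra.Generated_Fields"
    "HOL-Algebra.Embedded_Algebras"
    "HOL-Algebra.Algebraic_Closure_Type"
begin

section \<open>Imaginary quadratic fields and their orders\<close>

text \<open>Imaginary quadratic fields are taken as subfields of the complex numbers.\<close>

definition complex_ring :: "complex ring" where
  "complex_ring = ring_of_type_algebra"

definition imaginary_quadratic_field :: "complex set \<Rightarrow> bool" where
  "imaginary_quadratic_field K \<longleftrightarrow>
     subfield K complex_ring \<and> ring.dimension complex_ring 2 \<rat> K \<and> \<not> K \<subseteq> \<real>"

definition ring_of_integers :: "complex set \<Rightarrow> complex set" where
  "ring_of_integers K = {x \<in> K. algebraic_int x}"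

definition integral_basis :: "complex set \<Rightarrow> complex \<Rightarrow> complex \<Rightarrow> bool" where
  "integral_basis K u v \<longleftrightarrow>
     bij_betw (\<lambda>(a :: int, b :: int). of_int a * u + of_int b * v) UNIV (ring_of_integers K)"

text \<open>
  The two embeddings of an imaginary quadratic subfield \<open>K\<close> of the complex numbers are the
  inclusion and its complex conjugate, so the discriminant of \<open>K\<close> is the square of the
  determinant with rows \<open>u, v\<close> and \<open>cnj u, cnj v\<close>, for any integral basis \<open>u, v\<close>.
\<close>

definition field_discriminant :: "complex set \<Rightarrow> int" where
  "field_discriminant K =
     (THE d. \<exists>u v. integral_basis K u v \<and> of_int d = (u * cnj v - v * cnj u) ^ 2)"

lemma field_discriminant_eqI:
  assumes uv: "integral_basis K u v" and d: "of_int d = (u * cnj v - v * cnj u) ^ 2"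
  shows "field_discriminant K = d"
  unfolding field_discriminant_def
proof (rule the_equality)
  show "\<exists>u v. integral_basis K u v \<and> of_int d = (u * cnj v - v * cnj u) ^ 2"
    using assms by blast
next
  fix d'
  assume "\<exists>u v. integral_basis K u v \<and> of_int d' = (u * cnj v - v * cnj u) ^ 2"
  then obtain u' v' where uv': "integral_basis K u' v'"
    and d': "of_int d' = (u' * cnj v' - v' * cnj u') ^ 2" by blast
  have span: "\<exists>a b :: int. x = of_int a * s + of_int b * t"
    if "integral_basis K s t" "x \<in> ring_of_integers K" for s t x
    using that by (force simp: integral_basis_def bij_betw_def image_iff)
  have mem: "of_int a * s + of_int b * t \<in> ring_of_integers K"
    if "integral_basis K s t" for s t and a b :: int
    using that rangeI[of "\<lambda>(a :: int, b :: int). of_int a * s + of_int b * t" "(a, b)"]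
    by (simp add: integral_basis_def bij_betw_def)
  have memb: "s \<in> ring_of_integers K" "t \<in> ring_of_integers K" if "integral_basis K s t" for s t
    using mem[OF that, of 1 0] mem[OF that, of 0 1] by simp_all
  have inj: "a = a' \<and> b = b'"
    if "of_int a * u + of_int b * v = of_int a' * u + of_int b' * v" for a b a' b' :: int
  proof -
    have "inj (\<lambda>(a :: int, b :: int). of_int a * u + of_int b * v)"
      using uv by (auto simp: integral_basis_def bij_betw_def)
    from injD[OF this, of "(a, b)" "(a', b')"] that show ?thesis by simp
  qed
  obtain a b :: int where 1: "u' = of_int a * u + of_int b * v"
    using span[OF uv] memb[OF uv'] by blast
  obtain c e :: int where 2: "v' = of_int c * u + of_int e * v"
    using span[OF uv] memb[OF uv'] by blast
  obtain p q :: int where 3: "u = of_int p * u' + of_int q * v'"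
    using span[OF uv'] memb[OF uv] by blast
  obtain r s :: int where 4: "v = of_int r * u' + of_int s * v'"
    using span[OF uv'] memb[OF uv] by blast
  have "of_int (p * a + q * c) * u + of_int (p * b + q * e) * v = of_int 1 * u + of_int 0 * v"
    using 3 unfolding 1 2 by (simp add: algebra_simps)
  from inj[OF this] have 5: "p * a + q * c = 1" "p * b + q * e = 0" by auto
  have "of_int (r * a + s * c) * u + of_int (r * b + s * e) * v = of_int 0 * u + of_int 1 * v"
    using 4 unfolding 1 2 by (simp add: algebra_simps)
  from inj[OF this] have 6: "r * a + s * c = 0" "r * b + s * e = 1" by auto
  have "(p * s - q * r) * (a * e - b * c) =
      (p * a + q * c) * (r * b + s * e) - (p * b + q * e) * (r * a + s * c)"
    by (simp add: algebra_simps)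
  also have "\<dots> = 1" using 5 6 by simp
  finally have "\<bar>a * e - b * c\<bar> = 1"
    by (metis abs_zmult_eq_1 mult.commute abs_1)
  hence sq: "(a * e - b * c) ^ 2 = 1" by (metis power2_abs power_one)
  have "u' * cnj v' - v' * cnj u' = of_int (a * e - b * c) * (u * cnj v - v * cnj u)"
    unfolding 1 2 by (simp add: algebra_simps)
  hence "(of_int d' :: complex) = of_int ((a * e - b * c) ^ 2) * of_int d"
    unfolding d d' by (simp add: power_mult_distrib)
  hence "(of_int d' :: complex) = of_int d" using sq by simp
  thus "d' = d" by simp
qed

definition order_of_conductor :: "complex set \<Rightarrow> nat \<Rightarrow> complex set" where
  "order_of_conductor K f = {of_int a + of_nat f * x | a x. x \<in> ring_of_integers K}"


section \<open>Weierstrass curves and the group law\<close>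

text \<open>\<open>y\<^sup>2 + a1 x y + a3 y = x\<^sup>3 + a2 x\<^sup>2 + a4 x + a6\<close>\<close>

datatype 'a weierstrass = Weierstrass (a1: 'a) (a2: 'a) (a3: 'a) (a4: 'a) (a6: 'a)

definition curve_discriminant :: "'a :: field weierstrass \<Rightarrow> 'a" where
  "curve_discriminant E =
     (let b2 = a1 E ^ 2 + 4 * a2 E;
          b4 = 2 * a4 E + a1 E * a3 E;
          b6 = a3 E ^ 2 + 4 * a6 E;
          b8 = a1 E ^ 2 * a6 E + 4 * a2 E * a6 E - a1 E * a3 E * a4 E + a2 E * a3 E ^ 2 - a4 E ^ 2
      in - (b2 ^ 2) * b8 - 8 * b4 ^ 3 - 27 * b6 ^ 2 + 9 * b2 * b4 * b6)"

definition elliptic_curve :: "'a :: field weierstrass \<Rightarrow> bool" where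
  "elliptic_curve E \<longleftrightarrow> curve_discriminant E \<noteq> 0"

datatype 'a point = Infinity | Affine 'a 'a

definition curve_points :: "'a :: field weierstrass \<Rightarrow> 'a point set" where
  "curve_points E = insert Infinity
     {Affine x y | x y. y ^ 2 + a1 E * x * y + a3 E * y = x ^ 3 + a2 E * x ^ 2 + a4 E * x + a6 E}"

text \<open>
  In the affine case, \<open>y = l x + (y1 - l x1)\<close> is the chord through the two points, or the
  tangent if they coincide. If \<open>x1 = x2\<close> and the points are not opposite, they are equal.
\<close>

fun point_add :: "'a :: field weierstrass \<Rightarrow> 'a point \<Rightarrow> 'a point \<Rightarrow> 'a point" where
  "point_add E Infinity Q = Q"
| "point_add E P Infinity = P"
| "point_add E (Affine x1 y1) (Affine x2 y2) =
     (if x1 = x2 \<and> y1 + y2 + a1 E * x1 + a3 E = 0 then Infinity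
      else
        let l = (if x1 = x2
                 then (3 * x1 ^ 2 + 2 * a2 E * x1 + a4 E - a1 E * y1) / (2 * y1 + a1 E * x1 + a3 E)
                 else (y2 - y1) / (x2 - x1));
            x3 = l ^ 2 + a1 E * l - a2 E - x1 - x2;
            y3 = - (l + a1 E) * x3 - (y1 - l * x1) - a3 E
        in Affine x3 y3)"

definition point_group :: "'a :: field weierstrass \<Rightarrow> 'a point monoid" where
  "point_group E = \<lparr>carrier = curve_points E, monoid.mult = point_add E, one = Infinity\<rparr>"


section \<open>The endomorphism ring over an algebraically closed field\<close>

fun homogeneous_coords :: "'a :: field point \<Rightarrow> 'a \<times> 'a \<times> 'a" where
  "homogeneous_coords Infinity = (0, 1, 0)"
| "homogeneous_coords (Affine x y) = (x, y, 1)"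

definition ternary_form :: "nat \<Rightarrow> ('a :: field \<times> 'a \<times> 'a \<Rightarrow> 'a) \<Rightarrow> bool" where
  "ternary_form d F \<longleftrightarrow>
     (\<exists>c. F = (\<lambda>(x, y, z). \<Sum>(i, j) \<in> {(i, j). i + j \<le> d}. c i j * x ^ i * y ^ j * z ^ (d - i - j)))"

text \<open>
  A self-map of the curve is a morphism if, locally in the Zariski topology, it is given by
  three forms of equal degree without a common zero. Over an algebraically closed field, a
  morphism is determined by its values on points.
\<close>

definition curve_morphism ::
    "'a :: alg_closed_field weierstrass \<Rightarrow> ('a point \<Rightarrow> 'a point) \<Rightarrow> bool" where
  "curve_morphism E \<phi> \<longleftrightarrow>
     \<phi> \<in> curve_points E \<rightarrow> curve_points E \<and>
     (\<forall>P \<in> curve_points E. \<exists>d F G H.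
        ternary_form d F \<and> ternary_form d G \<and> ternary_form d H \<and>
        (let eval = (\<lambda>Q. let q = homogeneous_coords Q in (F q, G q, H q)) in
           eval P \<noteq> (0, 0, 0) \<and>
           (\<forall>Q \<in> curve_points E. eval Q \<noteq> (0, 0, 0) \<longrightarrow>
              (\<exists>t x y z. t \<noteq> 0 \<and> homogeneous_coords (\<phi> Q) = (x, y, z) \<and>
                 eval Q = (t * x, t * y, t * z)))))"

text \<open>
  Endomorphisms are extensional on the set of points, so that equality of functions is
  equality of endomorphisms.
\<close>

definition endomorphisms :: "'a :: alg_closed_field weierstrass \<Rightarrow> ('a point \<Rightarrow> 'a point) set" where
  "endomorphisms E =
     {\<phi> \<in> extensional (curve_points E). curve_morphism E \<phi> \<and> \<phi> \<in> hom (point_group E) (point_group E)}"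

definition endomorphism_ring ::
    "'a :: alg_closed_field weierstrass \<Rightarrow> ('a point \<Rightarrow> 'a point) ring" where
  "endomorphism_ring E =
     \<lparr>carrier = endomorphisms E,
      monoid.mult = (\<lambda>\<phi> \<psi>. compose (curve_points E) \<phi> \<psi>),
      one = (\<lambda>P \<in> curve_points E. P),
      ring.zero = (\<lambda>P \<in> curve_points E. Infinity),
      add = (\<lambda>\<phi> \<psi>. \<lambda>P \<in> curve_points E. point_add E (\<phi> P) (\<psi> P))\<rparr>"


section \<open>Curves over the rational numbers\<close>

type_synonym qbar = "rat alg_closure"

definition qbar_ring :: "qbar ring" where
  "qbar_ring = ring_of_type_algebra"

definition base_change :: "rat weierstrass \<Rightarrow> qbar weierstrass" where
  "base_change E = map_weierstrass to_ac E"

definition has_CM_by :: "rat weierstrass \<Rightarrow> complex set \<Rightarrow> bool" where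
  "has_CM_by E R \<longleftrightarrow> endomorphism_ring (base_change E) \<simeq> complex_ring\<lparr>carrier := R\<rparr>"

definition torsion_points :: "rat weierstrass \<Rightarrow> nat \<Rightarrow> qbar point set" where
  "torsion_points E m =
     {P \<in> curve_points (base_change E).
        P [^]\<^bsub>point_group (base_change E)\<^esub> m = \<one>\<^bsub>point_group (base_change E)\<^esub>}"

definition rat_adjoin :: "qbar set \<Rightarrow> qbar set" where
  "rat_adjoin S = generate_field qbar_ring (range to_ac \<union> S)"

definition division_field :: "rat weierstrass \<Rightarrow> nat \<Rightarrow> qbar set" where
  "division_field E m = rat_adjoin (\<Union>P \<in> torsion_points E m. set_point P)"

definition primitive_root_of_unity :: "nat \<Rightarrow> 'a :: field \<Rightarrow> bool" where
  "primitive_root_of_unity m \<zeta> \<longleftrightarrow> \<zeta> ^ m = 1 \<and> (\<forall>k. 0 < k \<and> k < m \<longrightarrow> \<zeta> ^ k \<noteq> 1)"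

end

theory Submission
  imports Defs
begin

text \<open>
  Let \<open>\<zeta>\<close> be a root of unity of order \<open>2 ^ (n + 1)\<close>. The Weil pairing puts \<open>\<zeta>\<^sup>2\<close> into the division
  field; that \<open>\<zeta>\<close> itself lies there is due to the complex multiplication. If it did not, there would
  be an automorphism \<open>\<sigma>\<close> of the algebraic closure that fixes the division field and moves \<open>\<zeta>\<close>
  (\<open>automorphism_moving\<close>). It is shown that such a \<open>\<sigma>\<close> preserves the Weil pairing of some basis of
  the points killed by \<open>2 ^ (n + 1)\<close>, which is a primitive root of unity, so that it fixes \<open>\<zeta>\<close>.

  The discriminant being even, the order is \<open>\<int>[w]\<close> with \<open>w\<^sup>2 = - D\<close> for a natural number \<open>D\<close>
  (\<open>even_order_generator\<close>). Let \<open>\<alpha>\<close> be the endomorphism corresponding to \<open>w\<close>. The conjugate of \<open>\<alpha>\<close> by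
  \<open>\<sigma>\<close> has the same square, hence is \<open>\<alpha>\<close> or \<open>- \<alpha>\<close>. Put \<open>\<nu> = \<alpha> + D\<close>. On the two-torsion
  \<open>\<nu>\<^sup>2 = D (D - 1) = 0\<close>, but \<open>\<nu>\<close> is not zero there, because a morphism that kills the two-torsion is
  twice an endomorphism (\<open>divisible_by_two\<close>), whereas \<open>w + D\<close> is not divisible by two in \<open>\<int>[w]\<close>.

  Since \<open>\<sigma>\<close> fixes all points killed by \<open>2 ^ n\<close>, it maps a point \<open>P\<close> killed by \<open>2 ^ (n + 1)\<close> to
  \<open>P + M (2 ^ n P)\<close> with an endomorphism \<open>M\<close> of the two-torsion. As \<open>n \<ge> 2\<close>, it fixes the four-torsion,
  and this excludes that the conjugate of \<open>\<alpha>\<close> is \<open>- \<alpha>\<close>: otherwise \<open>\<alpha>\<close>, and with it \<open>\<nu>\<close>, would kill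
  the two-torsion. So \<open>M\<close> commutes with \<open>\<nu>\<close>, a nonzero nilpotent matrix over the field with two
  elements, and \<open>M\<close> is \<open>0\<close>, \<open>\<nu>\<close>, \<open>1\<close> or \<open>1 + \<nu>\<close>. The pairing of a basis \<open>P\<close>, \<open>Q\<close> changes sign if \<open>P\<close> is
  replaced by \<open>P + T\<close> with a nonzero two-torsion point \<open>T\<close> that is not a multiple of \<open>Q\<close>
  (\<open>pairing_translate\<close>), and in each case there is a basis for which the number of sign changes is
  even (\<open>automorphism_fixes_roots_of_unity\<close>).

  The supporting theory is developed by elementary means: the group law on a short Weierstrass curve
  through collinear triples, the Weil pairing on two-power torsion through explicit functions in the
  style of Miller's algorithm, the fact that sums of morphisms are morphisms through translation to
  points in general position, and the reduction of a general Weierstrass equation to the short form.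
\<close>


section \<open>The group law on a short Weierstrass curve\<close>

locale short_curve =
  fixes a b :: "'a :: field_char_0"
  assumes nonsingular: "4 * a ^ 3 + 27 * b ^ 2 \<noteq> 0"
begin

abbreviation E :: "'a weierstrass" where "E \<equiv> Weierstrass 0 0 0 a b"
abbreviation pts :: "'a point set" where "pts \<equiv> curve_points E"
abbreviation padd :: "'a point \<Rightarrow> 'a point \<Rightarrow> 'a point" (infixl \<open>\<boxplus>\<close> 65) where
  "P \<boxplus> Q \<equiv> point_add E P Q"

fun neg :: "'a point \<Rightarrow> 'a point" where
  "neg Infinity = Infinity"
| "neg (Affine x y) = Affine x (- y)"

lemma Affine_in_pts: "Affine x y \<in> pts \<longleftrightarrow> y ^ 2 = x ^ 3 + a * x + b"
  by (simp add: curve_points_def)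

lemma Infinity_in_pts [simp]: "Infinity \<in> pts"
  by (simp add: curve_points_def)

lemma neg_in_pts [simp]: "neg P \<in> pts \<longleftrightarrow> P \<in> pts"
  by (cases P) (auto simp: Affine_in_pts)

lemma neg_neg [simp]: "neg (neg P) = P"
  by (cases P) auto

lemma neg_eq_Infinity [simp]: "neg P = Infinity \<longleftrightarrow> P = Infinity"
  by (cases P) auto

lemma neg_eq_iff [simp]: "neg P = neg Q \<longleftrightarrow> P = Q"
  by (metis neg_neg)

lemma padd_Infinity [simp]: "P \<boxplus> Infinity = P"
  by (cases P) auto

lemma padd_neg [simp]: "P \<boxplus> neg P = Infinity" "neg P \<boxplus> P = Infinity"
  by (cases P; simp)+

lemma padd_comm: "P \<boxplus> Q = Q \<boxplus> P" if "P \<in> pts" "Q \<in> pts"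
proof (cases P; cases Q)
  fix x1 y1 x2 y2
  assume PQ: "P = Affine x1 y1" "Q = Affine x2 y2"
  show ?thesis
  proof (cases "x1 = x2")
    case True
    have "y1 ^ 2 = y2 ^ 2" using that PQ True by (simp add: Affine_in_pts)
    then have "y1 = y2 \<or> y1 = - y2" by (simp add: power2_eq_iff)
    then show ?thesis using PQ True by auto
  next
    case False
    define l where "l = (y2 - y1) / (x2 - x1)"
    have l': "(y1 - y2) / (x1 - x2) = l"
      unfolding l_def by (metis minus_diff_eq minus_divide_divide)
    have "y1 - l * x1 = y2 - l * x2" unfolding l_def using False by (simp add: field_simps)
    then show ?thesis using PQ False by (simp add: Let_def l' flip: l_def)
  qed
qed auto

text \<open>
  Three affine points with multiplicity are collinear if restricting the equation of the curve to
  the line leaves the cubic polynomial with roots \<open>x1\<close>, \<open>x2\<close>, \<open>x3\<close>. Stated through coefficients,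
  this covers chords and tangents alike, so that the case distinction in the definition of the
  addition disappears from all later arguments.
\<close>

definition collinear ::
    "'a \<Rightarrow> 'a \<Rightarrow> 'a \<Rightarrow> 'a \<Rightarrow> 'a \<Rightarrow> 'a \<Rightarrow> 'a \<Rightarrow> 'a \<Rightarrow> bool" where
  "collinear l v x1 y1 x2 y2 x3 y3 \<longleftrightarrow>
     x1 + x2 + x3 = l ^ 2 \<and> x1 * x2 + x1 * x3 + x2 * x3 = a - 2 * l * v \<and>
     x1 * x2 * x3 = v ^ 2 - b \<and> y1 = l * x1 + v \<and> y2 = l * x2 + v \<and> y3 = l * x3 + v"

lemma collinear_rotate:
  "collinear l v x1 y1 x2 y2 x3 y3 \<Longrightarrow> collinear l v x2 y2 x3 y3 x1 y1"
  by (auto simp: collinear_def algebra_simps)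

lemma collinear_swap:
  "collinear l v x1 y1 x2 y2 x3 y3 \<Longrightarrow> collinear l v x2 y2 x1 y1 x3 y3"
  by (auto simp: collinear_def algebra_simps)

lemma collinear_neg:
  "collinear l v x1 y1 x2 y2 x3 y3 \<Longrightarrow> collinear (- l) (- v) x1 (- y1) x2 (- y2) x3 (- y3)"
  by (auto simp: collinear_def)

lemma collinear_eqs:
  assumes "collinear l v x1 y1 x2 y2 x3 y3"
  shows "a = x1 * x2 + x1 * x3 + x2 * x3 + 2 * l * v" "b = v ^ 2 - x1 * x2 * x3"
    "x3 = l ^ 2 - x1 - x2" "y1 = l * x1 + v" "y2 = l * x2 + v" "y3 = l * x3 + v"
  using assms by (auto simp: collinear_def algebra_simps)

lemma collinear_in_pts:
  assumes "collinear l v x1 y1 x2 y2 x3 y3"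
  shows "Affine x1 y1 \<in> pts"
proof -
  note e = collinear_eqs[OF assms]
  have "y1 ^ 2 = x1 ^ 3 + a * x1 + b"
    unfolding e(4) e(1,2) e(3) by (simp add: algebra_simps power2_eq_square power3_eq_cube)
  then show ?thesis by (simp add: Affine_in_pts)
qed

lemma collinear_third_in_pts:
  "collinear l v x1 y1 x2 y2 x3 y3 \<Longrightarrow> Affine x3 y3 \<in> pts"
  by (metis collinear_in_pts collinear_rotate)

lemma padd_collinear:
  assumes c: "collinear l v x1 y1 x2 y2 x3 y3" and no: "\<not> (x1 = x2 \<and> y1 = - y2)"
  shows "Affine x1 y1 \<boxplus> Affine x2 y2 = Affine x3 (- y3)"
proof -
  define s where "s = (if x1 = x2 then (3 * x1 ^ 2 + a) / (2 * y1) else (y2 - y1) / (x2 - x1))"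
  have "s = l"
  proof (cases "x1 = x2")
    case True
    then have "y1 = y2" using c by (simp add: collinear_def)
    then have "y1 \<noteq> 0" using no True by auto
    moreover have "3 * x1 ^ 2 + a = l * (2 * y1)"
      unfolding collinear_eqs(4)[OF c] collinear_eqs(1)[OF c] collinear_eqs(3)[OF c]
      using True by (simp add: algebra_simps power2_eq_square)
    ultimately show ?thesis unfolding s_def using True by simp
  next
    case False
    moreover have "y2 - y1 = l * (x2 - x1)" using c by (simp add: collinear_def algebra_simps)
    ultimately show ?thesis unfolding s_def by simp
  qed
  moreover have "x3 = l ^ 2 - x1 - x2" "y3 = l * x3 + (y1 - l * x1)"
    using c by (auto simp: collinear_def algebra_simps)
  moreover have "\<not> (x1 = x2 \<and> y1 + y2 = 0)" using no by (auto simp: add_eq_0_iff2)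
  ultimately show ?thesis
    by (auto simp: Let_def s_def split: if_splits)
qed

lemma obtain_collinear:
  assumes P: "Affine x1 y1 \<in> pts" and Q: "Affine x2 y2 \<in> pts"
    and no: "\<not> (x1 = x2 \<and> y1 = - y2)"
  obtains l v x3 y3 where "collinear l v x1 y1 x2 y2 x3 y3"
    "Affine x1 y1 \<boxplus> Affine x2 y2 = Affine x3 (- y3)"
proof -
  define l where "l = (if x1 = x2 then (3 * x1 ^ 2 + a) / (2 * y1) else (y2 - y1) / (x2 - x1))"
  define v where "v = y1 - l * x1"
  define x3 where "x3 = l ^ 2 - x1 - x2"
  have eq: "y1 ^ 2 = x1 ^ 3 + a * x1 + b" "y2 ^ 2 = x2 ^ 3 + a * x2 + b"
    using P Q by (auto simp: Affine_in_pts)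
  have "collinear l v x1 y1 x2 y2 x3 (l * x3 + v)"
  proof (cases "x1 = x2")
    case True
    then have "y1 ^ 2 = y2 ^ 2" using eq by simp
    then have y: "y1 = y2" using no True by (auto simp: power2_eq_iff)
    then have "y1 \<noteq> 0" using True no by auto
    then have l: "a = l * (2 * y1) - 3 * x1 ^ 2" using True by (simp add: l_def)
    have b: "b = y1 ^ 2 - x1 ^ 3 - a * x1" using eq by simp
    show ?thesis
      using True y unfolding collinear_def v_def x3_def unfolding b unfolding l
      by (simp add: algebra_simps power2_eq_square power3_eq_cube)
  next
    case False
    then have y2: "y2 = y1 + l * (x2 - x1)" by (simp add: l_def)
    have b: "b = y1 ^ 2 - x1 ^ 3 - a * x1" using eq by simp
    have "(x2 - x1) * a = (x2 - x1) * (l * (y1 + y2) - (x1 ^ 2 + x1 * x2 + x2 ^ 2))"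
      using eq(2) unfolding b y2 by (simp add: algebra_simps power2_eq_square power3_eq_cube)
    then have a: "a = l * (y1 + y2) - (x1 ^ 2 + x1 * x2 + x2 ^ 2)" using False by simp
    show ?thesis
      unfolding collinear_def v_def x3_def unfolding b unfolding a unfolding y2
      by (simp add: algebra_simps power2_eq_square power3_eq_cube)
  qed
  then show ?thesis using that padd_collinear no by blast
qed

text \<open>
  The curve being smooth, a line that is not vertical cannot contain a point together with
  its opposite.
\<close>

lemma collinear_not_opposite:
  assumes "collinear l v x1 y1 x2 y2 x3 y3"
  shows "\<not> (x2 = x3 \<and> y2 = - y3)"
proof
  assume *: "x2 = x3 \<and> y2 = - y3"
  then have "y2 = - y2" using collinear_eqs(5,6)[OF assms] by metis
  then have "y2 = 0" by (simp add: eq_neg_iff_add_eq_0)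
  then have v: "v = - l * x2" using assms by (simp add: collinear_def add_eq_0_iff2)
  have x1: "x1 = l ^ 2 - 2 * x2" using assms * by (simp add: collinear_def algebra_simps)
  have x3: "x3 = x2" using * by simp
  have a: "a = - 3 * x2 ^ 2"
    unfolding collinear_eqs(1)[OF assms] unfolding x3 x1 v
    by (simp add: algebra_simps power2_eq_square)
  have b: "b = 2 * x2 ^ 3"
    unfolding collinear_eqs(2)[OF assms] unfolding x3 x1 v
    by (simp add: algebra_simps power2_eq_square power3_eq_cube)
  have "4 * a ^ 3 + 27 * b ^ 2 = 0"
    unfolding a b by (simp add: power_mult_distrib flip: power_mult)
  with nonsingular show False by simp
qed

lemma padd_in_pts [simp]: "P \<boxplus> Q \<in> pts" if pq: "P \<in> pts" "Q \<in> pts"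
proof (cases P; cases Q)
  fix x1 y1 x2 y2
  assume PQ: "P = Affine x1 y1" "Q = Affine x2 y2"
  show ?thesis
  proof (cases "x1 = x2 \<and> y1 = - y2")
    case True
    then show ?thesis using PQ by simp
  next
    case False
    then obtain l v x3 y3 where c: "collinear l v x1 y1 x2 y2 x3 y3"
      and s: "P \<boxplus> Q = Affine x3 (- y3)"
      using obtain_collinear[of x1 y1 x2 y2] pq PQ by blast
    then show ?thesis using collinear_third_in_pts[OF c] neg_in_pts[of "Affine x3 y3"] by simp
  qed
qed (use that in auto)

lemma neg_padd: "neg (P \<boxplus> Q) = neg P \<boxplus> neg Q" if pq: "P \<in> pts" "Q \<in> pts"
proof (cases P; cases Q)
  fix x1 y1 x2 y2
  assume PQ: "P = Affine x1 y1" "Q = Affine x2 y2"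
  show ?thesis
  proof (cases "x1 = x2 \<and> y1 = - y2")
    case True
    then show ?thesis using PQ by simp
  next
    case False
    then obtain l v x3 y3 where c: "collinear l v x1 y1 x2 y2 x3 y3"
      and s: "P \<boxplus> Q = Affine x3 (- y3)"
      using obtain_collinear[of x1 y1 x2 y2] pq PQ by blast
    have "neg P \<boxplus> neg Q = Affine x3 (- (- y3))"
      using padd_collinear[OF collinear_neg[OF c]] False PQ by auto
    then show ?thesis using s by simp
  qed
qed auto

lemma padd_cancel: "(P \<boxplus> Q) \<boxplus> neg Q = P" if pq: "P \<in> pts" "Q \<in> pts"
proof (cases P; cases Q)
  fix x1 y1 x2 y2
  assume PQ: "P = Affine x1 y1" "Q = Affine x2 y2"
  show ?thesis
  proof (cases "x1 = x2 \<and> y1 = - y2")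
    case True
    then show ?thesis using PQ by simp
  next
    case False
    then obtain l v x3 y3 where c: "collinear l v x1 y1 x2 y2 x3 y3"
      and s: "P \<boxplus> Q = Affine x3 (- y3)"
      using obtain_collinear[of x1 y1 x2 y2] pq PQ by blast
    have c': "collinear (- l) (- v) x3 (- y3) x2 (- y2) x1 (- y1)"
      by (metis c collinear_neg collinear_rotate collinear_swap)
    have "\<not> (x3 = x2 \<and> - y3 = - (- y2))"
      using collinear_not_opposite[OF c] by auto
    from padd_collinear[OF c' this] show ?thesis using s PQ by simp
  qed
qed (use that in auto)

text \<open>
  Let \<open>k = (x3 - x1) (x3 - x2) / Y\<close>, where \<open>Y\<close> is the value at \<open>C\<close> of the line through \<open>A\<close>
  and \<open>B\<close>. After a shear that makes this line horizontal, the lines through \<open>A + B, C\<close> and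
  through \<open>A, B + C\<close> have slopes \<open>k\<close> and \<open>k\<close> minus the slope of the line \<open>B C\<close>; this is the
  cocycle property of the slope, and it makes both lines end in the same point.
\<close>

lemma padd_assoc_generic:
  assumes c1: "collinear l v x1 y1 x2 y2 d d'" and c2: "collinear r u x2 y2 x3 y3 g g'"
    and n1: "\<not> (x1 = x2 \<and> y1 = - y2)" and n2: "\<not> (x2 = x3 \<and> y2 = - y3)"
    and n3: "\<not> (d = x3 \<and> - d' = - y3)" and n4: "\<not> (x1 = g \<and> y1 = - (- g'))"
    and Y: "y3 \<noteq> l * x3 + v" and x: "x3 \<noteq> x2"
  shows "(Affine x1 y1 \<boxplus> Affine x2 y2) \<boxplus> Affine x3 y3 =
     Affine x1 y1 \<boxplus> (Affine x2 y2 \<boxplus> Affine x3 y3)"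
proof -
  define Y where "Y = y3 - (l * x3 + v)"
  have Y0: "Y \<noteq> 0" using Y by (simp add: Y_def)
  define k where "k = (x3 - x1) * (x3 - x2) / Y"
  have kY: "k * Y = (x3 - x1) * (x3 - x2)" using Y0 by (simp add: k_def)
  have "Affine x3 y3 \<in> pts" using c2 collinear_in_pts collinear_rotate by blast
  then have on: "y3 ^ 2 = x3 ^ 3 + a * x3 + b" by (simp add: Affine_in_pts)
  note e1 = collinear_eqs[OF c1] and e2 = collinear_eqs[OF c2]
  define s where "s = r - l"
  have K1: "k * (x3 - d) = Y + 2 * (l * x3 + v)"
  proof -
    have "Y * (k * (x3 - d)) = (x3 - x1) * (x3 - x2) * (x3 - d)"
      unfolding kY [symmetric] by simp
    also have "\<dots> = y3 ^ 2 - (l * x3 + v) ^ 2"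
      unfolding on e1(1,2,3) by (simp add: algebra_simps power2_eq_square power3_eq_cube)
    also have "\<dots> = Y * (Y + 2 * (l * x3 + v))"
      unfolding Y_def by (simp add: algebra_simps power2_eq_square)
    finally show ?thesis using Y0 by simp
  qed
  have Ys: "Y = s * (x3 - x2)"
    unfolding Y_def s_def e1(5) using e1(5) e2(4,5) by (simp add: algebra_simps)
  have K3: "k * s = x3 - x1"
  proof -
    have "(x3 - x2) * (k * s) = (x3 - x2) * (x3 - x1)" using kY unfolding Ys by (simp add: mult_ac)
    with x show ?thesis by simp
  qed
  have x1: "x1 = x3 - k * s" using K3 by simp
  have r: "r = s + l" by (simp add: s_def)
  have v: "v = (k * (x3 - d) - s * (x3 - x2)) / 2 - l * x3"
    using K1 unfolding Ys by (simp add: field_simps)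
  have d: "d = l ^ 2 - x1 - x2" by (rule e1)
  have y3: "y3 = s * (x3 - x2) + l * x3 + v" using Ys by (simp add: Y_def algebra_simps)
  have u: "u = l * x2 + v - r * x2" using e1(5) e2(4) by (simp add: algebra_simps)
  note par = e1(1,2,4-6) e2(3,6) u y3 r v d x1
  define m n h where "m = k - l" and "n = m - r + l" and "h = m ^ 2 - d - x3"
  define w where "w = - d' - m * d"
  have "collinear m w d (- d') x3 y3 h (m * h + w)"
    unfolding collinear_def
  proof (intro conjI)
    show "y3 = m * x3 + w"
      unfolding n_def m_def h_def w_def par
      by (simp add: field_simps power2_eq_square power3_eq_cube)
    show "d * x3 + d * h + x3 * h = a - 2 * m * w"
      unfolding n_def m_def h_def w_def par
      by (simp add: field_simps power2_eq_square power3_eq_cube)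
    show "d * x3 * h = w ^ 2 - b"
      unfolding n_def m_def h_def w_def par
      by (simp add: field_simps power2_eq_square power3_eq_cube)
  qed (simp_all add: h_def w_def)
  from padd_collinear[OF this] n3
  have L: "(Affine x1 y1 \<boxplus> Affine x2 y2) \<boxplus> Affine x3 y3 = Affine h (- (m * h + w))"
    using padd_collinear[OF c1 n1] by auto
  have "collinear n (y1 - n * x1) x1 y1 g (- g') h (m * h + w)"
    unfolding collinear_def
  proof (intro conjI)
    show "x1 + g + h = n ^ 2"
      unfolding n_def m_def h_def w_def par
      by (simp add: field_simps power2_eq_square power3_eq_cube)
    show "- g' = n * g + (y1 - n * x1)"
      unfolding n_def m_def h_def w_def par
      by (simp add: field_simps power2_eq_square power3_eq_cube)
    show "x1 * g + x1 * h + g * h = a - 2 * n * (y1 - n * x1)"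
      unfolding n_def m_def h_def w_def par
      by (simp add: field_simps power2_eq_square power3_eq_cube)
    show "x1 * g * h = (y1 - n * x1)\<^sup>2 - b"
      unfolding n_def m_def h_def w_def par
      by (simp add: field_simps power2_eq_square power3_eq_cube)
    show "m * h + w = n * h + (y1 - n * x1)"
      unfolding n_def m_def h_def w_def par
      by (simp add: field_simps power2_eq_square power3_eq_cube)
  qed simp_all
  from padd_collinear[OF this] n4
  have "Affine x1 y1 \<boxplus> (Affine x2 y2 \<boxplus> Affine x3 y3) = Affine h (- (m * h + w))"
    using padd_collinear[OF c2 n2] by auto
  with L show ?thesis by simp
qed

text \<open>
  If \<open>C\<close> is a third point of the line \<open>A B\<close>, it is \<open>A\<close>, \<open>B\<close> or the opposite of the sum. The
  excluded cases are those that follow from cancellation or from commutativity.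
\<close>

lemma padd_assoc_distinct:
  assumes A: "A \<in> pts" and B: "B \<in> pts" and C: "C \<in> pts"
    and aff: "A \<noteq> Infinity" "B \<noteq> Infinity" "C \<noteq> Infinity"
    and no: "B \<noteq> neg A" "C \<noteq> neg B" "A \<boxplus> B \<noteq> neg C" "B \<boxplus> C \<noteq> neg A"
    and ne: "C \<noteq> A" "C \<noteq> B"
  shows "(A \<boxplus> B) \<boxplus> C = A \<boxplus> (B \<boxplus> C)"
proof -
  obtain x1 y1 x2 y2 x3 y3 where
    eq: "A = Affine x1 y1" "B = Affine x2 y2" "C = Affine x3 y3"
    using aff by (metis point.exhaust)
  have n1: "\<not> (x1 = x2 \<and> y1 = - y2)" and n2: "\<not> (x2 = x3 \<and> y2 = - y3)"
    using no(1,2) eq by auto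
  obtain l v d d' where c1: "collinear l v x1 y1 x2 y2 d d'" and s1: "A \<boxplus> B = Affine d (- d')"
    using obtain_collinear[of x1 y1 x2 y2] A B eq n1 by blast
  obtain r u g g' where c2: "collinear r u x2 y2 x3 y3 g g'" and s2: "B \<boxplus> C = Affine g (- g')"
    using obtain_collinear[of x2 y2 x3 y3] B C eq n2 by blast
  have n3: "\<not> (d = x3 \<and> - d' = - y3)" and n4: "\<not> (x1 = g \<and> y1 = - (- g'))"
    using no(3,4) s1 s2 eq by auto
  note e1 = collinear_eqs[OF c1]
  have on3: "y3 ^ 2 = x3 ^ 3 + a * x3 + b" and on2: "y2 ^ 2 = x2 ^ 3 + a * x2 + b"
    using B C eq by (auto simp: Affine_in_pts)
  have "y3 \<noteq> l * x3 + v"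
  proof
    assume y3: "y3 = l * x3 + v"
    have "(x3 - x1) * (x3 - x2) * (x3 - d) = 0"
      using on3 unfolding y3 e1(1,2) unfolding e1(3)
      by (simp add: algebra_simps power2_eq_square power3_eq_cube)
    then consider "x3 = x1" | "x3 = x2" | "x3 = d" by auto
    then show False
    proof cases
      case 3
      then show ?thesis using n3 y3 e1(6) by simp
    qed (use ne eq y3 e1(4,5) in auto)
  qed
  moreover have "x3 \<noteq> x2"
  proof
    assume x: "x3 = x2"
    then have "y2 ^ 2 = y3 ^ 2" using on2 on3 by simp
    then show False using x ne(2) eq n2 by (auto simp: power2_eq_iff)
  qed
  ultimately show ?thesis using padd_assoc_generic[OF c1 c2 n1 n2 n3 n4] eq by simp
qed

lemma padd_assoc:
  assumes A: "A \<in> pts" and B: "B \<in> pts" and C: "C \<in> pts"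
  shows "(A \<boxplus> B) \<boxplus> C = A \<boxplus> (B \<boxplus> C)"
proof -
  have opp: "A \<boxplus> (neg A \<boxplus> C) = C" if "A \<in> pts" "C \<in> pts" for A C
    using padd_cancel[of C "neg A"] padd_comm that by (metis neg_neg neg_in_pts padd_in_pts)
  have third: "B \<boxplus> C = neg A" if "A \<in> pts" "B \<in> pts" "C \<in> pts" "A \<boxplus> B = neg C" for A B C
    using padd_cancel[of "neg A" "neg B"] padd_comm that
    by (metis neg_neg neg_in_pts padd_in_pts neg_padd)
  consider (inf) "A = Infinity \<or> B = Infinity \<or> C = Infinity" | (opp1) "B = neg A"
    | (opp2) "C = neg B" | (AB) "A \<boxplus> B = neg C" | (BC) "B \<boxplus> C = neg A" | (same) "C = A"
    | (BeqC) "A \<noteq> Infinity" "B \<noteq> Infinity" "C \<noteq> Infinity" "B \<noteq> neg A" "C \<noteq> neg B"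
        "A \<boxplus> B \<noteq> neg C" "B \<boxplus> C \<noteq> neg A" "C \<noteq> A" "C = B"
    | (dist) "A \<noteq> Infinity" "B \<noteq> Infinity" "C \<noteq> Infinity" "B \<noteq> neg A" "C \<noteq> neg B"
        "A \<boxplus> B \<noteq> neg C" "B \<boxplus> C \<noteq> neg A" "C \<noteq> A" "C \<noteq> B"
    by blast
  then show ?thesis
  proof cases
    case inf
    then show ?thesis by (metis padd_Infinity point_add.simps(1))
  next
    case opp1
    then show ?thesis using opp[OF A C] by simp
  next
    case opp2
    then show ?thesis using padd_cancel[OF A B] by simp
  next
    case AB
    then show ?thesis using third[OF A B C AB] by simp
  next
    case BC
    have "A \<boxplus> B = B \<boxplus> A" "B \<boxplus> C = C \<boxplus> B" using padd_comm A B C by auto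
    then have "A \<boxplus> B = neg C" using third[of C B A] A B C BC by simp
    then show ?thesis using BC by simp
  next
    case same
    then show ?thesis using padd_comm A B by simp
  next
    case BeqC
    have "(C \<boxplus> B) \<boxplus> A = C \<boxplus> (B \<boxplus> A)"
      using padd_assoc_distinct[OF C B A] BeqC padd_comm A B C by (metis neg_neg)
    then show ?thesis using padd_comm A B C by (metis padd_in_pts)
  next
    case dist
    then show ?thesis using padd_assoc_distinct[OF A B C] by simp
  qed
qed

end


section \<open>A Miller-type pairing on two-power torsion\<close>

context short_curve
begin

fun px :: "'a point \<Rightarrow> 'a" where "px (Affine x y) = x" | "px Infinity = 0"
fun py :: "'a point \<Rightarrow> 'a" where "py (Affine x y) = y" | "py Infinity = 0"

lemma px_neg [simp]: "px (neg P) = px P" by (cases P) auto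
lemma py_neg [simp]: "py (neg P) = - py P" by (cases P) auto

lemma Affine_px_py: "P \<noteq> Infinity \<Longrightarrow> P = Affine (px P) (py P)"
  by (cases P) auto

lemma curve_eq: "P \<in> pts \<Longrightarrow> P \<noteq> Infinity \<Longrightarrow> py P ^ 2 = px P ^ 3 + a * px P + b"
  using Affine_px_py Affine_in_pts by metis

lemma px_eq_iff:
  assumes "P \<in> pts" "Q \<in> pts" "P \<noteq> Infinity" "Q \<noteq> Infinity"
  shows "px P = px Q \<longleftrightarrow> P = Q \<or> P = neg Q"
proof
  assume eq: "px P = px Q"
  then have "py P ^ 2 = py Q ^ 2" using curve_eq assms by metis
  then show "P = Q \<or> P = neg Q"
    using eq assms by (cases P; cases Q) (auto simp: power2_eq_iff)
qed auto

abbreviation dbl :: "'a point \<Rightarrow> 'a point" where "dbl P \<equiv> P \<boxplus> P"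

lemma dbl_eq_Infinity_iff:
  assumes "P \<in> pts" "P \<noteq> Infinity"
  shows "dbl P = Infinity \<longleftrightarrow> py P = 0"
  using assms by (cases P) (auto simp: Let_def eq_neg_iff_add_eq_0)

lemma neg_eq_iff_dbl: "P \<in> pts \<Longrightarrow> neg P = P \<longleftrightarrow> dbl P = Infinity"
  by (cases P) (auto simp: Let_def eq_neg_iff_add_eq_0)

text \<open>
  Weil reciprocity for the equations of two lines. On the points of one line the equation of the
  other is linear in the abscissa, so both products are, up to sign and scaling, the value of the
  equation of the curve at the point where the lines meet.
\<close>

lemma line_reciprocity:
  assumes c: "collinear l v x1 y1 x2 y2 x3 y3" and d: "collinear l' v' u1 w1 u2 w2 u3 w3"
  shows "(y1 - l' * x1 - v') * (y2 - l' * x2 - v') * (y3 - l' * x3 - v') =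
    - ((w1 - l * u1 - v) * (w2 - l * u2 - v) * (w3 - l * u3 - v))"
proof -
  define m n where "m = l - l'" and "n = v - v'"
  have exp: "(r * z1 + s) * (r * z2 + s) * (r * z3 + s) =
      r ^ 3 * (z1 * z2 * z3) + r ^ 2 * s * (z1 * z2 + z1 * z3 + z2 * z3) + r * s ^ 2 * (z1 + z2 + z3) + s ^ 3"
    for r s z1 z2 z3 :: 'a
    by (simp add: algebra_simps power2_eq_square power3_eq_cube)
  have "(y1 - l' * x1 - v') * (y2 - l' * x2 - v') * (y3 - l' * x3 - v') =
      (m * x1 + n) * (m * x2 + n) * (m * x3 + n)"
    using c by (simp add: collinear_def m_def n_def algebra_simps)
  also have "\<dots> = m ^ 3 * (v ^ 2 - b) + m ^ 2 * n * (a - 2 * l * v) + m * n ^ 2 * l ^ 2 + n ^ 3"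
    unfolding exp using c by (simp add: collinear_def)
  also have "\<dots> = m ^ 3 * (v' ^ 2 - b) + m ^ 2 * n * (a - 2 * l' * v') + m * n ^ 2 * l' ^ 2 + n ^ 3"
    unfolding m_def n_def by (simp add: algebra_simps power2_eq_square power3_eq_cube)
  also have "\<dots> = (m * u1 + n) * (m * u2 + n) * (m * u3 + n)"
    unfolding exp using d by (simp add: collinear_def)
  also have "\<dots> = - ((w1 - l * u1 - v) * (w2 - l * u2 - v) * (w3 - l * u3 - v))"
    using d by (simp add: collinear_def m_def n_def algebra_simps)
  finally show ?thesis .
qed

text \<open>
  The product over \<open>R\<close> and \<open>- R\<close> eliminates the ordinate, and leaves the cubic polynomial whose
  roots are the abscissae of the points of the line.
\<close>

lemma line_norm:
  assumes c: "collinear l v x1 y1 x2 y2 x3 y3" and P: "Affine x y \<in> pts"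
  shows "(y - l * x - v) * (- y - l * x - v) = - ((x - x1) * (x - x2) * (x - x3))"
proof -
  have "(y - l * x - v) * (- y - l * x - v) = (l * x + v) ^ 2 - y ^ 2"
    by (simp add: algebra_simps power2_eq_square)
  also have "y ^ 2 = x ^ 3 + a * x + b" using P by (simp add: Affine_in_pts)
  finally have "(y - l * x - v) * (- y - l * x - v) = (l * x + v) ^ 2 - (x ^ 3 + a * x + b)" .
  then show ?thesis
    unfolding collinear_eqs(1,2)[OF c] unfolding collinear_eqs(3)[OF c]
    by (simp add: algebra_simps power2_eq_square power3_eq_cube)
qed

definition slope :: "'a point \<Rightarrow> 'a" where
  "slope A = (3 * px A ^ 2 + a) / (2 * py A)"

definition tang :: "'a point \<Rightarrow> 'a point \<Rightarrow> 'a" where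
  "tang A R = py R - slope A * px R - (py A - slope A * px A)"

text \<open>
  The function of \<open>R\<close> with divisor \<open>2 (A) - (2 A) - (O)\<close>: the tangent at \<open>A\<close> divided by the vertical
  line through \<open>2 A\<close>, which is absent if \<open>A\<close> is a two-torsion point.
\<close>

definition miller :: "'a point \<Rightarrow> 'a point \<Rightarrow> 'a" where
  "miller A R = (if py A = 0 then px R - px A else tang A R / (px R - px (dbl A)))"

lemma collinear_tangent:
  assumes A: "A \<in> pts" and y: "py A \<noteq> 0"
  shows "collinear (slope A) (py A - slope A * px A)
      (px A) (py A) (px A) (py A) (px (dbl A)) (- py (dbl A))" and "dbl A \<noteq> Infinity"
proof -
  have A': "A = Affine (px A) (py A)" using y by (cases A) auto
  have no: "\<not> (px A = px A \<and> py A = - py A)" using y by simp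
  obtain l v x3 y3 where c: "collinear l v (px A) (py A) (px A) (py A) x3 y3"
    and s: "dbl A = Affine x3 (- y3)"
    using obtain_collinear[of "px A" "py A" "px A" "py A"] A A' no by metis
  note e = collinear_eqs[OF c]
  have "l * (2 * py A) = 3 * px A ^ 2 + a"
    unfolding e(4) unfolding e(1) e(3) by (simp add: algebra_simps power2_eq_square)
  then have "slope A = l" using y by (simp add: slope_def field_simps)
  then show "collinear (slope A) (py A - slope A * px A)
      (px A) (py A) (px A) (py A) (px (dbl A)) (- py (dbl A))"
    using c s e(4) by simp
  show "dbl A \<noteq> Infinity" using s by simp
qed

lemma tang_neg: "tang (neg A) (neg R) = - tang A R"
  by (simp add: tang_def slope_def)

lemma miller_neg: "A \<in> pts \<Longrightarrow> py A \<noteq> 0 \<Longrightarrow> miller (neg A) (neg R) = - miller A R"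
  by (simp add: miller_def tang_neg flip: neg_padd)

lemma tang_norm:
  assumes "A \<in> pts" "py A \<noteq> 0" "R \<in> pts" "R \<noteq> Infinity"
  shows "tang A R * tang A (neg R) = - ((px R - px A) ^ 2 * (px R - px (dbl A)))"
proof -
  have "Affine (px R) (py R) \<in> pts" using assms Affine_px_py by metis
  from line_norm[OF collinear_tangent(1)[OF assms(1,2)] this]
  show ?thesis by (simp add: tang_def power2_eq_square algebra_simps)
qed

lemma tang_nonzero:
  assumes "A \<in> pts" "py A \<noteq> 0" "R \<in> pts" "R \<noteq> Infinity" "px R \<noteq> px A" "px R \<noteq> px (dbl A)"
  shows "tang A R \<noteq> 0"
  using tang_norm[OF assms(1-4)] assms(5,6) by auto

lemma miller_nonzero:
  assumes "A \<in> pts" "R \<in> pts" "R \<noteq> Infinity" "px R \<noteq> px A"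
    "py A \<noteq> 0 \<Longrightarrow> px R \<noteq> px (dbl A)"
  shows "miller A R \<noteq> 0"
  using assms tang_nonzero[OF assms(1) _ assms(2-4)] by (auto simp: miller_def)

text \<open>
  Weil reciprocity for the functions of \<open>A\<close> and \<open>B\<close>. Multiplying by the values of the tangents at
  \<open>- 2 A\<close> and \<open>- 2 B\<close> completes the products over the points of the two tangents, so that the
  identity becomes the reciprocity of these lines.
\<close>

lemma miller_reciprocity:
  assumes A: "A \<in> pts" "py A \<noteq> 0" and B: "B \<in> pts" "py B \<noteq> 0"
    and ne: "px A \<noteq> px (dbl B)" "px B \<noteq> px (dbl A)" "px (dbl A) \<noteq> px (dbl B)"
  shows "miller A B ^ 2 * miller B (dbl A) = - (miller B A ^ 2 * miller A (dbl B))"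
proof -
  have inf: "A \<noteq> Infinity" "B \<noteq> Infinity" using A B by auto
  note 2 = collinear_tangent(2)[OF A] collinear_tangent(2)[OF B]
  have *: "miller A B ^ 2 * miller B (dbl A) * tang B (neg (dbl A)) = - (tang A B ^ 2)"
    "tang B (neg (dbl A)) \<noteq> 0"
    if A: "A \<in> pts" "py A \<noteq> 0" and B: "B \<in> pts" "py B \<noteq> 0"
    and ne: "px A \<noteq> px (dbl B)" "px B \<noteq> px (dbl A)" "px (dbl A) \<noteq> px (dbl B)"
    and 2: "dbl A \<noteq> Infinity" for A B
  proof -
    have "miller A B ^ 2 * miller B (dbl A) * tang B (neg (dbl A)) =
        tang A B ^ 2 * (tang B (dbl A) * tang B (neg (dbl A))) /
          ((px B - px (dbl A)) ^ 2 * (px (dbl A) - px (dbl B)))"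
      using A(2) B(2) by (simp add: miller_def power_divide)
    also have "\<dots> = - (tang A B ^ 2)"
      unfolding tang_norm[OF B padd_in_pts[OF A(1) A(1)] 2]
      using ne by (simp add: power2_commute[of "px (dbl A)" "px B"])
    finally show "miller A B ^ 2 * miller B (dbl A) * tang B (neg (dbl A)) = - (tang A B ^ 2)" .
    show "tang B (neg (dbl A)) \<noteq> 0"
      using A B ne 2 by (intro tang_nonzero) auto
  qed
  note ab = *[OF A B ne 2(1)] and ba = *[OF B A ne(2,1) ne(3)[symmetric] 2(2)]
  have "tang B A * tang B A * tang B (neg (dbl A)) = - (tang A B * tang A B * tang A (neg (dbl B)))"
    using line_reciprocity[OF collinear_tangent(1)[OF A] collinear_tangent(1)[OF B]]
    by (simp add: tang_def algebra_simps)
  then have rec: "tang A B ^ 2 * tang A (neg (dbl B)) = - (tang B A ^ 2 * tang B (neg (dbl A)))"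
    by (simp add: power2_eq_square)
  have "miller A B ^ 2 * miller B (dbl A) * (tang B (neg (dbl A)) * tang A (neg (dbl B))) =
      - (tang A B ^ 2) * tang A (neg (dbl B))"
    unfolding ab(1)[symmetric] by simp
  also have "\<dots> = tang B A ^ 2 * tang B (neg (dbl A))" using rec by simp
  also have "\<dots> = - (miller B A ^ 2 * miller A (dbl B)) * (tang B (neg (dbl A)) * tang A (neg (dbl B)))"
  proof -
    have "tang B A ^ 2 = - (miller B A ^ 2 * miller A (dbl B) * tang A (neg (dbl B)))"
      using ba(1) by simp
    then show ?thesis by (simp add: mult_ac)
  qed
  finally have eq: "miller A B ^ 2 * miller B (dbl A) * (tang B (neg (dbl A)) * tang A (neg (dbl B))) =
      - (miller B A ^ 2 * miller A (dbl B)) * (tang B (neg (dbl A)) * tang A (neg (dbl B)))" .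
  have nz: "tang B (neg (dbl A)) * tang A (neg (dbl B)) \<noteq> 0" using ab(2) ba(2) by simp
  show ?thesis using eq unfolding mult_right_cancel[OF nz] .
qed

text \<open>
  The degenerate case of the reciprocity in which the tangent at \<open>A\<close> is vertical. The sign
  differs from that of the general case.
\<close>

lemma miller_two_torsion:
  assumes A: "A \<in> pts" "A \<noteq> Infinity" "py A = 0" and B: "B \<in> pts" "py B \<noteq> 0"
    and ne: "px A \<noteq> px (dbl B)"
  shows "miller A B ^ 2 = miller B A ^ 2 * miller A (dbl B)"
proof -
  have "neg A = A" using A by (metis Affine_px_py neg.simps(2) minus_zero)
  then have t: "tang B A * tang B A = - ((px A - px B) ^ 2 * (px A - px (dbl B)))"
    using tang_norm[OF B A(1,2)] by simp
  have "miller B A ^ 2 * miller A (dbl B) =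
      (tang B A * tang B A) * (px (dbl B) - px A) / (px A - px (dbl B)) ^ 2"
    using A(3) B(2) by (simp add: miller_def power_divide power2_eq_square)
  also have "\<dots> = (px A - px B) ^ 2"
    unfolding t minus_diff_eq[of "px A" "px (dbl B)", symmetric] using ne
    by (simp add: power2_eq_square del: minus_diff_eq)
  finally show ?thesis using A(3) by (simp add: miller_def power2_commute)
qed

text \<open>
  If \<open>2 ^ k Q = O\<close>, the divisors of the factors telescope: this function has divisor
  \<open>2 ^ k (Q) - 2 ^ k (O)\<close>.
\<close>

fun millerF :: "nat \<Rightarrow> 'a point \<Rightarrow> 'a point \<Rightarrow> 'a" where
  "millerF 0 Q R = 1"
| "millerF (Suc k) Q R = miller Q R ^ (2 ^ k) * millerF k (dbl Q) R"

definition exact_order :: "nat \<Rightarrow> 'a point \<Rightarrow> bool" where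
  "exact_order k Q \<longleftrightarrow> Q \<in> pts \<and> (dbl ^^ k) Q = Infinity \<and> (\<forall>j<k. (dbl ^^ j) Q \<noteq> Infinity)"

text \<open>
  These points \<open>R\<close> avoid the zeros and poles of all factors of the function \<open>millerF k Q\<close>.
\<close>

definition off_multiples :: "nat \<Rightarrow> 'a point \<Rightarrow> 'a point \<Rightarrow> bool" where
  "off_multiples k Q R \<longleftrightarrow> R \<in> pts \<and> R \<noteq> Infinity \<and> (\<forall>j<k. px R \<noteq> px ((dbl ^^ j) Q))"

lemma dbl_pow_Suc: "(dbl ^^ Suc j) Q = (dbl ^^ j) (dbl Q)"
  using funpow_swap1[of dbl j Q] by simp

lemma dbl_pow_in_pts [simp]: "Q \<in> pts \<Longrightarrow> (dbl ^^ j) Q \<in> pts"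
  by (induction j) auto

lemma exact_order_Suc:
  "exact_order (Suc k) Q \<longleftrightarrow> Q \<in> pts \<and> Q \<noteq> Infinity \<and> exact_order k (dbl Q)"
  unfolding exact_order_def using dbl_pow_Suc[of _ Q] All_less_Suc2[of k "\<lambda>j. (dbl ^^ j) Q \<noteq> Infinity"]
  by auto

lemma exact_order_0 [simp]: "exact_order 0 Q \<longleftrightarrow> Q = Infinity"
  by (auto simp: exact_order_def)

lemma off_multiples_Suc:
  "off_multiples (Suc k) Q R \<longleftrightarrow> off_multiples k (dbl Q) R \<and> px R \<noteq> px Q"
  unfolding off_multiples_def using dbl_pow_Suc[of _ Q] All_less_Suc2[of k "\<lambda>j. px R \<noteq> px ((dbl ^^ j) Q)"]
  by auto

lemma exact_order_py:
  assumes "exact_order (Suc k) Q" shows "py Q = 0 \<longleftrightarrow> k = 0"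
proof -
  have "dbl Q = Infinity \<longleftrightarrow> k = 0" "Q \<in> pts" "Q \<noteq> Infinity"
    using assms by (cases k; auto simp: exact_order_Suc)+
  with dbl_eq_Infinity_iff[of Q] show ?thesis by simp
qed

lemma exact_order_affine:
  assumes "exact_order (Suc (Suc k)) Q" shows "Q \<in> pts" "py Q \<noteq> 0"
  using exact_order_py[OF assms] assms by (auto simp: exact_order_def)

lemma millerF_nonzero:
  assumes "exact_order k Q" "off_multiples k Q R"
  shows "millerF k Q R \<noteq> 0"
  using assms
proof (induction k arbitrary: Q)
  case (Suc k)
  have "miller Q R \<noteq> 0"
  proof (rule miller_nonzero)
    assume "py Q \<noteq> 0"
    then have "k > 0" using Suc.prems exact_order_py by blast
    then show "px R \<noteq> px (dbl Q)"
      using Suc.prems(2) unfolding off_multiples_def by (force dest: spec[of _ 1])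
  qed (use Suc.prems in \<open>auto simp: exact_order_Suc off_multiples_def\<close>)
  with Suc show ?case by (auto simp: exact_order_Suc off_multiples_Suc)
qed simp

text \<open>
  Reciprocity for \<open>millerF\<close> is accumulated from the reciprocity of its factors. The signs
  of the general case enter with even exponents, and the last factor belongs to a two-torsion
  point, for which the sign is positive.
\<close>

lemma millerF_reciprocity:
  assumes "exact_order (Suc k) Q" "B \<in> pts" "py B \<noteq> 0"
    "off_multiples (Suc k) Q B" "off_multiples (Suc k) Q (dbl B)"
  shows "millerF (Suc k) Q B ^ 2 = millerF (Suc k) Q (dbl B) * miller B Q ^ (2 ^ Suc k)"
  using assms
proof (induction k arbitrary: Q)
  case 0
  then have "Q \<in> pts" "Q \<noteq> Infinity" "py Q = 0" "px Q \<noteq> px (dbl B)"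
    using exact_order_py[of 0 Q] by (auto simp: exact_order_Suc off_multiples_def)
  from miller_two_torsion[OF this(1-3) 0(2,3) this(4)] show ?case by simp
next
  case (Suc k)
  note Q = exact_order_affine[OF Suc.prems(1)]
  have ne: "px Q \<noteq> px (dbl B)" "px B \<noteq> px (dbl Q)" "px (dbl Q) \<noteq> px (dbl B)"
    using Suc.prems(4,5) by (auto simp: off_multiples_Suc)
  have IH: "millerF (Suc k) (dbl Q) B ^ 2 =
      millerF (Suc k) (dbl Q) (dbl B) * miller B (dbl Q) ^ (2 ^ Suc k)"
    using Suc.prems by (intro Suc.IH) (auto simp: exact_order_Suc[of "Suc k"] off_multiples_Suc[of "Suc k"])
  have "millerF (Suc (Suc k)) Q B ^ 2 = (miller Q B ^ 2) ^ (2 ^ Suc k) * millerF (Suc k) (dbl Q) B ^ 2"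
    unfolding millerF.simps(2)[of "Suc k"] power_mult_distrib by (simp only: mult.commute flip: power_mult)
  also have "\<dots> = (miller Q B ^ 2 * miller B (dbl Q)) ^ (2 ^ Suc k) * millerF (Suc k) (dbl Q) (dbl B)"
    unfolding IH power_mult_distrib by (simp only: mult_ac)
  also have "\<dots> = (miller B Q ^ 2 * miller Q (dbl B)) ^ (2 ^ Suc k) * millerF (Suc k) (dbl Q) (dbl B)"
    unfolding miller_reciprocity[OF Q Suc.prems(2,3) ne] by simp
  also have "\<dots> = millerF (Suc (Suc k)) Q (dbl B) * miller B Q ^ (2 ^ Suc (Suc k))"
    unfolding millerF.simps(2)[of "Suc k"] power_mult_distrib power_mult[symmetric]
    by (simp only: power_Suc[of 2 "Suc k"] mult_ac)
  finally show ?case .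
qed

text \<open>
  A basis of the points killed by \<open>2 ^ (k + 1)\<close>: two points of this exact order are independent if
  and only if their multiples of order two are different.
\<close>

definition basis :: "nat \<Rightarrow> 'a point \<Rightarrow> 'a point \<Rightarrow> bool" where
  "basis k P Q \<longleftrightarrow> exact_order (Suc k) P \<and> exact_order (Suc k) Q \<and> (dbl ^^ k) P \<noteq> (dbl ^^ k) Q"

text \<open>
  Up to sign and inversion, the Weil pairing of level \<open>2 ^ (k + 1)\<close> on the points of a basis. Both functions
  are normalised at infinity, so no auxiliary point is needed.
\<close>

definition pairing :: "nat \<Rightarrow> 'a point \<Rightarrow> 'a point \<Rightarrow> 'a" where
  "pairing k P Q = millerF (Suc k) Q (neg P) / millerF (Suc k) P (neg Q)"

lemma pairing_swap: "pairing k Q P = inverse (pairing k P Q)"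
  by (simp add: pairing_def)

lemma dbl_pow_neg: "Q \<in> pts \<Longrightarrow> (dbl ^^ j) (neg Q) = neg ((dbl ^^ j) Q)"
  by (induction j) (auto simp: neg_padd)

lemma dbl_pow_Infinity [simp]: "(dbl ^^ j) Infinity = Infinity"
  by (induction j) auto

lemma dbl_pow_add: "(dbl ^^ m) ((dbl ^^ n) Q) = (dbl ^^ (m + n)) Q"
  by (simp add: funpow_add)

lemma exact_order_top:
  assumes "exact_order (Suc k) Q"
  shows "neg ((dbl ^^ k) Q) = (dbl ^^ k) Q" "(dbl ^^ k) Q \<noteq> Infinity"
    "j > k \<Longrightarrow> (dbl ^^ j) Q = Infinity"
proof -
  have top: "(dbl ^^ Suc k) Q = Infinity" using assms unfolding exact_order_def by blast
  then show "neg ((dbl ^^ k) Q) = (dbl ^^ k) Q"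
    using assms by (subst neg_eq_iff_dbl) (auto simp: exact_order_def)
  show "(dbl ^^ k) Q \<noteq> Infinity" using assms unfolding exact_order_def by blast
  assume "j > k"
  then have "(dbl ^^ j) Q = (dbl ^^ (j - Suc k)) ((dbl ^^ Suc k) Q)"
    unfolding dbl_pow_add by simp
  then show "(dbl ^^ j) Q = Infinity" using top by simp
qed

lemma basis_sym: "basis k P Q \<Longrightarrow> basis k Q P"
  by (auto simp: basis_def)

lemma basis_px_neq:
  assumes "basis k P Q" "i \<le> k" "j \<le> k"
  shows "px ((dbl ^^ i) P) \<noteq> px ((dbl ^^ j) Q)"
proof -
  have main: "px ((dbl ^^ i) P) \<noteq> px ((dbl ^^ j) Q)" if b: "basis k P Q" and ij: "i \<le> j" "j \<le> k" for i j P Q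
  proof
    assume eq: "px ((dbl ^^ i) P) = px ((dbl ^^ j) Q)"
    have P: "exact_order (Suc k) P" and Q: "exact_order (Suc k) Q" and ne: "(dbl ^^ k) P \<noteq> (dbl ^^ k) Q"
      using b by (auto simp: basis_def)
    have inp: "P \<in> pts" "Q \<in> pts" using P Q by (auto simp: exact_order_def)
    have "(dbl ^^ i) P \<noteq> Infinity" "(dbl ^^ j) Q \<noteq> Infinity"
      using P Q ij by (auto simp: exact_order_def)
    then have "(dbl ^^ i) P = (dbl ^^ j) Q \<or> (dbl ^^ i) P = neg ((dbl ^^ j) Q)"
      using px_eq_iff[of "(dbl ^^ i) P" "(dbl ^^ j) Q"] eq inp by simp
    then have "(dbl ^^ (k - i)) ((dbl ^^ i) P) = (dbl ^^ (k - i)) ((dbl ^^ j) Q) \<or>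
        (dbl ^^ (k - i)) ((dbl ^^ i) P) = neg ((dbl ^^ (k - i)) ((dbl ^^ j) Q))"
      using dbl_pow_neg[of "(dbl ^^ j) Q" "k - i"] inp by auto
    moreover have "(dbl ^^ (k - i)) ((dbl ^^ i) P) = (dbl ^^ k) P"
      using ij unfolding dbl_pow_add by simp
    moreover have "(dbl ^^ (k - i)) ((dbl ^^ j) Q) = (dbl ^^ (k - i + j)) Q"
      by (rule dbl_pow_add)
    ultimately have *: "(dbl ^^ k) P = (dbl ^^ (k - i + j)) Q \<or> (dbl ^^ k) P = neg ((dbl ^^ (k - i + j)) Q)"
      by simp
    show False
    proof (cases "i = j")
      case True
      then show ?thesis using * ij ne exact_order_top(1)[OF Q] by simp
    next
      case False
      then have "k - i + j > k" using ij by simp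
      then show ?thesis using * exact_order_top(3)[OF Q] exact_order_top(2)[OF P] by simp
    qed
  qed
  show ?thesis
  proof (cases "i \<le> j")
    case True
    then show ?thesis using main assms by blast
  next
    case False
    then have "px ((dbl ^^ j) Q) \<noteq> px ((dbl ^^ i) P)" using main[OF basis_sym[OF assms(1)]] assms by simp
    then show ?thesis by simp
  qed
qed

lemma basis_dbl: "basis (Suc k) P Q \<Longrightarrow> basis k (dbl P) (dbl Q)"
  unfolding basis_def dbl_pow_Suc by (auto simp: exact_order_Suc)

lemma off_multiples_neg [simp]: "off_multiples k Q (neg P) = off_multiples k Q P"
  by (simp add: off_multiples_def)

lemma basis_off: "basis k P Q \<Longrightarrow> off_multiples (Suc k) Q P"
  using basis_px_neq[of k P Q 0] by (auto simp: off_multiples_def basis_def exact_order_Suc)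

lemma basis_off_dbl: "basis (Suc k) P Q \<Longrightarrow> off_multiples (Suc (Suc k)) Q (dbl P)"
  using basis_px_neq[of "Suc k" P Q 1] by (auto simp: off_multiples_def basis_def exact_order_Suc)

lemma pairing_0: "basis 0 P Q \<Longrightarrow> pairing 0 P Q = - 1"
  using basis_px_neq[of 0 P Q 0 0] exact_order_py[of 0 P] exact_order_py[of 0 Q]
  by (auto simp: pairing_def miller_def basis_def divide_eq_eq)

text \<open>
  The compatibility of the Weil pairings of consecutive levels: the factors of the functions of
  \<open>P\<close> and \<open>Q\<close> that are not functions of \<open>2 P\<close> and \<open>2 Q\<close> cancel by reciprocity.
\<close>

lemma pairing_square:
  assumes b: "basis (Suc k) P Q"
  shows "pairing (Suc k) P Q ^ 2 = pairing k (dbl P) (dbl Q)"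
proof -
  define M where "M P Q = miller Q (neg P) ^ 2 * miller (neg P) (dbl Q)" for P Q
  have *: "millerF (Suc (Suc k)) Q (neg P) ^ 2 = M P Q ^ (2 ^ Suc k) * millerF (Suc k) (dbl Q) (neg (dbl P))"
    "M P Q = miller P (neg Q) ^ 2 * miller (neg Q) (dbl P)" "M P Q \<noteq> 0"
    if b: "basis (Suc k) P Q" for P Q
  proof -
    have ord: "exact_order (Suc (Suc k)) P" "exact_order (Suc (Suc k)) Q" using b by (auto simp: basis_def)
    note P = exact_order_affine[OF ord(1)] and Q = exact_order_affine[OF ord(2)]
    have nP: "neg P \<in> pts" "py (neg P) \<noteq> 0" using P by auto
    have inf: "P \<noteq> Infinity" "Q \<noteq> Infinity" "dbl P \<noteq> Infinity" "dbl Q \<noteq> Infinity" using P Q collinear_tangent(2) by auto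
    have dn: "dbl (neg P) = neg (dbl P)" using P neg_padd by simp
    have ne: "px Q \<noteq> px (dbl (neg P))" "px (neg P) \<noteq> px (dbl Q)" "px (dbl Q) \<noteq> px (dbl (neg P))"
      "px P \<noteq> px Q"
      using basis_px_neq[OF b, of 1 0] basis_px_neq[OF b, of 0 1] basis_px_neq[OF b, of 1 1]
        basis_px_neq[OF b, of 0 0] dn by auto
    have "off_multiples (Suc k) (dbl Q) (neg P)" "off_multiples (Suc k) (dbl Q) (dbl (neg P))"
      using basis_off[OF b] basis_off_dbl[OF b] dn by (auto simp: off_multiples_Suc[of "Suc k"])
    then have "millerF (Suc k) (dbl Q) (neg P) ^ 2 =
        millerF (Suc k) (dbl Q) (dbl (neg P)) * miller (neg P) (dbl Q) ^ (2 ^ Suc k)"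
      using ord nP by (intro millerF_reciprocity) (auto simp: exact_order_Suc[of "Suc k"])
    then show "millerF (Suc (Suc k)) Q (neg P) ^ 2 = M P Q ^ (2 ^ Suc k) * millerF (Suc k) (dbl Q) (neg (dbl P))"
      unfolding M_def dn millerF.simps(2)[of "Suc k"] power_mult_distrib
      by (simp only: mult_ac flip: power_mult)
    have "M P Q = - (miller (neg P) Q ^ 2 * miller Q (neg (dbl P)))"
      unfolding M_def using miller_reciprocity[OF Q nP ne(1-3)] dn by simp
    also have "miller (neg P) Q = - miller P (neg Q)" using miller_neg[OF P, of "neg Q"] by simp
    also have "miller Q (neg (dbl P)) = - miller (neg Q) (dbl P)"
      using miller_neg[of "neg Q" "dbl P"] Q by simp
    finally show "M P Q = miller P (neg Q) ^ 2 * miller (neg Q) (dbl P)" by simp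
    have "miller Q (neg P) \<noteq> 0" using P Q inf ne by (intro miller_nonzero) auto
    moreover have "miller (neg P) (dbl Q) \<noteq> 0" using P Q inf ne by (intro miller_nonzero) auto
    ultimately show "M P Q \<noteq> 0" by (simp add: M_def)
  qed
  have "M P Q = M Q P" using *(2)[OF b] by (simp add: M_def)
  then show ?thesis
    unfolding pairing_def power_divide *(1)[OF b] *(1)[OF basis_sym[OF b]] using *(3)[OF b] by simp
qed

text \<open>
  The pairing is thus a root of unity of exact order \<open>2 ^ (k + 1)\<close>: repeated squaring leads to the
  pairing of two different points of order two, which is \<open>- 1\<close>.
\<close>

lemma pairing_primitive: "basis k P Q \<Longrightarrow> pairing k P Q ^ (2 ^ k) = - 1"
proof (induction k arbitrary: P Q)
  case (Suc k)
  then show ?case using pairing_square[OF Suc.prems] basis_dbl[OF Suc.prems]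
    by (simp add: power_mult)
qed (simp add: pairing_0)

text \<open>
  For a two-torsion point \<open>T\<close>, the chord is the line through \<open>- P\<close>, \<open>T\<close> and \<open>P + T\<close>, and dividing by
  the vertical line through \<open>P + T\<close> gives a function with divisor \<open>(- P) + (T) - (- P - T) - (O)\<close>.
\<close>

definition chord_slope :: "'a point \<Rightarrow> 'a point \<Rightarrow> 'a" where
  "chord_slope P T = py P / (px T - px P)"

definition chord :: "'a point \<Rightarrow> 'a point \<Rightarrow> 'a point \<Rightarrow> 'a" where
  "chord P T R = py R - chord_slope P T * (px R - px T)"

definition chord_miller :: "'a point \<Rightarrow> 'a point \<Rightarrow> 'a point \<Rightarrow> 'a" where
  "chord_miller P T R = chord P T R / (px R - px (P \<boxplus> T))"

lemma collinear_chord: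
  assumes P: "P \<in> pts" "P \<noteq> Infinity" and T: "T \<in> pts" "T \<noteq> Infinity" "py T = 0"
    and ne: "px P \<noteq> px T"
  shows "collinear (chord_slope P T) (- (chord_slope P T * px T)) (px P) (- py P) (px T) 0 (px (P \<boxplus> T)) (py (P \<boxplus> T))"
    and "P \<boxplus> T \<noteq> Infinity"
proof -
  have nT: "neg T = T" using T by (metis Affine_px_py neg.simps(2) minus_zero)
  have in': "Affine (px P) (- py P) \<in> pts" "Affine (px T) 0 \<in> pts"
    using P T Affine_px_py[of P] Affine_px_py[of T] neg_in_pts[of P] by (metis neg.simps(2))+
  obtain l' v x3 y3 where c: "collinear l' v (px P) (- py P) (px T) 0 x3 y3"
    and s: "Affine (px P) (- py P) \<boxplus> Affine (px T) 0 = Affine x3 (- y3)"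
    using obtain_collinear[OF in'] ne by blast
  have "neg P \<boxplus> T = Affine x3 (- y3)"
    using s P T Affine_px_py[of P] Affine_px_py[of T] by (metis neg.simps(2))
  then have PT: "P \<boxplus> T = Affine x3 y3"
    using neg_padd[of P T] P T nT neg_neg[of "P \<boxplus> T"] by simp
  have v: "v = - (l' * px T)" using collinear_eqs(5)[OF c] by (simp add: add_eq_0_iff2)
  have "l' * (px T - px P) = py P" using collinear_eqs(4)[OF c] v by (simp add: algebra_simps)
  then have "l' = chord_slope P T" using ne by (simp add: chord_slope_def field_simps)
  then show "collinear (chord_slope P T) (- (chord_slope P T * px T)) (px P) (- py P) (px T) 0 (px (P \<boxplus> T)) (py (P \<boxplus> T))"
    using c v PT by simp
  show "P \<boxplus> T \<noteq> Infinity" using PT by simp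
qed

lemma chord_norm:
  assumes P: "P \<in> pts" "P \<noteq> Infinity" and T: "T \<in> pts" "T \<noteq> Infinity" "py T = 0"
    and ne: "px P \<noteq> px T" and R: "R \<in> pts" "R \<noteq> Infinity"
  shows "chord P T R * chord P T (neg R) =
    - ((px R - px P) * (px R - px T) * (px R - px (P \<boxplus> T)))"
proof -
  have "Affine (px R) (py R) \<in> pts" using R Affine_px_py by metis
  from line_norm[OF collinear_chord(1)[OF assms(1-6)] this]
  show ?thesis by (simp add: chord_def algebra_simps)
qed

text \<open>
  The analogue of \<open>miller_reciprocity\<close> with a chord in place of one of the tangents.
\<close>

lemma miller_chord_reciprocity:
  assumes P: "P \<in> pts" "P \<noteq> Infinity" and T: "T \<in> pts" "T \<noteq> Infinity" "py T = 0"
    and PT: "px P \<noteq> px T" and Q: "Q \<in> pts" "py Q \<noteq> 0"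
    and ne: "px (dbl Q) \<noteq> px P" "px (dbl Q) \<noteq> px T" "px (dbl Q) \<noteq> px (P \<boxplus> T)" "px Q \<noteq> px (P \<boxplus> T)"
  shows "miller Q (neg P) * miller Q T * chord_miller P T (dbl Q) =
    - (miller Q (neg (P \<boxplus> T)) * chord_miller P T Q ^ 2)"
proof -
  note c = collinear_chord[OF P T PT] and t = collinear_tangent[OF Q]
  define S where "S = P \<boxplus> T"
  have S: "S \<in> pts" "S \<noteq> Infinity" using P T c(2) by (auto simp: S_def)
  define z where "z = chord P T (neg (dbl Q)) * tang Q S"
  have "chord P T (neg (dbl Q)) \<noteq> 0"
    using chord_norm[OF P T PT padd_in_pts[OF Q(1) Q(1)] t(2)] ne by auto
  moreover have "tang Q S \<noteq> 0" using tang_nonzero[OF Q S] ne S_def by metis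
  ultimately have z: "z \<noteq> 0" by (simp add: z_def)
  have "miller Q (neg P) * miller Q T * chord_miller P T (dbl Q) * chord P T (neg (dbl Q)) =
      tang Q (neg P) * tang Q T * (chord P T (dbl Q) * chord P T (neg (dbl Q))) /
        ((px P - px (dbl Q)) * (px T - px (dbl Q)) * (px (dbl Q) - px S))"
    using Q by (simp add: miller_def chord_miller_def S_def mult_ac)
  also have "(px P - px (dbl Q)) * (px T - px (dbl Q)) * (px (dbl Q) - px S) =
      (px (dbl Q) - px P) * (px (dbl Q) - px T) * (px (dbl Q) - px S)"
    by (simp add: algebra_simps)
  also have "tang Q (neg P) * tang Q T * (chord P T (dbl Q) * chord P T (neg (dbl Q))) / \<dots> =
      - (tang Q (neg P) * tang Q T)"
    unfolding chord_norm[OF P T PT padd_in_pts[OF Q(1) Q(1)] t(2)] S_def using ne by simp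
  finally have L: "miller Q (neg P) * miller Q T * chord_miller P T (dbl Q) * chord P T (neg (dbl Q)) =
      - (tang Q (neg P) * tang Q T)" .
  have "miller Q (neg S) * chord_miller P T Q ^ 2 * tang Q S =
      chord P T Q ^ 2 * (tang Q S * tang Q (neg S)) / ((px S - px (dbl Q)) * (px Q - px S) ^ 2)"
    using Q by (simp add: miller_def chord_miller_def S_def power_divide mult_ac)
  also have "\<dots> = - (chord P T Q ^ 2)"
    unfolding tang_norm[OF Q S] power2_commute[of "px S" "px Q"] using ne unfolding S_def by simp
  finally have R: "miller Q (neg S) * chord_miller P T Q ^ 2 * tang Q S = - (chord P T Q ^ 2)" .
  have "chord P T Q * chord P T Q * chord P T (neg (dbl Q)) =
      - (tang Q (neg P) * tang Q T * tang Q S)"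
    using line_reciprocity[OF t(1) c(1)] T(3) by (simp add: tang_def chord_def S_def algebra_simps)
  then have rec: "tang Q (neg P) * tang Q T * tang Q S = - (chord P T Q ^ 2 * chord P T (neg (dbl Q)))"
    by (simp add: power2_eq_square)
  have "miller Q (neg P) * miller Q T * chord_miller P T (dbl Q) * z =
      - (tang Q (neg P) * tang Q T) * tang Q S"
    unfolding z_def L[symmetric] by simp
  also have "\<dots> = chord P T Q ^ 2 * chord P T (neg (dbl Q))" using rec by simp
  also have "chord P T Q ^ 2 = - (miller Q (neg S) * chord_miller P T Q ^ 2 * tang Q S)" using R by simp
  also have "\<dots> * chord P T (neg (dbl Q)) = - (miller Q (neg S) * chord_miller P T Q ^ 2) * z"
    by (simp add: z_def mult_ac)
  finally show ?thesis unfolding mult_right_cancel[OF z] S_def .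
qed

lemma chord_two_torsion:
  assumes P: "P \<in> pts" "P \<noteq> Infinity" and T: "T \<in> pts" "T \<noteq> Infinity" "py T = 0"
    and PT: "px P \<noteq> px T" and Q: "Q \<in> pts" "Q \<noteq> Infinity" "py Q = 0"
    and ne: "px Q \<noteq> px (P \<boxplus> T)"
  shows "miller Q (neg P) * miller Q T = miller Q (neg (P \<boxplus> T)) * chord_miller P T Q ^ 2"
proof -
  have "neg Q = Q" using Q by (metis Affine_px_py neg.simps(2) minus_zero)
  then have "chord P T Q ^ 2 = - ((px Q - px P) * (px Q - px T) * (px Q - px (P \<boxplus> T)))"
    using chord_norm[OF P T PT Q(1,2)] by (simp add: power2_eq_square)
  then have "miller Q (neg (P \<boxplus> T)) * chord_miller P T Q ^ 2 =
     (px (P \<boxplus> T) - px Q) * (- ((px Q - px P) * (px Q - px T) * (px Q - px (P \<boxplus> T)))) / (px Q - px (P \<boxplus> T)) ^ 2"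
    using Q by (simp add: miller_def chord_miller_def power_divide)
  also have "\<dots> = (px Q - px P) * (px Q - px T)"
    unfolding minus_diff_eq[of "px Q" "px (P \<boxplus> T)", symmetric] using ne
    by (simp add: power2_eq_square del: minus_diff_eq)
  also have "\<dots> = miller Q (neg P) * miller Q T"
    using Q(3) by (simp add: miller_def algebra_simps)
  finally show ?thesis by simp
qed

text \<open>
  By this comparison, translating \<open>P\<close> by \<open>T\<close> changes the value at \<open>- P\<close> of the function of \<open>Q\<close> by its
  value at \<open>T\<close> and a power of the chord.
\<close>

lemma millerF_chord:
  assumes P: "P \<in> pts" "P \<noteq> Infinity" and T: "T \<in> pts" "T \<noteq> Infinity" "py T = 0"
    and PT: "px P \<noteq> px T" and Q: "exact_order (Suc k) Q"
    and off: "off_multiples (Suc k) Q P" "off_multiples (Suc k) Q T" "off_multiples (Suc k) Q (P \<boxplus> T)"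
  shows "millerF (Suc k) Q (neg P) * millerF (Suc k) Q T =
    millerF (Suc k) Q (neg (P \<boxplus> T)) * chord_miller P T Q ^ (2 ^ Suc k)"
  using Q off
proof (induction k arbitrary: Q)
  case 0
  then have "Q \<in> pts" "Q \<noteq> Infinity" "py Q = 0" "px Q \<noteq> px (P \<boxplus> T)"
    using exact_order_py[of 0 Q] by (auto simp: exact_order_Suc off_multiples_def)
  from chord_two_torsion[OF P T PT this] show ?case by simp
next
  case (Suc k)
  note Q = exact_order_affine[OF Suc.prems(1)]
  have ne: "px (dbl Q) \<noteq> px P" "px (dbl Q) \<noteq> px T" "px (dbl Q) \<noteq> px (P \<boxplus> T)" "px Q \<noteq> px (P \<boxplus> T)"
    using Suc.prems(2-) by (auto simp: off_multiples_Suc)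
  have IH: "millerF (Suc k) (dbl Q) (neg P) * millerF (Suc k) (dbl Q) T =
      millerF (Suc k) (dbl Q) (neg (P \<boxplus> T)) * chord_miller P T (dbl Q) ^ (2 ^ Suc k)"
    using Suc.prems by (intro Suc.IH) (auto simp: exact_order_Suc[of "Suc k"] off_multiples_Suc[of "Suc k"])
  have "millerF (Suc (Suc k)) Q (neg P) * millerF (Suc (Suc k)) Q T =
      (miller Q (neg P) * miller Q T) ^ (2 ^ Suc k) *
        (millerF (Suc k) (dbl Q) (neg P) * millerF (Suc k) (dbl Q) T)"
    unfolding millerF.simps(2)[of "Suc k"] power_mult_distrib by (simp only: mult_ac)
  also have "\<dots> = (miller Q (neg P) * miller Q T * chord_miller P T (dbl Q)) ^ (2 ^ Suc k) *
      millerF (Suc k) (dbl Q) (neg (P \<boxplus> T))"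
    unfolding IH power_mult_distrib by (simp only: mult_ac)
  also have "\<dots> = (miller Q (neg (P \<boxplus> T)) * chord_miller P T Q ^ 2) ^ (2 ^ Suc k) *
      millerF (Suc k) (dbl Q) (neg (P \<boxplus> T))"
    unfolding miller_chord_reciprocity[OF P T PT Q ne] by simp
  also have "\<dots> = millerF (Suc (Suc k)) Q (neg (P \<boxplus> T)) * chord_miller P T Q ^ (2 ^ Suc (Suc k))"
    unfolding millerF.simps(2)[of "Suc k"] power_mult_distrib power_mult[symmetric]
    by (simp only: power_Suc[of 2 "Suc k"] mult_ac)
  finally show ?case .
qed

text \<open>
  The sign that makes the pairing change under translation comes from here: it enters at the last
  factor, that of a two-torsion point, and the other factors only contribute squares.
\<close>

lemma millerF_at_two_torsion:
  assumes T: "T \<in> pts" "T \<noteq> Infinity" "py T = 0" and Q: "exact_order (Suc k) Q"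
    and off: "off_multiples (Suc k) Q T"
  shows "millerF (Suc k) Q T = - ((px Q - px T) ^ (2 ^ k))"
  using Q off
proof (induction k arbitrary: Q)
  case 0
  then show ?case using exact_order_py[of 0 Q] by (simp add: miller_def)
next
  case (Suc k)
  note Q = exact_order_affine[OF Suc.prems(1)]
  have ne: "px T \<noteq> px (dbl Q)" using Suc.prems(2) by (auto simp: off_multiples_Suc)
  have IH: "millerF (Suc k) (dbl Q) T = - ((px (dbl Q) - px T) ^ (2 ^ k))"
    using Suc.prems by (intro Suc.IH) (auto simp: exact_order_Suc[of "Suc k"] off_multiples_Suc[of "Suc k"])
  have *: "miller Q T ^ 2 * (px (dbl Q) - px T) = (px Q - px T) ^ 2"
    using miller_two_torsion[OF T Q ne] T(3) by (simp add: miller_def)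
  have "millerF (Suc (Suc k)) Q T = - ((miller Q T ^ 2 * (px (dbl Q) - px T)) ^ (2 ^ k))"
    unfolding millerF.simps(2)[of "Suc k"] IH power_mult_distrib power_mult[symmetric] power_Suc[of 2 k]
    by simp
  also have "\<dots> = - ((px Q - px T) ^ (2 ^ Suc k))"
    unfolding * power_mult[symmetric] by simp
  finally show ?case .
qed

text \<open>
  The computation behind \<open>miller_translate\<close>: coordinates are centred at the two-torsion point, so that the
  curve is \<open>y\<^sup>2 = s (s\<^sup>2 + A s + B)\<close>, and the point \<open>(p, t p)\<close> of it determines \<open>B\<close>.
\<close>

lemma translate_identity:
  fixes A s y p t :: 'a
  assumes B: "B = t ^ 2 * p - p ^ 2 - A * p" and p': "p' = t ^ 2 - p - A"
    and y: "y ^ 2 = s ^ 3 + A * s ^ 2 + B * s" and t: "t \<noteq> 0"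
    and m: "2 * t * m = 2 * p + A + t ^ 2" and m': "- 2 * t * m' = 2 * p' + A + t ^ 2"
  shows "s * (- y - m * s - (t * p - m * p)) * (s - p') ^ 2 =
    (- y - m' * s - (- t * p' - m' * p')) * (y + t * s) ^ 2"
proof -
  have y2: "y * y = s ^ 3 + A * s ^ 2 + (t ^ 2 * p - p ^ 2 - A * p) * s"
    using y B by (simp add: power2_eq_square)
  have y2': "y * (y * z) = (s ^ 3 + A * s ^ 2 + (t ^ 2 * p - p ^ 2 - A * p) * s) * z" for z
    unfolding y2[symmetric] by simp
  have "2 * t * (s * (- y - m * s - (t * p - m * p)) * (s - p') ^ 2) =
      s * (- 2 * t * y - 2 * t ^ 2 * p - 2 * t * m * (s - p)) * (s - p') ^ 2"
    by (simp add: algebra_simps power2_eq_square)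
  also have "\<dots> = (- 2 * t * y + 2 * t ^ 2 * p' + - 2 * t * m' * (s - p')) * (y + t * s) ^ 2"
    unfolding m m' p' by (simp add: algebra_simps power2_eq_square power3_eq_cube y2 y2')
  also have "\<dots> = 2 * t * ((- y - m' * s - (- t * p' - m' * p')) * (y + t * s) ^ 2)"
    by (simp add: algebra_simps power2_eq_square)
  finally show ?thesis using t by simp
qed

text \<open>
  Both sides have divisor \<open>2 (T) - 2 (O) + 2 (- P) - (- 2 P) - (O)\<close> as functions of \<open>R\<close>, because
  \<open>2 (P + T) = 2 P\<close>; the computation shows that the constant is one.
\<close>

lemma miller_translate:
  assumes P: "P \<in> pts" "py P \<noteq> 0" and T: "T \<in> pts" "T \<noteq> Infinity" "py T = 0"
    and PT: "px P \<noteq> px T" "py (P \<boxplus> T) \<noteq> 0" and R: "R \<in> pts" "R \<noteq> Infinity"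
    and ne: "px R \<noteq> px (P \<boxplus> T)" "px R \<noteq> px (dbl P)"
  shows "(px R - px T) * miller P (neg R) = miller (P \<boxplus> T) (neg R) * chord_miller P T R ^ 2"
proof -
  have P0: "P \<noteq> Infinity" using P by auto
  define S where "S = P \<boxplus> T"
  define e where "e = px T"
  have dS: "dbl S = dbl P"
  proof -
    have "dbl T = Infinity" using T dbl_eq_Infinity_iff by simp
    then show ?thesis unfolding S_def using P(1) T(1)
      by (metis padd_assoc padd_comm padd_in_pts padd_Infinity)
  qed
  define p s t where "p = px P - e" and "s = px R - e" and "t = - chord_slope P T"
  have p: "p \<noteq> 0" using PT by (simp add: p_def e_def)
  have yP: "py P = t * p"
    using PT by (simp add: t_def p_def e_def chord_slope_def field_simps)
  note c = collinear_eqs[OF collinear_chord(1)[OF P(1) P0 T PT(1)], folded S_def e_def]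
  have p': "px S - e = t ^ 2 - p - 3 * e" using c(3) by (simp add: t_def p_def)
  have yS: "py S = - t * (px S - e)" using c(6) by (simp add: t_def algebra_simps)
  have t: "t \<noteq> 0" using yP P by auto
  have p'0: "px S - e \<noteq> 0" using yS PT S_def by auto
  have b: "b = - (e ^ 3 + a * e)"
    using curve_eq[OF T(1,2)] T(3) by (simp add: e_def add_eq_0_iff2)
  define B where "B = 3 * e ^ 2 + a"
  have shift: "py R' ^ 2 = (px R' - e) ^ 3 + 3 * e * (px R' - e) ^ 2 + B * (px R' - e)"
    if "R' \<in> pts" "R' \<noteq> Infinity" for R'
    unfolding curve_eq[OF that] b B_def by (simp add: algebra_simps power2_eq_square power3_eq_cube)
  have B: "B = t ^ 2 * p - p ^ 2 - 3 * e * p"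
  proof -
    have "p * B = p * (t ^ 2 * p - p ^ 2 - 3 * e * p)"
      using shift[OF P(1) P0] unfolding yP p_def[symmetric]
      by (simp add: algebra_simps power2_eq_square power3_eq_cube)
    then show ?thesis using p by simp
  qed
  have m: "2 * t * slope P = 2 * p + 3 * e + t ^ 2"
  proof -
    have "2 * t * slope P * p = 3 * px P ^ 2 + a"
      using P yP p t by (simp add: slope_def)
    also have "\<dots> = 3 * p ^ 2 + 6 * e * p + B"
      by (simp add: p_def B_def algebra_simps power2_eq_square)
    also have "\<dots> = (2 * p + 3 * e + t ^ 2) * p"
      unfolding B by (simp add: algebra_simps power2_eq_square)
    finally show ?thesis using p by simp
  qed
  have m': "- 2 * t * slope S = 2 * (px S - e) + 3 * e + t ^ 2"
  proof -
    have "- 2 * t * slope S * (px S - e) = 3 * px S ^ 2 + a"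
      using yS p'0 t by (simp add: slope_def)
    also have "\<dots> = 3 * (px S - e) ^ 2 + 6 * e * (px S - e) + B"
      by (simp add: B_def algebra_simps power2_eq_square)
    also have "\<dots> = (2 * (px S - e) + 3 * e + t ^ 2) * (px S - e)"
      unfolding B p' by (simp add: algebra_simps power2_eq_square)
    finally show ?thesis unfolding mult_right_cancel[OF p'0] .
  qed
  have id: "s * (- py R - slope P * s - (t * p - slope P * p)) * (s - (px S - e)) ^ 2 =
    (- py R - slope S * s - (- t * (px S - e) - slope S * (px S - e))) * (py R + t * s) ^ 2"
    using shift[OF R] by (intro translate_identity[OF B p' _ t m m']) (simp add: s_def)
  have tP: "tang P (neg R) = - py R - slope P * s - (t * p - slope P * p)"
    by (simp add: tang_def yP p_def s_def algebra_simps)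
  have tS: "tang S (neg R) = - py R - slope S * s - (- t * (px S - e) - slope S * (px S - e))"
    by (simp add: tang_def yS s_def algebra_simps)
  have ch: "chord P T R = py R + t * s" by (simp add: chord_def t_def s_def e_def)
  have "(px R - px T) * tang P (neg R) * (px R - px S) ^ 2 = tang S (neg R) * chord P T R ^ 2"
    using id unfolding tP tS ch by (simp add: s_def e_def)
  then have eq: "(px R - px T) * tang P (neg R) = tang S (neg R) * chord P T R ^ 2 / (px R - px S) ^ 2"
    using ne by (simp add: eq_divide_eq S_def)
  have "(px R - px T) * miller P (neg R) = (px R - px T) * tang P (neg R) / (px R - px (dbl P))"
    using P by (simp add: miller_def)
  also have "\<dots> = miller S (neg R) * chord_miller P T R ^ 2"
    unfolding eq using PT by (simp add: miller_def chord_miller_def S_def[symmetric] dS power_divide)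
  finally show ?thesis by (simp add: S_def)
qed

text \<open>
  The instance of bilinearity that matters: translation by \<open>T\<close> multiplies the pairing by the pairing
  of \<open>T\<close> with \<open>Q\<close>, which is \<open>- 1\<close> as \<open>T\<close> is not a multiple of \<open>Q\<close>. The powers of the chord that arise
  from the two functions cancel, and the sign of \<open>millerF_at_two_torsion\<close> remains.
\<close>

theorem pairing_translate:
  assumes b: "basis (Suc k) P Q" and T: "T \<in> pts" "T \<noteq> Infinity" "py T = 0"
    and TQ: "T \<noteq> (dbl ^^ Suc k) Q"
  shows "basis (Suc k) (P \<boxplus> T) Q" "pairing (Suc k) (P \<boxplus> T) Q = - pairing (Suc k) P Q"
proof -
  have ord: "exact_order (Suc (Suc k)) P" "exact_order (Suc (Suc k)) Q" using b by (auto simp: basis_def)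
  note P = exact_order_affine[OF ord(1)] and Q = exact_order_affine[OF ord(2)]
  have P0: "P \<noteq> Infinity" "Q \<noteq> Infinity" using P Q by auto
  have nT: "neg T = T" using T by (metis Affine_px_py neg.simps(2) minus_zero)
  have dT: "dbl T = Infinity" using T dbl_eq_Infinity_iff by simp
  define S where "S = P \<boxplus> T"
  have PT: "px P \<noteq> px T" using px_eq_iff[OF P(1) T(1) P0(1) T(2)] P(2) T(3) nT by auto
  have S: "S \<in> pts" "S \<noteq> Infinity" using collinear_chord(2)[OF P(1) P0(1) T PT] P T by (auto simp: S_def)
  have dS: "dbl S = dbl P"
    unfolding S_def using P(1) T(1) dT by (metis padd_assoc padd_comm padd_in_pts padd_Infinity)
  then have ordS: "exact_order (Suc (Suc k)) S"
    using ord(1) S by (simp add: exact_order_Suc)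
  then have yS: "py S \<noteq> 0" by (rule exact_order_affine)
  have bS: "basis (Suc k) S Q" using b ordS dS unfolding basis_def dbl_pow_Suc by simp
  then show "basis (Suc k) (P \<boxplus> T) Q" by (simp add: S_def)
  have offT: "off_multiples (Suc (Suc k)) Q T"
  proof -
    have "px T \<noteq> px ((dbl ^^ j) Q)" if j: "j < Suc (Suc k)" for j
    proof
      assume eq: "px T = px ((dbl ^^ j) Q)"
      have "(dbl ^^ j) Q \<noteq> Infinity" using ord(2) j unfolding exact_order_def by blast
      then have "T = (dbl ^^ j) Q \<or> neg T = neg (neg ((dbl ^^ j) Q))"
        using px_eq_iff[of T "(dbl ^^ j) Q"] eq T Q by auto
      then have eq': "T = (dbl ^^ j) Q" unfolding nT neg_neg by blast
      then have "(dbl ^^ Suc j) Q = Infinity" using dT by simp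
      moreover have "Suc j < Suc (Suc k)" using TQ eq' j by (cases "j = Suc k") auto
      ultimately show False using ord(2) unfolding exact_order_def by blast
    qed
    then show ?thesis using T by (simp add: off_multiples_def)
  qed
  have ne: "px Q \<noteq> px S" "px Q \<noteq> px (dbl P)" "px Q \<noteq> px P" "px Q \<noteq> px T"
    using basis_px_neq[OF bS, of 0 0] basis_px_neq[OF b, of 1 0] basis_px_neq[OF b, of 0 0] offT
    by (auto simp: off_multiples_Suc)
  define G where "G = chord_miller P T Q"
  have G: "G \<noteq> 0"
    using chord_norm[OF P(1) P0(1) T PT Q(1) P0(2)] ne by (auto simp: G_def chord_miller_def S_def)
  have F: "millerF (Suc (Suc k)) Q (neg P) * millerF (Suc (Suc k)) Q T =
      millerF (Suc (Suc k)) Q (neg S) * G ^ (2 ^ Suc (Suc k))"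
    unfolding G_def S_def using basis_off[OF b] offT basis_off[OF bS]
    by (intro millerF_chord[OF P(1) P0(1) T PT ord(2)]) (auto simp: S_def)
  have "millerF (Suc (Suc k)) Q T = - ((px Q - px T) ^ (2 ^ Suc k))"
    by (rule millerF_at_two_torsion[OF T ord(2) offT])
  with F have F: "millerF (Suc (Suc k)) Q (neg S) * G ^ (2 ^ Suc (Suc k)) =
      - (millerF (Suc (Suc k)) Q (neg P) * (px Q - px T) ^ (2 ^ Suc k))" by simp
  have tr: "(px Q - px T) * miller P (neg Q) = miller S (neg Q) * G ^ 2"
    unfolding S_def G_def using yS ne by (intro miller_translate[OF P T PT _ Q(1) P0(2)]) (auto simp: S_def)
  have split: "millerF (Suc (Suc k)) R (neg Q) =
      miller R (neg Q) ^ (2 ^ Suc k) * millerF (Suc k) (dbl R) (neg Q)" for R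
    by (rule millerF.simps)
  have "millerF (Suc (Suc k)) Q (neg S) * millerF (Suc (Suc k)) P (neg Q) * G ^ (2 ^ Suc (Suc k)) =
      (millerF (Suc (Suc k)) Q (neg S) * G ^ (2 ^ Suc (Suc k))) * millerF (Suc (Suc k)) P (neg Q)"
    by (simp only: mult_ac)
  also have "\<dots> = - (millerF (Suc (Suc k)) Q (neg P) * ((px Q - px T) * miller P (neg Q)) ^ (2 ^ Suc k) *
        millerF (Suc k) (dbl P) (neg Q))"
    unfolding F split power_mult_distrib by (simp only: mult_ac mult_minus_left mult_minus_right)
  also have "\<dots> = - (millerF (Suc (Suc k)) Q (neg P) * millerF (Suc (Suc k)) S (neg Q)) * G ^ (2 ^ Suc (Suc k))"
    unfolding tr split dS power_mult_distrib power_mult[symmetric] power_Suc[of 2 "Suc k", symmetric]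
    by (simp only: mult_ac mult_minus_left mult_minus_right)
  finally have eq: "millerF (Suc (Suc k)) Q (neg S) * millerF (Suc (Suc k)) P (neg Q) =
      - (millerF (Suc (Suc k)) Q (neg P) * millerF (Suc (Suc k)) S (neg Q))"
    unfolding mult_right_cancel[OF power_not_zero[OF G]] .
  have nz: "millerF (Suc (Suc k)) P (neg Q) \<noteq> 0" "millerF (Suc (Suc k)) S (neg Q) \<noteq> 0"
    using millerF_nonzero[OF ord(1)] millerF_nonzero[OF ordS] basis_off[OF basis_sym[OF b]]
      basis_off[OF basis_sym[OF bS]] by auto
  show "pairing (Suc k) (P \<boxplus> T) Q = - pairing (Suc k) P Q"
    unfolding S_def[symmetric] pairing_def using eq nz
    by (simp add: field_simps del: millerF.simps)
qed

end


section \<open>Automorphisms of an algebraic closure\<close>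

definition is_subfield :: "'a :: field set \<Rightarrow> bool" where
  "is_subfield L \<longleftrightarrow> 1 \<in> L \<and> (\<forall>x\<in>L. \<forall>y\<in>L. x - y \<in> L \<and> x * y \<in> L) \<and> (\<forall>x\<in>L. inverse x \<in> L)"

definition field_automorphism :: "('a :: field \<Rightarrow> 'a) \<Rightarrow> bool" where
  "field_automorphism \<sigma> \<longleftrightarrow>
     bij \<sigma> \<and> (\<forall>x y. \<sigma> (x + y) = \<sigma> x + \<sigma> y) \<and> (\<forall>x y. \<sigma> (x * y) = \<sigma> x * \<sigma> y)"

text \<open>
  Homomorphisms from a subring to the field that fix \<open>L\<close> are handled through their graphs, which
  are subrings of the square of the field; unions of chains are then immediate.
\<close>

definition hom_graph :: "'a :: field set \<Rightarrow> ('a \<times> 'a) set \<Rightarrow> bool" where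
  "hom_graph L G \<longleftrightarrow> (\<forall>x\<in>L. (x, x) \<in> G) \<and>
     (\<forall>x x' y y'. (x, x') \<in> G \<longrightarrow> (y, y') \<in> G \<longrightarrow> (x - y, x' - y') \<in> G \<and> (x * y, x' * y') \<in> G) \<and>
     (\<forall>x'. (0, x') \<in> G \<longrightarrow> x' = 0)"

text \<open>
  The relation between a polynomial and its image under the homomorphism with graph \<open>G\<close>.
\<close>

definition related :: "('a \<times> 'a) set \<Rightarrow> 'a :: field poly \<Rightarrow> 'a poly \<Rightarrow> bool" where
  "related G f f' \<longleftrightarrow> (\<forall>i. (poly.coeff f i, poly.coeff f' i) \<in> G)"

locale algebraic_over =
  fixes L :: "'a :: {alg_closed_field, field_char_0} set"
  assumes L: "is_subfield L"
    and algebraic: "\<And>x. \<exists>p. p \<noteq> 0 \<and> (\<forall>i. poly.coeff p i \<in> L) \<and> poly p x = 0"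
begin

context
  fixes G assumes G: "hom_graph L G"
begin

lemma graph_diag: "x \<in> L \<Longrightarrow> (x, x) \<in> G"
  and graph_diff: "(x, x') \<in> G \<Longrightarrow> (y, y') \<in> G \<Longrightarrow> (x - y, x' - y') \<in> G"
  and graph_mult: "(x, x') \<in> G \<Longrightarrow> (y, y') \<in> G \<Longrightarrow> (x * y, x' * y') \<in> G"
  and graph_zero: "(0, x') \<in> G \<Longrightarrow> x' = 0"
  using G unfolding hom_graph_def by blast+

lemma graph_1: "(1, 1) \<in> G" and graph_0: "(0, 0) \<in> G"
  using graph_diag[of 1] graph_diff[of 1 1 1 1] L by (auto simp: is_subfield_def)

lemma graph_add: "(x, x') \<in> G \<Longrightarrow> (y, y') \<in> G \<Longrightarrow> (x + y, x' + y') \<in> G"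
  using graph_diff[of x x' "0 - y" "0 - y'"] graph_diff[OF graph_0, of y y'] by simp

lemma graph_fun: "(x, x') \<in> G \<Longrightarrow> (x, x'') \<in> G \<Longrightarrow> x' = x''"
  using graph_diff[of x x' x x''] graph_zero by force

lemma graph_sum: "(\<And>i. i \<in> A \<Longrightarrow> (f i, g i) \<in> G) \<Longrightarrow> (sum f A, sum g A) \<in> G"
  by (induction A rule: infinite_finite_induct) (auto intro: graph_0 graph_add)

lemma graph_power: "(x, x') \<in> G \<Longrightarrow> (x ^ n, x' ^ n) \<in> G"
  by (induction n) (auto intro: graph_1 graph_mult)

lemma related_diff: "related G f f' \<Longrightarrow> related G g g' \<Longrightarrow> related G (f - g) (f' - g')"
  by (auto simp: related_def intro: graph_diff)

lemma related_mult: "related G f f' \<Longrightarrow> related G g g' \<Longrightarrow> related G (f * g) (f' * g')"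
  by (auto simp: related_def coeff_mult intro!: graph_sum graph_mult)

lemma related_monom: "(c, c') \<in> G \<Longrightarrow> related G (Polynomial.monom c n) (Polynomial.monom c' n)"
  by (auto simp: related_def intro: graph_0)

lemma related_const: "(c, c') \<in> G \<Longrightarrow> related G [:c:] [:c':]"
  by (auto simp: related_def coeff_pCons intro: graph_0 split: nat.splits)

lemma related_self: "(\<And>i. poly.coeff p i \<in> L) \<Longrightarrow> related G p p"
  by (auto simp: related_def intro: graph_diag)

lemma related_degree_le: "related G f f' \<Longrightarrow> Polynomial.degree f' \<le> Polynomial.degree f"
  unfolding related_def by (intro degree_le allI impI) (metis coeff_eq_0 graph_zero)

lemma related_zero: "related G 0 f' \<Longrightarrow> f' = 0"
  unfolding related_def by (intro poly_eqI) (metis coeff_0 graph_zero)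

lemma related_poly:
  assumes "related G f f'" "(x, x') \<in> G"
  shows "(poly f x, poly f' x') \<in> G"
proof -
  have "poly f' x' = (\<Sum>i\<le>Polynomial.degree f. poly.coeff f' i * x' ^ i)"
    unfolding poly_altdef
    using related_degree_le[OF assms(1)] by (intro sum.mono_neutral_left) (auto simp: coeff_eq_0)
  then show ?thesis
    unfolding poly_altdef[of f] using assms
    by (auto simp: related_def intro!: graph_sum graph_mult graph_power)
qed

text \<open>
  A homomorphism extends to a simple algebraic extension by sending the generator to a root of
  the image of its minimal polynomial.
\<close>

lemma hom_graph_adjoin:
  assumes p: "related G p p'" and monic: "lead_coeff p = 1"
    and root: "poly p z = 0" and root': "poly p' z' = 0"
    and min: "\<And>f f'. related G f f' \<Longrightarrow> f \<noteq> 0 \<Longrightarrow> poly f z = 0 \<Longrightarrow> Polynomial.degree p \<le> Polynomial.degree f"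
  shows "\<exists>G'. hom_graph L G' \<and> G \<subseteq> G' \<and> (z, z') \<in> G'"
proof -
  define d where "d = Polynomial.degree p"
  have "d \<noteq> 0"
  proof
    assume "d = 0"
    then obtain c where "p = [:c:]" using degree_0_id[of p] by (metis d_def)
    then show False using monic root by auto
  qed
  have pd': "poly.coeff p' d = 1"
    using p monic graph_1 graph_fun unfolding related_def d_def by metis
  have zero: "poly f' z' = 0" if "related G f f'" "poly f z = 0" for f f'
    using that
  proof (induction "Polynomial.degree f" arbitrary: f f' rule: less_induct)
    case (less f f')
    show ?case
    proof (cases "f = 0")
      case True
      then have "f' = 0" using less.prems(1) by (auto intro: related_zero)
      then show ?thesis by simp
    next
      case False
      define n where "n = Polynomial.degree f"
      have n: "d \<le> n" using min[OF less.prems(1) False less.prems(2)] by (simp add: d_def n_def)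
      define c c' where "c = poly.coeff f n" and "c' = poly.coeff f' n"
      define g where "g = f - Polynomial.monom c (n - d) * p"
      define g' where "g' = f' - Polynomial.monom c' (n - d) * p'"
      have rel: "related G g g'"
        unfolding g_def g'_def c_def c'_def using less.prems(1) p
        by (intro related_diff related_mult related_monom) (auto simp: related_def)
      have "Polynomial.degree g < n"
      proof (rule degree_lessI)
        have "Polynomial.degree (Polynomial.monom c (n - d) * p) \<le> n"
          using degree_mult_le[of "Polynomial.monom c (n - d)" p] degree_monom_le[of c "n - d"] n
          by (simp add: d_def)
        moreover have "poly.coeff g n = 0"
          using n monic by (simp add: g_def c_def coeff_monom_mult d_def)
        ultimately show "\<forall>k\<ge>n. poly.coeff g k = 0"
          by (metis (no_types, lifting) coeff_eq_0 degree_diff_le_max g_def le_less_trans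
              le_neq_implies_less max.bounded_iff n_def order_refl)
        show "g \<noteq> 0 \<or> 0 < n" using \<open>d \<noteq> 0\<close> n by auto
      qed
      moreover have "poly g z = 0" using less.prems root by (simp add: g_def)
      ultimately have "poly g' z' = 0" using less.hyps[of g g'] rel by (simp add: n_def)
      then show ?thesis using root' by (simp add: g'_def)
    qed
  qed
  define G' where "G' = {(poly f z, poly f' z') | f f'. related G f f'}"
  have sub: "G \<subseteq> G'"
  proof
    fix w assume "w \<in> G"
    then show "w \<in> G'"
      unfolding G'_def using related_const[of "fst w" "snd w"]
      by (intro CollectI exI[of _ "[:fst w:]"] exI[of _ "[:snd w:]"]) auto
  qed
  have "(poly [:0, 1:] z, poly [:0, 1:] z') \<in> G'"
    unfolding G'_def using related_self[of "[:0, 1:]"] L graph_0 graph_1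
    by (intro CollectI exI[of _ "[:0, 1:]"])
       (auto simp: related_def coeff_pCons split: nat.splits)
  moreover have "hom_graph L G'"
    unfolding hom_graph_def
  proof (intro conjI allI impI ballI)
    fix x assume "x \<in> L" then show "(x, x) \<in> G'" using sub graph_diag by auto
  next
    fix x x' y y' assume "(x, x') \<in> G'" "(y, y') \<in> G'"
    then obtain f f' g g' where fg: "related G f f'" "related G g g'"
      "x = poly f z" "x' = poly f' z'" "y = poly g z" "y' = poly g' z'"
      unfolding G'_def by auto
    show "(x - y, x' - y') \<in> G'"
      unfolding G'_def using fg related_diff[OF fg(1,2)]
      by (intro CollectI exI[of _ "f - g"] exI[of _ "f' - g'"]) auto
    show "(x * y, x' * y') \<in> G'"
      unfolding G'_def using fg related_mult[OF fg(1,2)]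
      by (intro CollectI exI[of _ "f * g"] exI[of _ "f' * g'"]) auto
  next
    fix x' assume "(0, x') \<in> G'"
    then show "x' = 0" unfolding G'_def using zero by auto
  qed
  ultimately show ?thesis using sub by auto
qed

text \<open>
  A nonzero element is a root of a polynomial over \<open>L\<close> with nonzero constant term. Its image
  satisfies the same equation, so it cannot vanish.
\<close>

lemma graph_inj: assumes "(y, 0) \<in> G" shows "y = 0"
proof (rule ccontr)
  assume y: "y \<noteq> 0"
  let ?P = "\<lambda>p. p \<noteq> 0 \<and> (\<forall>i. poly.coeff p i \<in> L) \<and> poly p y = 0"
  obtain p where p: "?P p" and min: "\<And>q. ?P q \<Longrightarrow> Polynomial.degree p \<le> Polynomial.degree q"
    using ex_has_least_nat[of ?P _ Polynomial.degree] algebraic[of y] by metis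
  have "poly.coeff p 0 \<noteq> 0"
  proof
    assume c0: "poly.coeff p 0 = 0"
    obtain c q where q: "p = pCons c q" by (cases p)
    then have "c = 0" using c0 by simp
    then have "?P q" using p q y by (metis coeff_pCons_Suc mult_eq_0_iff pCons_0_0 poly_pCons add_0)
    moreover have "Polynomial.degree q < Polynomial.degree p" using q p \<open>c = 0\<close> by auto
    ultimately show False using min by fastforce
  qed
  moreover have "(poly p y, poly p 0) \<in> G" using related_poly[OF related_self assms] p by blast
  then have "poly p 0 = 0" using p graph_zero by simp
  ultimately show False by (simp add: poly_0_coeff_0)
qed

lemma hom_graph_fractions:
  "hom_graph L {(x / y, x' / y') | x x' y y'. (x, x') \<in> G \<and> (y, y') \<in> G \<and> y \<noteq> 0}" (is "hom_graph L ?F")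
  unfolding hom_graph_def
proof (intro conjI allI impI ballI)
  have F: "(x / y, x' / y') \<in> ?F" if "(x, x') \<in> G" "(y, y') \<in> G" "y \<noteq> 0" for x x' y y'
    using that by blast
  show "(x, x) \<in> ?F" if "x \<in> L" for x using F[OF graph_diag[OF that] graph_1] by simp
  fix u u' v v' assume "(u, u') \<in> ?F" "(v, v') \<in> ?F"
  then obtain x x' y y' z z' w w' where *: "(x, x') \<in> G" "(y, y') \<in> G" "y \<noteq> 0" "u = x / y" "u' = x' / y'"
    "(z, z') \<in> G" "(w, w') \<in> G" "w \<noteq> 0" "v = z / w" "v' = z' / w'" by blast
  then have nz: "y' \<noteq> 0" "w' \<noteq> 0" using graph_inj by auto
  have "((x * w - z * y) / (y * w), (x' * w' - z' * y') / (y' * w')) \<in> ?F"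
    using * by (intro F graph_mult graph_diff) auto
  moreover have "((x * w - z * y) / (y * w), (x' * w' - z' * y') / (y' * w')) = (u - v, u' - v')"
    using * nz by (simp add: diff_frac_eq)
  ultimately show "(u - v, u' - v') \<in> ?F" by simp
  have "((x * z) / (y * w), (x' * z') / (y' * w')) \<in> ?F"
    using * by (intro F graph_mult) auto
  then show "(u * v, u' * v') \<in> ?F" using * by simp
next
  fix x' assume "(0, x') \<in> ?F"
  then show "x' = 0" using graph_zero by force
qed

end

text \<open>
  A maximal homomorphism is defined on a field, since it extends to fractions. There minimal
  polynomials can be made monic, and the field being algebraically closed, their images have
  roots to which the generators can be sent.
\<close>

lemma maximal_hom_graph_total:
  assumes G: "hom_graph L G" and max: "\<And>G'. hom_graph L G' \<Longrightarrow> G \<subseteq> G' \<Longrightarrow> G' = G"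
  shows "\<exists>z'. (z, z') \<in> G"
proof -
  have frac: "(x / y, x' / y') \<in> G" if "(x, x') \<in> G" "(y, y') \<in> G" "y \<noteq> 0" for x x' y y'
  proof -
    let ?F = "{(x / y, x' / y') | x x' y y'. (x, x') \<in> G \<and> (y, y') \<in> G \<and> y \<noteq> 0}"
    have "G \<subseteq> ?F"
    proof
      fix w assume "w \<in> G"
      then show "w \<in> ?F" using graph_1[OF G]
        by (intro CollectI exI[of _ "fst w"] exI[of _ "snd w"] exI[of _ 1]) auto
    qed
    then show ?thesis using max[OF hom_graph_fractions[OF G]] that by blast
  qed
  let ?P = "\<lambda>(f, f'). f \<noteq> 0 \<and> related G f f' \<and> poly f z = 0"
  obtain p where "p \<noteq> 0 \<and> (\<forall>i. poly.coeff p i \<in> L) \<and> poly p z = 0" using algebraic by blast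
  then have "?P (p, p)" using related_self[OF G] by auto
  from ex_has_least_nat[of ?P, OF this, of "\<lambda>w. Polynomial.degree (fst w)"]
  obtain w where w: "?P w" and
    min: "\<And>w'. ?P w' \<Longrightarrow> Polynomial.degree (fst w) \<le> Polynomial.degree (fst w')"
    by blast
  obtain f f' where "w = (f, f')" by (cases w)
  then have f: "f \<noteq> 0" "related G f f'" "poly f z = 0" using w by auto
  have min: "Polynomial.degree f \<le> Polynomial.degree g" if "related G g g'" "g \<noteq> 0" "poly g z = 0" for g g'
    using min[of "(g, g')"] that \<open>w = (f, f')\<close> by auto
  define d where "d = Polynomial.degree f"
  define c c' where "c = poly.coeff f d" and "c' = poly.coeff f' d"
  have cc: "(c, c') \<in> G" "c \<noteq> 0" using f by (auto simp: c_def c'_def related_def d_def)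
  then have c': "c' \<noteq> 0" using graph_inj[OF G] by auto
  define q q' where "q = Polynomial.smult (1 / c) f" and "q' = Polynomial.smult (1 / c') f'"
  have rel: "related G q q'"
    unfolding q_def q'_def related_def using f(2) frac[OF _ cc]
    by (auto simp: related_def)
  have degq: "Polynomial.degree q = d" using cc by (simp add: q_def d_def)
  have "Polynomial.degree f' = d"
    using related_degree_le[OF G f(2)] le_degree[of f' d] c' by (simp add: d_def c'_def)
  moreover have "d \<noteq> 0"
  proof
    assume "d = 0"
    then obtain e where "f = [:e:]" using degree_0_id[of f] by (metis d_def)
    then show False using f by auto
  qed
  ultimately have "Polynomial.degree q' > 0" using c' by (simp add: q'_def)
  then obtain z' where "poly q' z' = 0" using alg_closed_imp_poly_has_root by blast
  moreover have "lead_coeff q = 1" using cc by (simp add: q_def c_def d_def)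
  moreover have "poly q z = 0" using f by (simp add: q_def)
  ultimately obtain G' where "hom_graph L G'" "G \<subseteq> G'" "(z, z') \<in> G'"
    using hom_graph_adjoin[OF G rel] min degq unfolding d_def by metis
  then show ?thesis using max by blast
qed

text \<open>
  Zorn's lemma provides a total homomorphism. It is surjective because it permutes the finitely
  many roots of each polynomial over \<open>L\<close>.
\<close>

lemma hom_graph_extends:
  assumes G0: "hom_graph L G0"
  shows "\<exists>\<sigma>. field_automorphism \<sigma> \<and> (\<forall>(x, x') \<in> G0. \<sigma> x = x')"
proof -
  let ?A = "{G. hom_graph L G \<and> G0 \<subseteq> G}"
  have "\<exists>G\<in>?A. \<forall>G'\<in>?A. G \<subseteq> G' \<longrightarrow> G' = G"
  proof (rule subset_Zorn_nonempty)
    show "?A \<noteq> {}" using G0 by auto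
  next
    fix C assume C: "C \<noteq> {}" "subset.chain ?A C"
    have hom: "hom_graph L G" if "G \<in> C" for G using C that by (auto simp: subset_chain_def)
    have lin: "G \<subseteq> G' \<or> G' \<subseteq> G" if "G \<in> C" "G' \<in> C" for G G'
      using C that by (auto simp: subset_chain_def)
    have two: "\<exists>G\<in>C. p \<in> G \<and> q \<in> G" if pq: "p \<in> \<Union>C" "q \<in> \<Union>C" for p q
    proof -
      from pq obtain G G' where "G \<in> C" "p \<in> G" "G' \<in> C" "q \<in> G'" by (elim UnionE)
      then show ?thesis using lin[of G G'] by (metis subsetD)
    qed
    have "hom_graph L (\<Union>C)"
      unfolding hom_graph_def
    proof (intro conjI allI impI ballI)
      fix x assume "x \<in> L"
      moreover obtain G where "G \<in> C" using C by auto
      ultimately show "(x, x) \<in> \<Union>C" using graph_diag[OF hom] by (meson UnionI)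
    next
      fix x x' y y' assume "(x, x') \<in> \<Union>C" "(y, y') \<in> \<Union>C"
      then obtain G where "G \<in> C" "(x, x') \<in> G" "(y, y') \<in> G" using two by blast
      then show "(x - y, x' - y') \<in> \<Union>C" "(x * y, x' * y') \<in> \<Union>C"
        using graph_diff[OF hom] graph_mult[OF hom] by (meson UnionI)+
    next
      fix x' assume "(0, x') \<in> \<Union>C" then show "x' = 0" using graph_zero[OF hom] by (elim UnionE)
    qed
    moreover have "G0 \<subseteq> \<Union>C" using C by (force simp: subset_chain_def)
    ultimately show "\<Union>C \<in> ?A" by simp
  qed
  then obtain G where "G \<in> ?A" and maxA: "\<forall>G'\<in>?A. G \<subseteq> G' \<longrightarrow> G' = G" by (elim bexE)
  then have G: "hom_graph L G" "G0 \<subseteq> G" by auto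
  have max: "G' = G" if "hom_graph L G'" "G \<subseteq> G'" for G'
    using maxA[rule_format, of G'] that G(2) by simp
  have tot: "\<exists>z'. (z, z') \<in> G" for z using maximal_hom_graph_total[OF G(1) max] .
  define \<sigma> where "\<sigma> z = (THE z'. (z, z') \<in> G)" for z
  have \<sigma>: "\<sigma> z = z'" if "(z, z') \<in> G" for z z'
    unfolding \<sigma>_def using graph_fun[OF G(1)] that by blast
  have in_G: "(z, \<sigma> z) \<in> G" for z using tot \<sigma> by metis
  have add: "\<sigma> (x + y) = \<sigma> x + \<sigma> y" for x y using \<sigma>[OF graph_add[OF G(1) in_G in_G]] .
  have mult: "\<sigma> (x * y) = \<sigma> x * \<sigma> y" for x y using \<sigma>[OF graph_mult[OF G(1) in_G in_G]] .
  have inj: "inj \<sigma>"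
  proof (rule injI)
    fix x y assume "\<sigma> x = \<sigma> y"
    then have "(x - y, 0) \<in> G" using graph_diff[OF G(1) in_G[of x] in_G[of y]] by simp
    then show "x = y" using graph_inj[OF G(1)] by fastforce
  qed
  moreover have "surj \<sigma>"
  proof -
    have "y \<in> range \<sigma>" for y
    proof -
      obtain p where p: "p \<noteq> 0" "\<forall>i. poly.coeff p i \<in> L" "poly p y = 0" using algebraic by blast
      let ?R = "{x. poly p x = 0}"
      have "poly p (\<sigma> x) = 0" if "poly p x = 0" for x
        using related_poly[OF G(1) related_self[OF G(1)] in_G[of x], of p] p that graph_zero[OF G(1)] by simp
      then have "\<sigma> ` ?R \<subseteq> ?R" by auto
      moreover have "finite ?R" using p poly_roots_finite by blast
      ultimately have "\<sigma> ` ?R = ?R" using inj by (intro endo_inj_surj) (auto intro: inj_on_subset)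
      then show ?thesis using p by blast
    qed
    then show ?thesis by auto
  qed
  ultimately show ?thesis using add mult \<sigma> G(2) unfolding field_automorphism_def bij_def by blast
qed

text \<open>
  The minimal polynomial of \<open>z\<close> is separable in characteristic zero and not linear, so it has
  another root. The homomorphism from \<open>L(z)\<close> that sends \<open>z\<close> to this root extends.
\<close>

theorem automorphism_moving:
  assumes z: "z \<notin> L"
  shows "\<exists>\<sigma>. field_automorphism \<sigma> \<and> (\<forall>x\<in>L. \<sigma> x = x) \<and> \<sigma> z \<noteq> z"
proof -
  define D where "D = {(x, x) | x. x \<in> L}"
  have D: "hom_graph L D" using L unfolding hom_graph_def D_def is_subfield_def by auto
  have rel: "related D f f' \<longleftrightarrow> f' = f \<and> (\<forall>i. poly.coeff f i \<in> L)" for f f'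
    by (auto simp: related_def D_def poly_eq_iff)
  let ?P = "\<lambda>p. p \<noteq> 0 \<and> (\<forall>i. poly.coeff p i \<in> L) \<and> poly p z = 0"
  obtain f where f: "?P f" and min: "\<And>q. ?P q \<Longrightarrow> Polynomial.degree f \<le> Polynomial.degree q"
    using ex_has_least_nat[of ?P _ Polynomial.degree] algebraic[of z] by metis
  define c where "c = lead_coeff f"
  define p where "p = Polynomial.smult (inverse c) f"
  have c: "c \<noteq> 0" "inverse c \<in> L" using f L by (auto simp: c_def is_subfield_def)
  have p: "?P p" "lead_coeff p = 1" "Polynomial.degree p = Polynomial.degree f"
    using f c L by (auto simp: p_def c_def is_subfield_def)
  have pd: "pderiv p \<noteq> 0" "Polynomial.degree p \<noteq> 0"
  proof -
    show *: "Polynomial.degree p \<noteq> 0"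
    proof
      assume "Polynomial.degree p = 0"
      then obtain e where "p = [:e:]" using degree_0_id[of p] by metis
      then show False using p by auto
    qed
    then show "pderiv p \<noteq> 0" by (simp add: pderiv_eq_0_iff)
  qed
  have "poly (pderiv p) z \<noteq> 0"
  proof
    assume "poly (pderiv p) z = 0"
    moreover have "poly.coeff (pderiv p) i \<in> L" for i
    proof -
      have "of_nat n \<in> L" for n
      proof (induction n)
        case 0 then show ?case using L unfolding is_subfield_def by (metis diff_self of_nat_0)
      next
        case (Suc n)
        have "1 - (0 - of_nat n) \<in> L" using Suc L unfolding is_subfield_def by (metis diff_self)
        then show ?case by simp
      qed
      then show ?thesis using p L unfolding coeff_pderiv is_subfield_def by blast
    qed
    ultimately have "Polynomial.degree f \<le> Polynomial.degree (pderiv p)" using pd min by blast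
    then show False using pd p(3) by (simp add: degree_pderiv)
  qed
  obtain q where q: "p = [:- z, 1:] * q" using p by (metis poly_eq_0_iff_dvd dvdE)
  have "poly (pderiv p) z = poly q z"
    unfolding q pderiv_mult by (simp add: pderiv_pCons del: mult_pCons_left)
  then have qz: "poly q z \<noteq> 0" using \<open>poly (pderiv p) z \<noteq> 0\<close> by simp
  have "q \<noteq> 0" using q p by auto
  then have deg: "Polynomial.degree p = Suc (Polynomial.degree q)"
    unfolding q by (subst degree_mult_eq) auto
  have "Polynomial.degree q \<noteq> 0"
  proof
    assume "Polynomial.degree q = 0"
    then obtain e where e: "q = [:e:]" using degree_0_id[of q] by metis
    then have "p = [:- z * e, e:]" using q by simp
    then have "e = 1" using p(2) deg e by simp
    then have "poly.coeff p 0 = - z" using \<open>p = [:- z * e, e:]\<close> by simp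
    then have "- z \<in> L" using p by metis
    then have "(1 - 1) - (- z) \<in> L" using L unfolding is_subfield_def by blast
    then show False using z by simp
  qed
  then obtain z' where z': "poly q z' = 0" using alg_closed_imp_poly_has_root by blast
  then have "z' \<noteq> z" "poly p z' = 0" using qz q by auto
  have "\<exists>G. hom_graph L G \<and> D \<subseteq> G \<and> (z, z') \<in> G"
  proof (rule hom_graph_adjoin[OF D])
    show "related D p p" using rel p by blast
    show "Polynomial.degree p \<le> Polynomial.degree g" if "related D g g'" "g \<noteq> 0" "poly g z = 0" for g g'
      using min[of g] p(3) that rel by auto
  qed (use p \<open>poly p z' = 0\<close> in auto)
  then obtain G where G: "hom_graph L G" "D \<subseteq> G" "(z, z') \<in> G" by blast
  obtain \<sigma> where \<sigma>: "field_automorphism \<sigma>" "\<forall>(x, x') \<in> G. \<sigma> x = x'"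
    using hom_graph_extends[OF G(1)] by blast
  have "\<sigma> z = z'" "\<And>x. x \<in> L \<Longrightarrow> \<sigma> x = x" using \<sigma>(2) G by (auto simp: D_def)
  then show ?thesis using \<sigma> \<open>z' \<noteq> z\<close> by blast
qed

end


section \<open>Forms and morphisms\<close>

lemma finite_form_index: "finite {(i, j). i + j \<le> (d :: nat)}"
  by (rule finite_subset[of _ "{..d} \<times> {..d}"]) auto

lemma form_zero: "ternary_form d (\<lambda>v. 0)"
  unfolding ternary_form_def by (intro exI[of _ "\<lambda>_ _. 0"]) auto

lemma form_monom:
  assumes "i + j \<le> d"
  shows "ternary_form d (\<lambda>(x, y, z). k * x ^ i * y ^ j * z ^ (d - i - j))"
  unfolding ternary_form_def
proof (intro exI[of _ "\<lambda>i' j'. if i' = i \<and> j' = j then k else 0"] ext, clarify)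
  fix x y z :: 'a
  have "(\<Sum>(i', j')\<in>{(i, j). i + j \<le> d}. (if i' = i \<and> j' = j then k else 0) * x ^ i' * y ^ j' * z ^ (d - i' - j')) =
      (\<Sum>p\<in>{(i, j). i + j \<le> d}. if p = (i, j) then k * x ^ i * y ^ j * z ^ (d - i - j) else 0)"
  proof (intro sum.cong refl)
    fix p :: "nat \<times> nat"
    show "(case p of (i', j') \<Rightarrow> (if i' = i \<and> j' = j then k else 0) * x ^ i' * y ^ j' * z ^ (d - i' - j')) =
        (if p = (i, j) then k * x ^ i * y ^ j * z ^ (d - i - j) else 0)"
    proof (cases "p = (i, j)")
      case False
      then have "\<not> (fst p = i \<and> snd p = j)" by (cases p) auto
      then show ?thesis using False by (auto simp: case_prod_unfold)
    qed simp
  qed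
  also have "\<dots> = k * x ^ i * y ^ j * z ^ (d - i - j)"
    using assms finite_form_index[of d] by (subst sum.delta) auto
  finally show "k * x ^ i * y ^ j * z ^ (d - i - j) =
     (\<Sum>(i', j')\<in>{(i, j). i + j \<le> d}. (if i' = i \<and> j' = j then k else 0) * x ^ i' * y ^ j' * z ^ (d - i' - j'))" ..
qed

lemma form_add:
  assumes "ternary_form d F" "ternary_form d G"
  shows "ternary_form d (\<lambda>v. F v + G v)"
proof -
  obtain c c' where "F = (\<lambda>(x, y, z). \<Sum>(i, j) \<in> {(i, j). i + j \<le> d}. c i j * x ^ i * y ^ j * z ^ (d - i - j))"
    "G = (\<lambda>(x, y, z). \<Sum>(i, j) \<in> {(i, j). i + j \<le> d}. c' i j * x ^ i * y ^ j * z ^ (d - i - j))"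
    using assms unfolding ternary_form_def by blast
  then show ?thesis
    unfolding ternary_form_def
    by (intro exI[of _ "\<lambda>i j. c i j + c' i j"])
       (auto simp: fun_eq_iff case_prod_unfold algebra_simps simp flip: sum.distrib)
qed

lemma form_sum:
  "(\<And>i. i \<in> A \<Longrightarrow> ternary_form d (F i)) \<Longrightarrow> ternary_form d (\<lambda>v. \<Sum>i\<in>A. F i v)"
  by (induction A rule: infinite_finite_induct) (auto intro: form_zero form_add)

lemma form_as_sum:
  assumes "ternary_form d F"
  obtains c where "F = (\<lambda>v. \<Sum>p\<in>{(i, j). i + j \<le> d}.
     c p * fst v ^ fst p * fst (snd v) ^ snd p * snd (snd v) ^ (d - fst p - snd p))"
proof -
  obtain c where "F = (\<lambda>(x, y, z). \<Sum>(i, j) \<in> {(i, j). i + j \<le> d}. c i j * x ^ i * y ^ j * z ^ (d - i - j))"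
    using assms unfolding ternary_form_def by blast
  then have "F = (\<lambda>v. \<Sum>p\<in>{(i, j). i + j \<le> d}.
     case_prod c p * fst v ^ fst p * fst (snd v) ^ snd p * snd (snd v) ^ (d - fst p - snd p))"
    by (auto simp: fun_eq_iff case_prod_unfold)
  then show ?thesis by (rule that)
qed

lemma form_monom':
  "i + j \<le> d \<Longrightarrow> ternary_form d (\<lambda>v. k * fst v ^ i * fst (snd v) ^ j * snd (snd v) ^ (d - i - j))"
  using form_monom[of i j d k] by (simp add: case_prod_unfold)

lemma form_mult:
  assumes "ternary_form d F" "ternary_form e G"
  shows "ternary_form (d + e) (\<lambda>v. F v * G v)"
proof -
  obtain c where F: "F = (\<lambda>v. \<Sum>p\<in>{(i, j). i + j \<le> d}.
      c p * fst v ^ fst p * fst (snd v) ^ snd p * snd (snd v) ^ (d - fst p - snd p))"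
    by (rule form_as_sum[OF assms(1)])
  obtain c' where G: "G = (\<lambda>v. \<Sum>p\<in>{(i, j). i + j \<le> e}.
      c' p * fst v ^ fst p * fst (snd v) ^ snd p * snd (snd v) ^ (e - fst p - snd p))"
    by (rule form_as_sum[OF assms(2)])
  have "ternary_form (d + e) (\<lambda>v. (c p * fst v ^ fst p * fst (snd v) ^ snd p * snd (snd v) ^ (d - fst p - snd p)) *
      (c' q * fst v ^ fst q * fst (snd v) ^ snd q * snd (snd v) ^ (e - fst q - snd q)))"
    if "p \<in> {(i, j). i + j \<le> d}" "q \<in> {(i, j). i + j \<le> e}" for p q
  proof -
    have le: "fst p + snd p \<le> d" "fst q + snd q \<le> e" using that by auto
    then have "d - fst p - snd p + (e - fst q - snd q) = d + e - (fst p + fst q) - (snd p + snd q)"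
      by linarith
    then have *: "(c p * x ^ fst p * y ^ snd p * z ^ (d - fst p - snd p)) *
        (c' q * x ^ fst q * y ^ snd q * z ^ (e - fst q - snd q)) =
        (c p * c' q) * x ^ (fst p + fst q) * y ^ (snd p + snd q) * z ^ (d + e - (fst p + fst q) - (snd p + snd q))"
      for x y z by (simp add: power_add mult_ac flip: power_add[of z])
    show ?thesis
      unfolding * using form_monom'[of "fst p + fst q" "snd p + snd q" "d + e" "c p * c' q"] le by simp
  qed
  then show ?thesis
    unfolding F G sum_product by (intro form_sum)
qed

lemma form_const: "ternary_form 0 (\<lambda>v. k)"
  using form_monom'[of 0 0 0 k] by simp

lemma form_coord:
  "ternary_form 1 (\<lambda>v. fst v)" "ternary_form 1 (\<lambda>v. fst (snd v))" "ternary_form 1 (\<lambda>v. snd (snd v))"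
  using form_monom'[of 1 0 1 1] form_monom'[of 0 1 1 1] form_monom'[of 0 0 1 1] by simp_all

lemma form_scale: "ternary_form d F \<Longrightarrow> ternary_form d (\<lambda>v. k * F v)"
  using form_mult[OF form_const, of d F k] by simp

lemma form_uminus: "ternary_form d F \<Longrightarrow> ternary_form d (\<lambda>v. - F v)"
  using form_scale[of d F "- 1"] by simp

lemma form_diff: "ternary_form d F \<Longrightarrow> ternary_form d G \<Longrightarrow> ternary_form d (\<lambda>v. F v - G v)"
  using form_add[OF _ form_uminus] by fastforce

lemma form_power: "ternary_form d F \<Longrightarrow> ternary_form (n * d) (\<lambda>v. F v ^ n)"
  by (induction n) (auto intro: form_const dest: form_mult[of d F])

lemma form_prod:
  "finite A \<Longrightarrow> (\<And>i. i \<in> A \<Longrightarrow> ternary_form 1 (F i)) \<Longrightarrow> ternary_form (card A) (\<lambda>v. \<Prod>i\<in>A. F i v)"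
proof (induction A rule: finite_induct)
  case (insert i A)
  then show ?case using form_mult[of 1 "F i" "card A"] by simp
qed (simp add: form_const)

lemma form_compose:
  assumes "ternary_form d F" "ternary_form e G1" "ternary_form e G2" "ternary_form e G3"
  shows "ternary_form (d * e) (\<lambda>v. F (G1 v, G2 v, G3 v))"
proof -
  obtain c where F: "F = (\<lambda>v. \<Sum>p\<in>{(i, j). i + j \<le> d}.
      c p * fst v ^ fst p * fst (snd v) ^ snd p * snd (snd v) ^ (d - fst p - snd p))"
    by (rule form_as_sum[OF assms(1)])
  have "ternary_form (d * e) (\<lambda>v. c p * G1 v ^ fst p * G2 v ^ snd p * G3 v ^ (d - fst p - snd p))"
    if "p \<in> {(i, j). i + j \<le> d}" for p
  proof -
    have "ternary_form (fst p * e + snd p * e + (d - fst p - snd p) * e)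
        (\<lambda>v. c p * G1 v ^ fst p * G2 v ^ snd p * G3 v ^ (d - fst p - snd p))"
      by (intro form_mult form_scale form_power assms)
    moreover have "fst p * e + snd p * e + (d - fst p - snd p) * e = d * e"
    proof -
      have "fst p + snd p + (d - fst p - snd p) = d" using that by auto
      then show ?thesis by (metis add_mult_distrib)
    qed
    ultimately show ?thesis by simp
  qed
  then show ?thesis unfolding F fst_conv snd_conv by (intro form_sum)
qed

fun vscale :: "'a :: field \<Rightarrow> 'a \<times> 'a \<times> 'a \<Rightarrow> 'a \<times> 'a \<times> 'a" where
  "vscale t (x, y, z) = (t * x, t * y, t * z)"

lemma vscale_eq: "vscale t v = (t * fst v, t * fst (snd v), t * snd (snd v))"
  by (cases v) auto

lemma vscale_eq_0: "vscale t v = (0, 0, 0) \<longleftrightarrow> t = 0 \<or> v = (0, 0, 0)"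
  by (cases v) auto

lemma vscale_vscale: "vscale s (vscale t v) = vscale (s * t) v"
  by (cases v) (auto simp: mult_ac)

lemma form_homogeneous:
  assumes "ternary_form d F"
  shows "F (vscale t v) = t ^ d * F v"
proof -
  obtain c where F: "F = (\<lambda>v. \<Sum>p\<in>{(i, j). i + j \<le> d}.
      c p * fst v ^ fst p * fst (snd v) ^ snd p * snd (snd v) ^ (d - fst p - snd p))"
    by (rule form_as_sum[OF assms(1)])
  have "c p * (t * x) ^ fst p * (t * y) ^ snd p * (t * z) ^ (d - fst p - snd p) =
      t ^ d * (c p * x ^ fst p * y ^ snd p * z ^ (d - fst p - snd p))"
    if "p \<in> {(i, j). i + j \<le> d}" for p x y z
  proof -
    have "t ^ d = t ^ (fst p + snd p + (d - fst p - snd p))" using that by auto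
    also have "\<dots> = t ^ fst p * t ^ snd p * t ^ (d - fst p - snd p)" by (simp only: power_add)
    finally show ?thesis by (simp add: power_mult_distrib mult_ac)
  qed
  then show ?thesis
    unfolding F vscale_eq fst_conv snd_conv sum_distrib_left by (intro sum.cong refl)
qed

definition form_map :: "nat \<Rightarrow> ('a :: field \<times> 'a \<times> 'a \<Rightarrow> 'a \<times> 'a \<times> 'a) \<Rightarrow> bool" where
  "form_map d \<Phi> \<longleftrightarrow> ternary_form d (\<lambda>v. fst (\<Phi> v)) \<and> ternary_form d (\<lambda>v. fst (snd (\<Phi> v))) \<and>
     ternary_form d (\<lambda>v. snd (snd (\<Phi> v)))"

lemma form_map_homogeneous: "form_map d \<Phi> \<Longrightarrow> \<Phi> (vscale t v) = vscale (t ^ d) (\<Phi> v)"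
  unfolding form_map_def vscale_eq[of _ "\<Phi> v"] by (metis form_homogeneous prod.collapse)

lemma form_map_compose:
  assumes "form_map d \<Phi>" "form_map e \<Psi>"
  shows "form_map (d * e) (\<lambda>v. \<Phi> (\<Psi> v))"
  using form_compose[of d _ e "\<lambda>v. fst (\<Psi> v)" "\<lambda>v. fst (snd (\<Psi> v))" "\<lambda>v. snd (snd (\<Psi> v))"] assms
  unfolding form_map_def by auto

lemma form_map_scale:
  "form_map d \<Phi> \<Longrightarrow> ternary_form e F \<Longrightarrow> form_map (e + d) (\<lambda>v. vscale (F v) (\<Phi> v))"
  unfolding form_map_def vscale_eq by (auto intro: form_mult)

text \<open>
  The local condition in the definition of a morphism, for maps whose source and target may be
  different curves; this makes changes of coordinates and compositions available.
\<close>

definition local_forms ::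
    "'a :: field weierstrass \<Rightarrow> ('a point \<Rightarrow> 'a point) \<Rightarrow> 'a point \<Rightarrow> bool" where
  "local_forms C \<phi> P \<longleftrightarrow> (\<exists>d \<Phi>. form_map d \<Phi> \<and> \<Phi> (homogeneous_coords P) \<noteq> (0, 0, 0) \<and>
     (\<forall>Q\<in>curve_points C. \<Phi> (homogeneous_coords Q) \<noteq> (0, 0, 0) \<longrightarrow>
        (\<exists>t. t \<noteq> 0 \<and> \<Phi> (homogeneous_coords Q) = vscale t (homogeneous_coords (\<phi> Q)))))"

lemma curve_morphism_iff:
  "curve_morphism C \<phi> \<longleftrightarrow>
     \<phi> \<in> curve_points C \<rightarrow> curve_points C \<and> (\<forall>P \<in> curve_points C. local_forms C \<phi> P)"
proof -
  have "local_forms C \<phi> P \<longleftrightarrow> (\<exists>d F G H.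
        ternary_form d F \<and> ternary_form d G \<and> ternary_form d H \<and>
        (let eval = (\<lambda>Q. let q = homogeneous_coords Q in (F q, G q, H q)) in
           eval P \<noteq> (0, 0, 0) \<and>
           (\<forall>Q \<in> curve_points C. eval Q \<noteq> (0, 0, 0) \<longrightarrow>
              (\<exists>t x y z. t \<noteq> 0 \<and> homogeneous_coords (\<phi> Q) = (x, y, z) \<and>
                 eval Q = (t * x, t * y, t * z)))))" (is "_ \<longleftrightarrow> ?R") for P
  proof
    assume "local_forms C \<phi> P"
    then obtain d \<Phi> where *: "form_map d \<Phi>" "\<Phi> (homogeneous_coords P) \<noteq> (0, 0, 0)"
      "\<And>Q. Q \<in> curve_points C \<Longrightarrow> \<Phi> (homogeneous_coords Q) \<noteq> (0, 0, 0) \<Longrightarrow>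
        \<exists>t. t \<noteq> 0 \<and> \<Phi> (homogeneous_coords Q) = vscale t (homogeneous_coords (\<phi> Q))"
      unfolding local_forms_def by blast
    show ?R
      unfolding Let_def
    proof (rule exI[of _ d], rule exI[of _ "\<lambda>v. fst (\<Phi> v)"], rule exI[of _ "\<lambda>v. fst (snd (\<Phi> v))"],
        rule exI[of _ "\<lambda>v. snd (snd (\<Phi> v))"], intro conjI ballI impI)
      show "ternary_form d (\<lambda>v. fst (\<Phi> v))" "ternary_form d (\<lambda>v. fst (snd (\<Phi> v)))"
        "ternary_form d (\<lambda>v. snd (snd (\<Phi> v)))"
        using * by (auto simp: form_map_def)
      show "(fst (\<Phi> (homogeneous_coords P)), fst (snd (\<Phi> (homogeneous_coords P))),
          snd (snd (\<Phi> (homogeneous_coords P)))) \<noteq> (0, 0, 0)" using * by simp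
      fix Q assume "Q \<in> curve_points C" "(fst (\<Phi> (homogeneous_coords Q)), fst (snd (\<Phi> (homogeneous_coords Q))),
          snd (snd (\<Phi> (homogeneous_coords Q)))) \<noteq> (0, 0, 0)"
      then obtain t where t: "t \<noteq> 0" "\<Phi> (homogeneous_coords Q) = vscale t (homogeneous_coords (\<phi> Q))"
        using *(3)[of Q] by auto
      obtain a b c where "homogeneous_coords (\<phi> Q) = (a, b, c)"
        by (cases "homogeneous_coords (\<phi> Q)")
      then show "\<exists>t x y z. t \<noteq> 0 \<and> homogeneous_coords (\<phi> Q) = (x, y, z) \<and>
          (fst (\<Phi> (homogeneous_coords Q)), fst (snd (\<Phi> (homogeneous_coords Q))),
            snd (snd (\<Phi> (homogeneous_coords Q)))) = (t * x, t * y, t * z)"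
        using t by (intro exI[of _ t] exI[of _ a] exI[of _ b] exI[of _ c]) simp
    qed
  next
    assume ?R
    then obtain d F G H where *: "ternary_form d F" "ternary_form d G" "ternary_form d H"
      "(F (homogeneous_coords P), G (homogeneous_coords P), H (homogeneous_coords P)) \<noteq> (0, 0, 0)"
      "\<And>Q. Q \<in> curve_points C \<Longrightarrow> (F (homogeneous_coords Q), G (homogeneous_coords Q), H (homogeneous_coords Q)) \<noteq> (0, 0, 0) \<Longrightarrow>
        \<exists>t x y z. t \<noteq> 0 \<and> homogeneous_coords (\<phi> Q) = (x, y, z) \<and>
          (F (homogeneous_coords Q), G (homogeneous_coords Q), H (homogeneous_coords Q)) = (t * x, t * y, t * z)"
      unfolding Let_def by blast
    show "local_forms C \<phi> P"
      unfolding local_forms_def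
    proof (intro exI[of _ d] exI[of _ "\<lambda>v. (F v, G v, H v)"] conjI ballI impI)
      fix Q assume "Q \<in> curve_points C" "(F (homogeneous_coords Q), G (homogeneous_coords Q), H (homogeneous_coords Q)) \<noteq> (0, 0, 0)"
      from *(5)[OF this] show "\<exists>t. t \<noteq> 0 \<and> (F (homogeneous_coords Q), G (homogeneous_coords Q), H (homogeneous_coords Q)) =
          vscale t (homogeneous_coords (\<phi> Q))" by auto
    qed (use * in \<open>auto simp: form_map_def\<close>)
  qed
  then show ?thesis unfolding curve_morphism_def by blast
qed

lemma homogeneous_coords_nonzero [simp]: "homogeneous_coords P \<noteq> (0, 0, 0)"
  by (cases P) auto

lemma local_forms_const: "local_forms C (\<lambda>Q. R) P"
  unfolding local_forms_def
  by (intro exI[of _ "0 :: nat"] exI[of _ "\<lambda>v. homogeneous_coords R"])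
     (auto simp: form_map_def form_const vscale_eq intro!: exI[of _ 1])

lemma local_forms_id: "local_forms C (\<lambda>Q. Q) P"
  unfolding local_forms_def
  by (intro exI[of _ "1 :: nat"] exI[of _ "\<lambda>v. v"])
     (use form_coord in \<open>auto simp: form_map_def vscale_eq intro!: exI[of _ 1]\<close>)

lemma local_forms_cong:
  "local_forms C \<phi> P \<Longrightarrow> (\<And>Q. Q \<in> curve_points C \<Longrightarrow> \<phi> Q = \<psi> Q) \<Longrightarrow> local_forms C \<psi> P"
  unfolding local_forms_def by force

text \<open>
  Multiplying by a form of positive degree ensures that the forms vanish at the origin. This
  matters for compositions, where the inner forms may vanish simultaneously.
\<close>

lemma local_forms_positive:
  assumes "local_forms C \<phi> P"
  shows "\<exists>d \<Phi>. form_map d \<Phi> \<and> d > 0 \<and> \<Phi> (homogeneous_coords P) \<noteq> (0, 0, 0) \<and>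
    (\<forall>Q\<in>curve_points C. \<Phi> (homogeneous_coords Q) \<noteq> (0, 0, 0) \<longrightarrow>
       (\<exists>t. t \<noteq> 0 \<and> \<Phi> (homogeneous_coords Q) = vscale t (homogeneous_coords (\<phi> Q))))"
proof -
  obtain d \<Phi> where *: "form_map d \<Phi>" "\<Phi> (homogeneous_coords P) \<noteq> (0, 0, 0)"
      "\<And>Q. Q \<in> curve_points C \<Longrightarrow> \<Phi> (homogeneous_coords Q) \<noteq> (0, 0, 0) \<Longrightarrow>
        \<exists>t. t \<noteq> 0 \<and> \<Phi> (homogeneous_coords Q) = vscale t (homogeneous_coords (\<phi> Q))"
    using assms unfolding local_forms_def by blast
  obtain F where F: "ternary_form 1 F" "F (homogeneous_coords P) \<noteq> 0"
  proof (cases P)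
    case Infinity
    then show ?thesis using form_coord(2) by (intro that[of "\<lambda>v. fst (snd v)"]) auto
  next
    case Affine
    then show ?thesis using form_coord(3) by (intro that[of "\<lambda>v. snd (snd v)"]) auto
  qed
  show ?thesis
  proof (intro exI[of _ "1 + d"] exI[of _ "\<lambda>v. vscale (F v) (\<Phi> v)"] conjI ballI impI)
    show "form_map (1 + d) (\<lambda>v. vscale (F v) (\<Phi> v))" using form_map_scale * F by blast
    show "vscale (F (homogeneous_coords P)) (\<Phi> (homogeneous_coords P)) \<noteq> (0, 0, 0)"
      using * F by (simp add: vscale_eq_0)
    fix Q assume Q: "Q \<in> curve_points C" "vscale (F (homogeneous_coords Q)) (\<Phi> (homogeneous_coords Q)) \<noteq> (0, 0, 0)"
    then have nz: "F (homogeneous_coords Q) \<noteq> 0" "\<Phi> (homogeneous_coords Q) \<noteq> (0, 0, 0)"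
      by (auto simp: vscale_eq_0)
    then obtain t where "t \<noteq> 0" "\<Phi> (homogeneous_coords Q) = vscale t (homogeneous_coords (\<phi> Q))"
      using *(3) Q by blast
    then show "\<exists>t. t \<noteq> 0 \<and> vscale (F (homogeneous_coords Q)) (\<Phi> (homogeneous_coords Q)) =
        vscale t (homogeneous_coords (\<phi> Q))"
      using nz by (intro exI[of _ "F (homogeneous_coords Q) * t"]) (simp add: vscale_vscale)
  qed simp
qed

text \<open>
  If the inner forms vanish at a point, then so do the outer ones, whose degree can be taken to be
  positive. Where the composed forms do not vanish, both local conditions therefore apply.
\<close>

lemma local_forms_compose:
  assumes 1: "local_forms C \<phi> P" and 2: "local_forms D \<psi> (\<phi> P)" and P: "P \<in> curve_points C"
    and map: "\<And>Q. Q \<in> curve_points C \<Longrightarrow> \<phi> Q \<in> curve_points D"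
  shows "local_forms C (\<lambda>Q. \<psi> (\<phi> Q)) P"
proof -
  obtain d \<Phi> where \<Phi>: "form_map d \<Phi>" "\<Phi> (homogeneous_coords P) \<noteq> (0, 0, 0)"
      "\<And>Q. Q \<in> curve_points C \<Longrightarrow> \<Phi> (homogeneous_coords Q) \<noteq> (0, 0, 0) \<Longrightarrow>
        \<exists>t. t \<noteq> 0 \<and> \<Phi> (homogeneous_coords Q) = vscale t (homogeneous_coords (\<phi> Q))"
    using 1 unfolding local_forms_def by blast
  obtain e \<Psi> where \<Psi>: "form_map e \<Psi>" "e > 0" "\<Psi> (homogeneous_coords (\<phi> P)) \<noteq> (0, 0, 0)"
    "\<And>Q. Q \<in> curve_points D \<Longrightarrow> \<Psi> (homogeneous_coords Q) \<noteq> (0, 0, 0) \<Longrightarrow>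
       \<exists>t. t \<noteq> 0 \<and> \<Psi> (homogeneous_coords Q) = vscale t (homogeneous_coords (\<psi> Q))"
    using local_forms_positive[OF 2] by blast
  have \<Psi>0: "\<Psi> (0, 0, 0) = (0, 0, 0)"
    using form_map_homogeneous[OF \<Psi>(1), of 0 "(0, 0, 0)"] \<Psi>(2) by (simp add: vscale_eq zero_power)
  show ?thesis
    unfolding local_forms_def
  proof (intro exI[of _ "e * d"] exI[of _ "\<lambda>v. \<Psi> (\<Phi> v)"] conjI ballI impI)
    show "form_map (e * d) (\<lambda>v. \<Psi> (\<Phi> v))" using form_map_compose \<Phi> \<Psi> by blast
    obtain t where "t \<noteq> 0" "\<Phi> (homogeneous_coords P) = vscale t (homogeneous_coords (\<phi> P))"
      using \<Phi> P by blast
    then show "\<Psi> (\<Phi> (homogeneous_coords P)) \<noteq> (0, 0, 0)"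
      using \<Psi>(3) by (simp add: form_map_homogeneous[OF \<Psi>(1)] vscale_eq_0)
  next
    fix Q assume Q: "Q \<in> curve_points C" and nz: "\<Psi> (\<Phi> (homogeneous_coords Q)) \<noteq> (0, 0, 0)"
    then have "\<Phi> (homogeneous_coords Q) \<noteq> (0, 0, 0)" using \<Psi>0 by auto
    then obtain t where t: "t \<noteq> 0" "\<Phi> (homogeneous_coords Q) = vscale t (homogeneous_coords (\<phi> Q))"
      using \<Phi> Q by blast
    then have "\<Psi> (homogeneous_coords (\<phi> Q)) \<noteq> (0, 0, 0)"
      using nz by (auto simp: form_map_homogeneous[OF \<Psi>(1)] vscale_eq_0)
    then obtain s where "s \<noteq> 0" "\<Psi> (homogeneous_coords (\<phi> Q)) = vscale s (homogeneous_coords (\<psi> (\<phi> Q)))"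
      using \<Psi>(4) map Q by blast
    then show "\<exists>t. t \<noteq> 0 \<and> \<Psi> (\<Phi> (homogeneous_coords Q)) = vscale t (homogeneous_coords (\<psi> (\<phi> Q)))"
      using t by (intro exI[of _ "t ^ e * s"]) (simp add: form_map_homogeneous[OF \<Psi>(1)] vscale_vscale)
  qed
qed

section \<open>Sums of morphisms\<close>

text \<open>
  The chord formula in homogeneous coordinates. It degenerates only if the two points coincide or
  if one of them is the point at infinity.
\<close>

fun chord_add :: "'a :: field \<times> 'a \<times> 'a \<Rightarrow> 'a \<times> 'a \<times> 'a \<Rightarrow> 'a \<times> 'a \<times> 'a" where
  "chord_add (x1, y1, z1) (x2, y2, z2) =
     (let u = y2 * z1 - y1 * z2; v = x2 * z1 - x1 * z2; w = z1 * z2;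
          s = u * u * w - v * v * v - 2 * (v * v * (x1 * z2))
      in (v * s, u * (v * v * (x1 * z2) - s) - v * v * v * (y1 * z2), v * v * v * w))"

lemma chord_add_scale:
  "chord_add (vscale s v) (vscale t w) = vscale ((s * t) ^ 4) (chord_add v w)"
  by (cases v; cases w) (simp add: Let_def algebra_simps power4_eq_xxxx)

lemma form_map_chord_add:
  assumes "form_map d \<Phi>" "form_map e \<Psi>"
  shows "form_map (4 * (d + e)) (\<lambda>v. chord_add (\<Phi> v) (\<Psi> v))"
proof -
  define x1 y1 z1 where "x1 = (\<lambda>v. fst (\<Phi> v))" and "y1 = (\<lambda>v. fst (snd (\<Phi> v)))"
    and "z1 = (\<lambda>v. snd (snd (\<Phi> v)))"
  define x2 y2 z2 where "x2 = (\<lambda>v. fst (\<Psi> v))" and "y2 = (\<lambda>v. fst (snd (\<Psi> v)))"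
    and "z2 = (\<lambda>v. snd (snd (\<Psi> v)))"
  have f: "ternary_form d x1" "ternary_form d y1" "ternary_form d z1"
    "ternary_form e x2" "ternary_form e y2" "ternary_form e z2"
    using assms by (auto simp: form_map_def x1_def y1_def z1_def x2_def y2_def z2_def)
  define n where "n = d + e"
  have prod: "ternary_form n (\<lambda>v. F v * G v)" if "ternary_form d F" "ternary_form e G" for F G
    using form_mult[OF that] by (simp add: n_def)
  have prod': "ternary_form n (\<lambda>v. G v * F v)" if "ternary_form d F" "ternary_form e G" for F G
    using form_mult[OF that(2,1)] by (simp add: n_def add.commute)
  define u v w where "u a = y2 a * z1 a - y1 a * z2 a" and "v a = x2 a * z1 a - x1 a * z2 a"
    and "w a = z1 a * z2 a" for a
  have uvw: "ternary_form n u" "ternary_form n v" "ternary_form n w"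
    unfolding u_def v_def w_def
    by (intro form_diff prod[OF f(2,6)] prod'[OF f(3,5)] prod[OF f(1,6)] prod'[OF f(3,4)] prod[OF f(3,6)])+
  have xz: "ternary_form n (\<lambda>a. x1 a * z2 a)" "ternary_form n (\<lambda>a. y1 a * z2 a)"
    by (intro prod f)+
  have p2: "ternary_form (2 * n) (\<lambda>a. F a * G a)" if "ternary_form n F" "ternary_form n G" for F G
    using form_mult[OF that] by (simp add: mult_2)
  have p3: "ternary_form (3 * n) (\<lambda>a. F a * G a)" if "ternary_form (2 * n) F" "ternary_form n G" for F G
    using form_mult[OF that] by (simp add: algebra_simps)
  have p4: "ternary_form (4 * n) (\<lambda>a. F a * G a)" if "ternary_form (3 * n) F" "ternary_form n G" for F G
    using form_mult[OF that] by (simp add: algebra_simps)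
  have p4': "ternary_form (4 * n) (\<lambda>a. G a * F a)" if "ternary_form (3 * n) F" "ternary_form n G" for F G
    using form_mult[OF that(2,1)] by (simp add: algebra_simps)
  define s where "s a = u a * u a * w a - v a * v a * v a - 2 * (v a * v a * (x1 a * z2 a))" for a
  have s: "ternary_form (3 * n) s"
    unfolding s_def by (intro form_diff form_scale p3 p2 uvw xz)
  have "chord_add (\<Phi> a) (\<Psi> a) = (v a * s a, u a * (v a * v a * (x1 a * z2 a) - s a) - v a * v a * v a * (y1 a * z2 a),
      v a * v a * v a * w a)" for a
    unfolding s_def u_def v_def w_def x1_def y1_def z1_def x2_def y2_def z2_def
    by (cases "\<Phi> a"; cases "\<Psi> a") (simp add: Let_def)
  moreover have "ternary_form (4 * n) (\<lambda>a. v a * s a)"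
    "ternary_form (4 * n) (\<lambda>a. u a * (v a * v a * (x1 a * z2 a) - s a) - v a * v a * v a * (y1 a * z2 a))"
    "ternary_form (4 * n) (\<lambda>a. v a * v a * v a * w a)"
    by (rule p4'[OF s uvw(2)], intro form_diff p4'[OF _ uvw(1)] p4[OF _ xz(2)] p3 p2 uvw xz s,
        intro p4 p3 p2 uvw)
  ultimately show ?thesis unfolding form_map_def n_def by simp
qed

context short_curve
begin

lemma chord_add_nonzero:
  assumes P: "P \<in> pts" "P \<noteq> Infinity" and Q: "Q \<in> pts" "Q \<noteq> Infinity" and ne: "P \<noteq> Q"
  shows "chord_add (homogeneous_coords P) (homogeneous_coords Q) \<noteq> (0, 0, 0)"
proof -
  obtain x1 y1 x2 y2 where pq: "P = Affine x1 y1" "Q = Affine x2 y2"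
    using P Q by (metis point.exhaust)
  show ?thesis
  proof (cases "x1 = x2")
    case True
    then have "y1 \<noteq> y2" using ne pq by simp
    then show ?thesis using True pq by (simp add: Let_def)
  qed (simp add: pq Let_def)
qed

lemma chord_add_padd:
  assumes P: "P \<in> pts" and Q: "Q \<in> pts"
    and nz: "chord_add (homogeneous_coords P) (homogeneous_coords Q) \<noteq> (0, 0, 0)"
  shows "\<exists>t. t \<noteq> 0 \<and> chord_add (homogeneous_coords P) (homogeneous_coords Q) =
    vscale t (homogeneous_coords (P \<boxplus> Q))"
proof (cases P; cases Q)
  fix x1 y1 x2 y2 assume pq: "P = Affine x1 y1" "Q = Affine x2 y2"
  show ?thesis
  proof (cases "x1 = x2")
    case True
    then have "y1 \<noteq> y2" using nz pq by (auto simp: Let_def)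
    moreover have "y1 ^ 2 = y2 ^ 2" using P Q pq True by (simp add: Affine_in_pts)
    ultimately have "y1 = - y2" by (simp add: power2_eq_iff)
    then show ?thesis using True pq \<open>y1 \<noteq> y2\<close>
      by (intro exI[of _ "- ((y2 - y1) * (y2 - y1) * (y2 - y1))"]) (simp add: Let_def)
  next
    case False
    define l where "l = (y2 - y1) / (x2 - x1)"
    define h where "h = x2 - x1"
    have h: "h \<noteq> 0" "y2 = y1 + l * h" "x2 = x1 + h" using False by (auto simp: h_def l_def)
    have "P \<boxplus> Q = Affine (l ^ 2 - x1 - x2) (- (l * (l ^ 2 - x1 - x2) + (y1 - l * x1)))"
      using False pq by (simp add: Let_def l_def)
    then show ?thesis
      unfolding pq using h
      by (intro exI[of _ "h * h * h"])
         (simp add: Let_def algebra_simps power2_eq_square)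
  qed
qed (use nz in \<open>auto simp: Let_def\<close>)

lemma local_forms_padd_distinct:
  assumes \<phi>: "local_forms C \<phi> P" "\<And>Q. Q \<in> curve_points C \<Longrightarrow> \<phi> Q \<in> pts"
    and \<psi>: "local_forms C \<psi> P" "\<And>Q. Q \<in> curve_points C \<Longrightarrow> \<psi> Q \<in> pts"
    and P: "P \<in> curve_points C" and ne: "\<phi> P \<noteq> Infinity" "\<psi> P \<noteq> Infinity" "\<phi> P \<noteq> \<psi> P"
  shows "local_forms C (\<lambda>Q. \<phi> Q \<boxplus> \<psi> Q) P"
proof -
  obtain d \<Phi> where \<Phi>: "form_map d \<Phi>" "\<Phi> (homogeneous_coords P) \<noteq> (0, 0, 0)"
      "\<And>Q. Q \<in> curve_points C \<Longrightarrow> \<Phi> (homogeneous_coords Q) \<noteq> (0, 0, 0) \<Longrightarrow>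
        \<exists>t. t \<noteq> 0 \<and> \<Phi> (homogeneous_coords Q) = vscale t (homogeneous_coords (\<phi> Q))"
    using \<phi>(1) unfolding local_forms_def by blast
  obtain e \<Psi> where \<Psi>: "form_map e \<Psi>" "\<Psi> (homogeneous_coords P) \<noteq> (0, 0, 0)"
      "\<And>Q. Q \<in> curve_points C \<Longrightarrow> \<Psi> (homogeneous_coords Q) \<noteq> (0, 0, 0) \<Longrightarrow>
        \<exists>t. t \<noteq> 0 \<and> \<Psi> (homogeneous_coords Q) = vscale t (homogeneous_coords (\<psi> Q))"
    using \<psi>(1) unfolding local_forms_def by blast
  have zero: "chord_add (0, 0, 0) v = (0, 0, 0)" "chord_add v (0, 0, 0) = (0, 0, 0)" for v :: "'a \<times> 'a \<times> 'a"
    by (cases v; simp add: Let_def)+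
  show ?thesis
    unfolding local_forms_def
  proof (intro exI[of _ "4 * (d + e)"] exI[of _ "\<lambda>v. chord_add (\<Phi> v) (\<Psi> v)"] conjI ballI impI)
    show "form_map (4 * (d + e)) (\<lambda>v. chord_add (\<Phi> v) (\<Psi> v))"
      using form_map_chord_add \<Phi> \<Psi> by blast
    obtain s t where "s \<noteq> 0" "\<Phi> (homogeneous_coords P) = vscale s (homogeneous_coords (\<phi> P))"
      "t \<noteq> 0" "\<Psi> (homogeneous_coords P) = vscale t (homogeneous_coords (\<psi> P))"
      using \<Phi>(3)[OF P \<Phi>(2)] \<Psi>(3)[OF P \<Psi>(2)] by blast
    then show "chord_add (\<Phi> (homogeneous_coords P)) (\<Psi> (homogeneous_coords P)) \<noteq> (0, 0, 0)"
      using chord_add_nonzero[OF \<phi>(2)[OF P] ne(1) \<psi>(2)[OF P] ne(2,3)]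
      by (simp add: chord_add_scale vscale_eq_0)
  next
    fix Q assume Q: "Q \<in> curve_points C"
      and nz: "chord_add (\<Phi> (homogeneous_coords Q)) (\<Psi> (homogeneous_coords Q)) \<noteq> (0, 0, 0)"
    have "\<Phi> (homogeneous_coords Q) \<noteq> (0, 0, 0)" "\<Psi> (homogeneous_coords Q) \<noteq> (0, 0, 0)"
      using nz by (auto simp: zero)
    then obtain s t where st: "s \<noteq> 0" "\<Phi> (homogeneous_coords Q) = vscale s (homogeneous_coords (\<phi> Q))"
      "t \<noteq> 0" "\<Psi> (homogeneous_coords Q) = vscale t (homogeneous_coords (\<psi> Q))"
      using \<Phi>(3)[OF Q] \<Psi>(3)[OF Q] by blast
    then have "chord_add (homogeneous_coords (\<phi> Q)) (homogeneous_coords (\<psi> Q)) \<noteq> (0, 0, 0)"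
      using nz by (auto simp: chord_add_scale vscale_eq_0)
    from chord_add_padd[OF \<phi>(2)[OF Q] \<psi>(2)[OF Q] this] obtain r where
      "r \<noteq> 0" "chord_add (homogeneous_coords (\<phi> Q)) (homogeneous_coords (\<psi> Q)) =
        vscale r (homogeneous_coords (\<phi> Q \<boxplus> \<psi> Q))" by blast
    then show "\<exists>t. t \<noteq> 0 \<and> chord_add (\<Phi> (homogeneous_coords Q)) (\<Psi> (homogeneous_coords Q)) =
        vscale t (homogeneous_coords (\<phi> Q \<boxplus> \<psi> Q))"
      using st by (intro exI[of _ "(s * t) ^ 4 * r"]) (simp add: chord_add_scale vscale_vscale)
  qed
qed

text \<open>
  Near the point at infinity, translation by a two-torsion point \<open>(e, 0)\<close> has a simple formula:
  with \<open>s = x - e z\<close>, the usual formula for it is divided by \<open>z\<close> with the help of the equation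
  \<open>y\<^sup>2 z = s (s\<^sup>2 + 3 e s z + (3 e\<^sup>2 + a) z\<^sup>2)\<close> of the curve.
\<close>

lemma local_forms_translate_Infinity:
  assumes T: "Affine e 0 \<in> pts"
  shows "local_forms E (\<lambda>Q. Q \<boxplus> Affine e 0) Infinity"
proof -
  define k where "k = 3 * e ^ 2 + a"
  define s where "s v = fst v - e * snd (snd v)" for v :: "'a \<times> 'a \<times> 'a"
  define m where "m v = fst (snd v) * fst (snd v) - 3 * e * (s v * s v) - k * (s v * snd (snd v))" for v
  define \<Phi> where "\<Phi> v = (e * m v + k * (s v * s v), - (k * (fst (snd v) * s v)), m v)" for v
  have b: "b = - (e ^ 3 + a * e)" using T by (simp add: Affine_in_pts add_eq_0_iff2)
  have s: "ternary_form 1 s" unfolding s_def by (intro form_diff form_scale form_coord)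
  have m: "ternary_form (1 + 1) m"
    unfolding m_def by (intro form_diff form_scale form_mult form_coord s)
  show ?thesis
    unfolding local_forms_def
  proof (intro exI[of _ "1 + 1 :: nat"] exI[of _ \<Phi>] conjI ballI impI)
    show "form_map (1 + 1) \<Phi>"
      unfolding form_map_def \<Phi>_def fst_conv snd_conv
      by (intro conjI form_add form_uminus form_scale form_mult form_coord s m)
    show "\<Phi> (homogeneous_coords Infinity) \<noteq> (0, 0, 0)"
      by (simp add: \<Phi>_def m_def s_def)
  next
    fix Q assume Q: "Q \<in> pts" "\<Phi> (homogeneous_coords Q) \<noteq> (0, 0, 0)"
    show "\<exists>t. t \<noteq> 0 \<and> \<Phi> (homogeneous_coords Q) = vscale t (homogeneous_coords (Q \<boxplus> Affine e 0))"
    proof (cases Q)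
      case Infinity
      then show ?thesis by (intro exI[of _ 1]) (simp add: \<Phi>_def m_def s_def)
    next
      case (Affine x y)
      define h where "h = x - e"
      have yy: "y * y = h * h * h + 3 * e * (h * h) + k * h"
        using Q(1) unfolding k_def h_def Affine Affine_in_pts unfolding b
        by (simp add: algebra_simps power2_eq_square power3_eq_cube)
      have m': "m (homogeneous_coords Q) = h * h * h"
        by (simp add: m_def s_def Affine yy h_def[symmetric])
      have s': "s (homogeneous_coords Q) = h" by (simp add: s_def Affine h_def)
      have h: "h \<noteq> 0"
      proof
        assume "h = 0"
        then have "y = 0" using yy by simp
        then show False using Q(2) \<open>h = 0\<close> m' s' by (simp add: \<Phi>_def)
      qed
      define l where "l = y / h"
      have y: "y = l * h" using h by (simp add: l_def)
      have x: "x = h + e" by (simp add: h_def)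
      have k: "k = h * (l * l) - h * h - 3 * e * h"
      proof -
        have "h * k = h * (h * (l * l) - h * h - 3 * e * h)" using yy y by (simp add: algebra_simps)
        then show ?thesis using h by simp
      qed
      have sl: "(0 - y) / (e - x) = l" using h by (simp add: y x)
      have "Q \<boxplus> Affine e 0 = Affine (l ^ 2 - x - e) (- (l * (l ^ 2 - x - e) + (y - l * x)))"
        using h x sl Affine by (simp add: Let_def)
      then show ?thesis
        using h unfolding \<Phi>_def m' s'
        by (intro exI[of _ "h * h * h"])
           (simp add: Affine y x k algebra_simps power2_eq_square)
    qed
  qed
qed

end


context short_curve
begin

lemma padd_left_comm:
  "P \<in> pts \<Longrightarrow> Q \<in> pts \<Longrightarrow> R \<in> pts \<Longrightarrow> P \<boxplus> (Q \<boxplus> R) = Q \<boxplus> (P \<boxplus> R)"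
  by (metis padd_assoc padd_comm)

lemma padd_cancel': "P \<in> pts \<Longrightarrow> Q \<in> pts \<Longrightarrow> neg Q \<boxplus> (Q \<boxplus> P) = P"
  using padd_cancel[of P Q] padd_comm[of P Q] padd_comm[of "neg Q" "Q \<boxplus> P"] by simp

lemma padd_left_cancel [simp]:
  "P \<in> pts \<Longrightarrow> Q \<in> pts \<Longrightarrow> R \<in> pts \<Longrightarrow> P \<boxplus> Q = P \<boxplus> R \<longleftrightarrow> Q = R"
  using padd_cancel'[of Q P] padd_cancel'[of R P] by metis

lemma padd_eq_Infinity_iff: "P \<in> pts \<Longrightarrow> Q \<in> pts \<Longrightarrow> P \<boxplus> Q = Infinity \<longleftrightarrow> Q = neg P"
  using padd_left_cancel[of P Q "neg P"] by simp

lemma padd_rearrange: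
  assumes "P \<in> pts" "Q \<in> pts" "R \<in> pts" "S \<in> pts"
  shows "(P \<boxplus> R) \<boxplus> (Q \<boxplus> S) = (P \<boxplus> Q) \<boxplus> (R \<boxplus> S)"
  using assms by (simp add: padd_assoc padd_left_comm[of R Q S])

lemma dbl_padd: "P \<in> pts \<Longrightarrow> Q \<in> pts \<Longrightarrow> dbl (P \<boxplus> Q) = dbl P \<boxplus> dbl Q"
  by (rule padd_rearrange)

lemma padd_diff:
  assumes "P \<in> pts" "R \<in> pts" "S \<in> pts"
  shows "(P \<boxplus> R) \<boxplus> (S \<boxplus> neg R) = P \<boxplus> S"
  using assms padd_rearrange[of P S R "neg R"] by simp

lemma finite_px_fibre: "finite {P \<in> pts. P \<noteq> Infinity \<and> px P = x}"
proof (cases "{P \<in> pts. P \<noteq> Infinity \<and> px P = x} = {}")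
  case False
  then obtain P where "P \<in> pts" "P \<noteq> Infinity" "px P = x" by auto
  then have "{P \<in> pts. P \<noteq> Infinity \<and> px P = x} \<subseteq> {P, neg P}"
    using px_eq_iff[of _ P] by auto
  then show ?thesis by (rule finite_subset) simp
next
  case True
  then show ?thesis by (simp only: finite.emptyI)
qed

lemma finite_px_preimage: "finite S \<Longrightarrow> finite {P \<in> pts. P \<noteq> Infinity \<and> px P \<in> S}"
proof -
  assume "finite S"
  then have "finite (\<Union>x\<in>S. {P \<in> pts. P \<noteq> Infinity \<and> px P = x})" using finite_px_fibre by blast
  then show ?thesis by (rule rev_finite_subset) auto
qed

definition cubic :: "'a poly" where "cubic = [:b, a, 0, 1:]"

lemma poly_cubic: "poly cubic x = x ^ 3 + a * x + b"
  by (simp add: cubic_def algebra_simps power3_eq_cube)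

lemma finite_two_torsion: "finite {P \<in> pts. P \<noteq> Infinity \<and> py P = 0}"
proof -
  have "cubic \<noteq> 0" by (simp add: cubic_def)
  then have "finite {P \<in> pts. P \<noteq> Infinity \<and> px P \<in> {x. poly cubic x = 0}}"
    using poly_roots_finite finite_px_preimage by blast
  then show ?thesis
    by (rule rev_finite_subset) (auto simp: poly_cubic dest: curve_eq)
qed

text \<open>
  A double root of the cubic would be a singular point of the curve.
\<close>

lemma double_root_singular: "e ^ 3 + a * e + b = 0 \<Longrightarrow> 3 * e ^ 2 + a \<noteq> 0"
proof
  assume *: "e ^ 3 + a * e + b = 0" "3 * e ^ 2 + a = 0"
  have a: "a = - 3 * e ^ 2" using *(2) by (simp add: add_eq_0_iff2)
  have "b = - (e ^ 3 + a * e)" using *(1) by (simp add: add_eq_0_iff2 add.commute)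
  then have b: "b = 2 * e ^ 3" unfolding a by (simp add: algebra_simps power2_eq_square power3_eq_cube)
  have "4 * a ^ 3 + 27 * b ^ 2 = 0"
    unfolding a b by (simp add: power_mult_distrib flip: power_mult)
  with nonsingular show False by simp
qed

text \<open>
  The coordinate ring of the affine curve. The values of these functions at infinity carry no
  meaning.
\<close>

inductive polyfun :: "('a point \<Rightarrow> 'a) \<Rightarrow> bool" where
  polyfun_const: "polyfun (\<lambda>P. k)"
| polyfun_px: "polyfun px"
| polyfun_py: "polyfun py"
| polyfun_add: "polyfun g \<Longrightarrow> polyfun h \<Longrightarrow> polyfun (\<lambda>P. g P + h P)"
| polyfun_mult: "polyfun g \<Longrightarrow> polyfun h \<Longrightarrow> polyfun (\<lambda>P. g P * h P)"

lemma polyfun_sum: "(\<And>i. i \<in> A \<Longrightarrow> polyfun (g i)) \<Longrightarrow> polyfun (\<lambda>P. \<Sum>i\<in>A. g i P)"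
  by (induction A rule: infinite_finite_induct) (auto intro: polyfun.intros)

lemma polyfun_power: "polyfun g \<Longrightarrow> polyfun (\<lambda>P. g P ^ n)"
  by (induction n) (auto intro: polyfun.intros)

lemma hc_affine: "P \<noteq> Infinity \<Longrightarrow> homogeneous_coords P = (px P, py P, 1)"
  by (cases P) auto

lemma form_polyfun:
  assumes "ternary_form d F"
  shows "\<exists>g. polyfun g \<and> (\<forall>P. P \<noteq> Infinity \<longrightarrow> F (homogeneous_coords P) = g P)"
proof -
  obtain c where F: "F = (\<lambda>v. \<Sum>p\<in>{(i, j). i + j \<le> d}.
      c p * fst v ^ fst p * fst (snd v) ^ snd p * snd (snd v) ^ (d - fst p - snd p))"
    by (rule form_as_sum[OF assms])
  have "polyfun (\<lambda>P. \<Sum>p\<in>{(i, j). i + j \<le> d}. c p * px P ^ fst p * py P ^ snd p)"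
    by (intro polyfun_sum polyfun_mult polyfun_const polyfun_power polyfun_px polyfun_py)
  then show ?thesis
    by (intro exI[of _ "\<lambda>P. \<Sum>p\<in>{(i, j). i + j \<le> d}. c p * px P ^ fst p * py P ^ snd p"] conjI)
       (simp_all add: F hc_affine)
qed

lemma polyfun_form:
  assumes "polyfun g"
  shows "\<exists>d F. ternary_form d F \<and> (\<forall>P. P \<noteq> Infinity \<longrightarrow> F (homogeneous_coords P) = g P)"
  using assms
proof induction
  case (polyfun_const k)
  show ?case using form_const by (intro exI[of _ "0 :: nat"] exI[of _ "\<lambda>v. k"]) auto
next
  case polyfun_px
  show ?case using form_coord(1) by (intro exI[of _ "1 :: nat"] exI[of _ "\<lambda>v. fst v"]) (auto simp: hc_affine)
next
  case polyfun_py
  show ?case using form_coord(2) by (intro exI[of _ "1 :: nat"] exI[of _ "\<lambda>v. fst (snd v)"]) (auto simp: hc_affine)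
next
  case (polyfun_add g h)
  then obtain d F e G where F: "ternary_form d F" "ternary_form e G"
    "\<And>P. P \<noteq> Infinity \<Longrightarrow> F (homogeneous_coords P) = g P" "\<And>P. P \<noteq> Infinity \<Longrightarrow> G (homogeneous_coords P) = h P"
    by blast
  have "ternary_form (e * 1 + d) (\<lambda>v. snd (snd v) ^ e * F v)" "ternary_form (d * 1 + e) (\<lambda>v. snd (snd v) ^ d * G v)"
    by (rule form_mult[OF form_power[OF form_coord(3)] F(1)],
        rule form_mult[OF form_power[OF form_coord(3)] F(2)])
  then have "ternary_form (d + e) (\<lambda>v. snd (snd v) ^ e * F v + snd (snd v) ^ d * G v)"
    by (intro form_add) (simp_all add: add.commute)
  then show ?case using F(3,4)
    by (intro exI[of _ "d + e"] exI[of _ "\<lambda>v. snd (snd v) ^ e * F v + snd (snd v) ^ d * G v"]) (simp add: hc_affine)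
next
  case (polyfun_mult g h)
  then obtain d F e G where F: "ternary_form d F" "ternary_form e G"
    "\<And>P. P \<noteq> Infinity \<Longrightarrow> F (homogeneous_coords P) = g P" "\<And>P. P \<noteq> Infinity \<Longrightarrow> G (homogeneous_coords P) = h P"
    by blast
  then show ?case
    by (intro exI[of _ "d + e"] exI[of _ "\<lambda>v. F v * G v"]) (simp add: form_mult)
qed

text \<open>
  On the curve a polynomial function is \<open>A(x) + B(x) y\<close>, and its norm \<open>A\<^sup>2 - B\<^sup>2 (x\<^sup>3 + a x + b)\<close>
  is nonzero because the degrees of the two terms have different parity.
\<close>

lemma polyfun_normal_form:
  assumes "polyfun g"
  shows "\<exists>A B :: 'a poly. \<forall>P\<in>pts. P \<noteq> Infinity \<longrightarrow> g P = poly A (px P) + poly B (px P) * py P"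
  using assms
proof induction
  case (polyfun_const k)
  show ?case by (intro exI[of _ "[:k:]"] exI[of _ 0]) auto
next
  case polyfun_px
  show ?case by (intro exI[of _ "[:0, 1:]"] exI[of _ 0]) auto
next
  case polyfun_py
  show ?case by (rule exI[of _ 0], rule exI[of _ 1]) auto
next
  case (polyfun_add g h)
  then obtain A B A' B' where "\<forall>P\<in>pts. P \<noteq> Infinity \<longrightarrow> g P = poly A (px P) + poly B (px P) * py P"
    "\<forall>P\<in>pts. P \<noteq> Infinity \<longrightarrow> h P = poly A' (px P) + poly B' (px P) * py P" by blast
  then show ?case by (intro exI[of _ "A + A'"] exI[of _ "B + B'"]) (auto simp: algebra_simps)
next
  case (polyfun_mult g h)
  then obtain A B A' B' where *: "\<forall>P\<in>pts. P \<noteq> Infinity \<longrightarrow> g P = poly A (px P) + poly B (px P) * py P"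
    "\<forall>P\<in>pts. P \<noteq> Infinity \<longrightarrow> h P = poly A' (px P) + poly B' (px P) * py P" by blast
  have "g P * h P = poly (A * A' + B * B' * cubic) (px P) + poly (A * B' + B * A') (px P) * py P"
    if "P \<in> pts" "P \<noteq> Infinity" for P
  proof -
    have "g P * h P = poly A (px P) * poly A' (px P) + poly B (px P) * poly B' (px P) * (py P ^ 2) +
        (poly A (px P) * poly B' (px P) + poly B (px P) * poly A' (px P)) * py P"
      using * that by (simp add: algebra_simps power2_eq_square)
    also have "py P ^ 2 = poly cubic (px P)" using curve_eq that by (simp add: poly_cubic)
    finally show ?thesis by simp
  qed
  then show ?case by blast
qed

lemma polyfun_finite_zeros:
  assumes g: "polyfun g" and P0: "P0 \<in> pts" "P0 \<noteq> Infinity" "g P0 \<noteq> 0"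
  shows "finite {P \<in> pts. P \<noteq> Infinity \<and> g P = 0}"
proof -
  obtain A B where AB: "\<And>P. P \<in> pts \<Longrightarrow> P \<noteq> Infinity \<Longrightarrow> g P = poly A (px P) + poly B (px P) * py P"
    using polyfun_normal_form[OF g] by blast
  define N where "N = A * A - B * B * cubic"
  have "N \<noteq> 0"
  proof
    assume "N = 0"
    then have eq: "A * A = B * B * cubic" by (simp add: N_def)
    have "B = 0"
    proof (rule ccontr)
      assume B: "B \<noteq> 0"
      have c: "cubic \<noteq> 0" "Polynomial.degree cubic = 3" by (auto simp: cubic_def)
      then have "A \<noteq> 0" using eq B by auto
      have "Polynomial.degree (A * A) = 2 * Polynomial.degree A" using \<open>A \<noteq> 0\<close> by (simp add: degree_mult_eq)
      moreover have "Polynomial.degree (B * B * cubic) = 2 * Polynomial.degree B + 3"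
        using B c by (simp add: degree_mult_eq)
      ultimately have "2 * Polynomial.degree A = 2 * Polynomial.degree B + 3" using eq by simp
      then show False by presburger
    qed
    then have "A = 0" using eq by simp
    then show False using AB[OF P0(1,2)] P0(3) \<open>B = 0\<close> by simp
  qed
  then have "finite {P \<in> pts. P \<noteq> Infinity \<and> px P \<in> {x. poly N x = 0}}"
    using poly_roots_finite finite_px_preimage by blast
  moreover have "poly N (px P) = 0" if "P \<in> pts" "P \<noteq> Infinity" "g P = 0" for P
  proof -
    have "poly A (px P) = - (poly B (px P) * py P)"
      using AB[OF that(1,2)] that(3) by (simp add: eq_neg_iff_add_eq_0)
    then have "poly N (px P) = poly B (px P) * poly B (px P) * (py P ^ 2 - poly cubic (px P))"
      by (simp add: N_def algebra_simps power2_eq_square)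
    then show ?thesis using curve_eq[OF that(1,2)] by (simp add: poly_cubic)
  qed
  ultimately show ?thesis by (auto intro: rev_finite_subset)
qed

lemma dbl_coordinates:
  assumes P: "P \<in> pts" "py P \<noteq> 0"
  shows "px (dbl P) * (4 * (px P ^ 3 + a * px P + b)) = (3 * px P ^ 2 + a) ^ 2 - 8 * px P * (px P ^ 3 + a * px P + b)"
    and "2 * py P * py (dbl P) = - (2 * (px P ^ 3 + a * px P + b) + (3 * px P ^ 2 + a) * (px (dbl P) - px P))"
proof -
  have f: "px P ^ 3 + a * px P + b = py P ^ 2" using P curve_eq by (metis py.simps(2))
  note e = collinear_eqs[OF collinear_tangent(1)[OF P]]
  have sl: "2 * py P * slope P = 3 * px P ^ 2 + a" using P by (simp add: slope_def)
  have "px (dbl P) * (4 * py P ^ 2) = (2 * py P * slope P) ^ 2 - 8 * px P * py P ^ 2"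
    unfolding e(3) by (simp add: algebra_simps power2_eq_square)
  then show "px (dbl P) * (4 * (px P ^ 3 + a * px P + b)) = (3 * px P ^ 2 + a) ^ 2 - 8 * px P * (px P ^ 3 + a * px P + b)"
    unfolding sl f .
  have y: "py (dbl P) = - (slope P * px (dbl P) + (py P - slope P * px P))" using e(6) by (metis minus_minus)
  have "2 * py P * py (dbl P) = - (2 * py P ^ 2 + 2 * py P * slope P * (px (dbl P) - px P))"
    unfolding y by (simp add: algebra_simps power2_eq_square)
  then show "2 * py P * py (dbl P) = - (2 * (px P ^ 3 + a * px P + b) + (3 * px P ^ 2 + a) * (px (dbl P) - px P))"
    unfolding sl f .
qed

end

locale alg_short_curve = short_curve a b
  for a b :: "'a :: {alg_closed_field, field_char_0}"
begin

lemma square_root: "\<exists>y :: 'a. y ^ 2 = x"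
  using nth_root_exists[of 2 x] by simp

lemma infinite_pts: "infinite pts"
proof
  assume "finite pts"
  then have "finite (px ` pts)" by simp
  moreover have "px ` pts = UNIV"
  proof -
    have "x \<in> px ` pts" for x
    proof -
      obtain y where "y ^ 2 = x ^ 3 + a * x + b" using square_root by blast
      then have "Affine x y \<in> pts" by (simp add: Affine_in_pts)
      then show ?thesis by (metis imageI px.simps(1))
    qed
    then show ?thesis by auto
  qed
  ultimately show False using infinite_UNIV_char_0[where 'a = 'a] by simp
qed

lemma point_avoiding: "finite S \<Longrightarrow> \<exists>P. P \<in> pts \<and> P \<notin> S"
  using infinite_pts by (metis finite_subset subsetI)

lemma three_roots:
  obtains e1 e2 e3 where "e1 \<noteq> e2" "e1 \<noteq> e3" "e2 \<noteq> e3"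
    "Affine e1 0 \<in> pts" "Affine e2 0 \<in> pts" "Affine e3 0 \<in> pts"
proof -
  have "Polynomial.degree cubic > 0" by (simp add: cubic_def)
  then obtain e1 where e1: "e1 ^ 3 + a * e1 + b = 0"
    using alg_closed_imp_poly_has_root[of cubic] poly_cubic by auto
  have "Polynomial.degree [:e1 ^ 2 + a, e1, 1:] > 0" by simp
  then obtain e2 where "poly [:e1 ^ 2 + a, e1, 1:] e2 = 0"
    using alg_closed_imp_poly_has_root by blast
  then have e2: "e2 ^ 2 + e1 * e2 + e1 ^ 2 + a = 0" by (simp add: algebra_simps power2_eq_square)
  define e3 where "e3 = - e1 - e2"
  have a: "a = - (e2 ^ 2 + e1 * e2 + e1 ^ 2)" using e2 by (simp add: add_eq_0_iff2 algebra_simps)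
  have "b = - (e1 ^ 3 + a * e1)" using e1 by (simp add: add_eq_0_iff2 algebra_simps)
  then have b: "b = e1 * e2 * (e1 + e2)" unfolding a by (simp add: algebra_simps power2_eq_square power3_eq_cube)
  have r: "e2 ^ 3 + a * e2 + b = 0" "e3 ^ 3 + a * e3 + b = 0"
    unfolding e3_def b a by (simp_all add: algebra_simps power2_eq_square power3_eq_cube)
  have "e1 \<noteq> e2" using double_root_singular[OF e1] unfolding a by (auto simp: power2_eq_square)
  moreover have "e1 \<noteq> e3"
  proof
    assume "e1 = e3"
    then have "e2 = - 2 * e1" by (simp add: e3_def)
    then show False using double_root_singular[OF e1] unfolding a by (simp add: algebra_simps power2_eq_square)
  qed
  moreover have "e2 \<noteq> e3"
  proof
    assume "e2 = e3"
    then have "e1 = - 2 * e2" by (simp add: e3_def)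
    then show False using double_root_singular[OF r(1)] unfolding a by (simp add: algebra_simps power2_eq_square)
  qed
  ultimately show ?thesis using e1 r by (intro that[of e1 e2 e3]) (simp_all add: Affine_in_pts)
qed

text \<open>
  The abscissae of the halves of \<open>Q\<close> are the roots of the quartic polynomial that the duplication
  formula provides. A root determines a half of \<open>Q\<close> or of its opposite.
\<close>

lemma dbl_surj:
  assumes Q: "Q \<in> pts"
  shows "\<exists>P\<in>pts. dbl P = Q"
proof (cases Q)
  case Infinity
  then show ?thesis by (intro bexI[of _ Infinity]) auto
next
  case (Affine u v)
  have "Polynomial.degree [:a ^ 2 - 4 * u * b, - 8 * b - 4 * u * a, - 2 * a, - 4 * u, 1:] > 0" by simp
  then obtain x where "poly [:a ^ 2 - 4 * u * b, - 8 * b - 4 * u * a, - 2 * a, - 4 * u, 1:] x = 0"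
    using alg_closed_imp_poly_has_root by blast
  then have x: "u * (4 * (x ^ 3 + a * x + b)) = (3 * x ^ 2 + a) ^ 2 - 8 * x * (x ^ 3 + a * x + b)"
    by (simp add: algebra_simps power2_eq_square power3_eq_cube)
  have f0: "x ^ 3 + a * x + b \<noteq> 0"
  proof
    assume 0: "x ^ 3 + a * x + b = 0"
    then show False using x double_root_singular[OF 0] by simp
  qed
  obtain y where y: "y ^ 2 = x ^ 3 + a * x + b" using square_root by blast
  define P where "P = Affine x y"
  have P: "P \<in> pts" "py P \<noteq> 0" and px: "px P = x"
    using f0 y by (auto simp: P_def Affine_in_pts)
  have "px (dbl P) * (4 * (x ^ 3 + a * x + b)) = u * (4 * (x ^ 3 + a * x + b))"
    using dbl_coordinates(1)[OF P] x unfolding px by metis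
  moreover have "4 * (x ^ 3 + a * x + b) \<noteq> 0" using f0 by (metis mult_eq_0_iff zero_neq_numeral)
  ultimately have "px (dbl P) = u" unfolding mult_right_cancel[OF \<open>4 * (x ^ 3 + a * x + b) \<noteq> 0\<close>] by blast
  then have "dbl P = Q \<or> dbl P = neg Q"
    using px_eq_iff[OF padd_in_pts[OF P(1) P(1)] Q collinear_tangent(2)[OF P]] Affine by simp
  then have "dbl P = Q \<or> dbl (neg P) = Q" using neg_padd[OF P(1) P(1)] by auto
  then show ?thesis using P(1) neg_in_pts by blast
qed

text \<open>
  The chord formula gives translations at points in general position. The others are composed
  of translations in general position: where \<open>\<phi> P = V\<close>, through a generic point, and where
  \<open>\<phi> P\<close> is infinite, through a two-torsion point, whose translation has explicit forms at
  infinity.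
\<close>

lemma local_forms_translate:
  assumes \<phi>: "local_forms C \<phi> P" "\<And>Q. Q \<in> curve_points C \<Longrightarrow> \<phi> Q \<in> pts"
    and P: "P \<in> curve_points C" and V: "V \<in> pts"
  shows "local_forms C (\<lambda>Q. \<phi> Q \<boxplus> V) P"
proof -
  have direct: "local_forms C (\<lambda>Q. \<psi> Q \<boxplus> W) P"
    if "local_forms C \<psi> P" "\<And>Q. Q \<in> curve_points C \<Longrightarrow> \<psi> Q \<in> pts" "W \<in> pts"
      "\<psi> P \<noteq> Infinity" "W \<noteq> Infinity" "\<psi> P \<noteq> W" for \<psi> W
    by (rule local_forms_padd_distinct[OF that(1,2) local_forms_const that(3) P that(4-6)])
  have via: "local_forms C (\<lambda>Q. \<phi> Q \<boxplus> V) P"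
    if W: "W \<in> pts" and \<psi>: "local_forms C (\<lambda>Q. \<phi> Q \<boxplus> W) P" and
      ne: "\<phi> P \<boxplus> W \<noteq> Infinity" "V \<boxplus> neg W \<noteq> Infinity" "\<phi> P \<boxplus> W \<noteq> V \<boxplus> neg W" for W
  proof (rule local_forms_cong)
    show "local_forms C (\<lambda>Q. (\<phi> Q \<boxplus> W) \<boxplus> (V \<boxplus> neg W)) P"
      using \<phi>(2) W V ne by (intro direct[OF \<psi>]) auto
    show "\<phi> Q \<boxplus> W \<boxplus> (V \<boxplus> neg W) = \<phi> Q \<boxplus> V" if "Q \<in> curve_points C" for Q
      using padd_diff \<phi>(2)[OF that] W V by simp
  qed
  have \<phi>P: "\<phi> P \<in> pts" using \<phi>(2) P by blast
  consider (V0) "V = Infinity" | (P0) "V \<noteq> Infinity" "\<phi> P = Infinity"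
    | (eq) "V \<noteq> Infinity" "\<phi> P = V" | (ne) "V \<noteq> Infinity" "\<phi> P \<noteq> Infinity" "\<phi> P \<noteq> V" by blast
  then show ?thesis
  proof cases
    case V0
    then show ?thesis using \<phi> by simp
  next
    case ne
    then show ?thesis using direct \<phi> V by blast
  next
    case eq
    have "finite (insert Infinity (insert V (insert (neg V) {P \<in> pts. P \<noteq> Infinity \<and> py P = 0})))"
      using finite_two_torsion by simp
    from point_avoiding[OF this] obtain W where W: "W \<in> pts"
      "W \<notin> insert Infinity (insert V (insert (neg V) {P \<in> pts. P \<noteq> Infinity \<and> py P = 0}))" by blast
    then have "neg W \<noteq> W" using neg_eq_iff_dbl dbl_eq_Infinity_iff by auto
    moreover have "V \<noteq> neg W" using W by auto
    ultimately show ?thesis using W V eq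
      by (intro via[OF W(1)] direct[OF \<phi> W(1)]) (auto simp: padd_eq_Infinity_iff)
  next
    case P0
    obtain e where "Affine e 0 \<in> pts" using three_roots by metis
    moreover define T where "T = Affine e 0"
    ultimately have T: "T \<in> pts" "T \<noteq> Infinity" "neg T = T"
      and loc: "local_forms E (\<lambda>Q. Q \<boxplus> T) Infinity"
      using local_forms_translate_Infinity by (simp_all del: point_add.simps(3))
    have l: "local_forms C (\<lambda>Q. \<phi> Q \<boxplus> T) P"
      by (rule local_forms_compose[where D = E and \<psi> = "\<lambda>Q. Q \<boxplus> T", OF \<phi>(1) _ P \<phi>(2)])
         (simp_all add: P0 loc)
    show ?thesis
    proof (cases "V = T")
      case False
      have "T \<noteq> T \<boxplus> V" using padd_left_cancel[OF T(1) _ V, of Infinity] T(1) P0(1) by auto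
      moreover have "T \<boxplus> V \<noteq> Infinity" using padd_eq_Infinity_iff[OF T(1) V] T(3) False by simp
      ultimately show ?thesis using T l V P0
        by (intro via[OF T(1) l]) (simp_all add: padd_comm[OF V T(1)])
    qed (use l in simp)
  qed
qed

text \<open>
  Translating both maps to points in general position, where the chord formula applies, and
  translating the sum back, shows that sums of morphisms are morphisms.
\<close>

lemma local_forms_padd:
  assumes \<phi>: "local_forms C \<phi> P" "\<And>Q. Q \<in> curve_points C \<Longrightarrow> \<phi> Q \<in> pts"
    and \<psi>: "local_forms C \<psi> P" "\<And>Q. Q \<in> curve_points C \<Longrightarrow> \<psi> Q \<in> pts"
    and P: "P \<in> curve_points C"
  shows "local_forms C (\<lambda>Q. \<phi> Q \<boxplus> \<psi> Q) P"
proof -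
  obtain R where R: "R \<in> pts" "R \<noteq> Infinity" using point_avoiding[of "{Infinity}"] by auto
  obtain S where S: "S \<in> pts" "S \<noteq> Infinity" "S \<noteq> R" using point_avoiding[of "{Infinity, R}"] by auto
  define V W where "V = neg (\<phi> P) \<boxplus> R" and "W = neg (\<psi> P) \<boxplus> S"
  have VW: "V \<in> pts" "W \<in> pts" using \<phi>(2)[OF P] \<psi>(2)[OF P] R S by (auto simp: V_def W_def)
  have val: "\<phi> P \<boxplus> V = R" "\<psi> P \<boxplus> W = S"
    using padd_cancel'[of R "neg (\<phi> P)"] padd_cancel'[of S "neg (\<psi> P)"] \<phi>(2)[OF P] \<psi>(2)[OF P] R S
    by (auto simp: V_def W_def)
  have "local_forms C (\<lambda>Q. (\<phi> Q \<boxplus> V) \<boxplus> (\<psi> Q \<boxplus> W)) P"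
    using \<phi> \<psi> VW val R S P
    by (intro local_forms_padd_distinct local_forms_translate) auto
  then have l: "local_forms C (\<lambda>Q. (\<phi> Q \<boxplus> V) \<boxplus> (\<psi> Q \<boxplus> W) \<boxplus> neg (V \<boxplus> W)) P"
    using \<phi> \<psi> VW P by (intro local_forms_translate) auto
  show ?thesis
  proof (rule local_forms_cong[OF l])
    fix Q assume Q: "Q \<in> curve_points C"
    show "(\<phi> Q \<boxplus> V) \<boxplus> (\<psi> Q \<boxplus> W) \<boxplus> neg (V \<boxplus> W) = \<phi> Q \<boxplus> \<psi> Q"
      using padd_rearrange[of "\<phi> Q" "\<psi> Q" V W] padd_cancel[of "\<phi> Q \<boxplus> \<psi> Q" "V \<boxplus> W"] \<phi>(2)[OF Q] \<psi>(2)[OF Q] VW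
      by simp
  qed
qed

end


section \<open>Division of endomorphisms by two\<close>

context alg_short_curve
begin

definition fibre_poly :: "(nat \<Rightarrow> 'a point \<Rightarrow> 'a) \<Rightarrow> 'a point \<Rightarrow> 'a" where
  "fibre_poly c P = (\<Sum>i<4. c i (dbl P) * px P ^ i)"

text \<open>
  Over the functions of \<open>Q = 2 P\<close>, the abscissa of \<open>P\<close> is a root of a monic quartic polynomial, and
  the ordinate of \<open>P\<close> is a polynomial in it once the ordinate of \<open>Q\<close> is inverted. Hence every
  polynomial function of \<open>P\<close> is, up to a power of the ordinate of \<open>Q\<close>, a cubic polynomial in the
  abscissa of \<open>P\<close>.
\<close>

definition cubic_over_double :: "('a point \<Rightarrow> 'a) \<Rightarrow> bool" where
  "cubic_over_double g \<longleftrightarrow> (\<exists>N c. (\<forall>i. polyfun (c i)) \<and>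
     (\<forall>P\<in>pts. py P \<noteq> 0 \<longrightarrow> py (dbl P) \<noteq> 0 \<longrightarrow> py (dbl P) ^ N * g P = fibre_poly c P))"

lemma sum_upto_4: "(\<Sum>i<(4 :: nat). f i) = f 0 + f 1 + f 2 + (f 3 :: 'a)"
  by (simp add: eval_nat_numeral)

lemma fibre_poly_eq: "fibre_poly c P =
    c 0 (dbl P) + c 1 (dbl P) * px P + c 2 (dbl P) * px P ^ 2 + c 3 (dbl P) * px P ^ 3"
  by (simp add: fibre_poly_def sum_upto_4)

lemma cubic_over_double_add:
  assumes "cubic_over_double g" "cubic_over_double h"
  shows "cubic_over_double (\<lambda>P. g P + h P)"
proof -
  obtain N c where c: "\<And>i. polyfun (c i)"
    "\<And>P. P \<in> pts \<Longrightarrow> py P \<noteq> 0 \<Longrightarrow> py (dbl P) \<noteq> 0 \<Longrightarrow> py (dbl P) ^ N * g P = fibre_poly c P"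
    using assms(1) unfolding cubic_over_double_def by blast
  obtain M d where d: "\<And>i. polyfun (d i)"
    "\<And>P. P \<in> pts \<Longrightarrow> py P \<noteq> 0 \<Longrightarrow> py (dbl P) \<noteq> 0 \<Longrightarrow> py (dbl P) ^ M * h P = fibre_poly d P"
    using assms(2) unfolding cubic_over_double_def by blast
  define e where "e i Q = py Q ^ M * c i Q + py Q ^ N * d i Q" for i Q
  have "polyfun (e i)" for i
    unfolding e_def by (intro polyfun_add polyfun_mult polyfun_power polyfun_py c d)
  moreover have "py (dbl P) ^ (N + M) * (g P + h P) = fibre_poly e P"
    if "P \<in> pts" "py P \<noteq> 0" "py (dbl P) \<noteq> 0" for P
  proof -
    have "py (dbl P) ^ (N + M) * (g P + h P) =
        py (dbl P) ^ M * (py (dbl P) ^ N * g P) + py (dbl P) ^ N * (py (dbl P) ^ M * h P)"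
      by (simp add: power_add algebra_simps)
    also have "\<dots> = fibre_poly e P"
      unfolding c(2)[OF that] d(2)[OF that] fibre_poly_eq e_def by (simp add: algebra_simps)
    finally show ?thesis .
  qed
  ultimately show ?thesis unfolding cubic_over_double_def by blast
qed

lemma cubic_over_double_scale:
  assumes "polyfun k" "cubic_over_double g"
  shows "cubic_over_double (\<lambda>P. k (dbl P) * g P)"
proof -
  obtain N c where c: "\<And>i. polyfun (c i)"
    "\<And>P. P \<in> pts \<Longrightarrow> py P \<noteq> 0 \<Longrightarrow> py (dbl P) \<noteq> 0 \<Longrightarrow> py (dbl P) ^ N * g P = fibre_poly c P"
    using assms(2) unfolding cubic_over_double_def by blast
  have "py (dbl P) ^ N * (k (dbl P) * g P) = fibre_poly (\<lambda>i Q. k Q * c i Q) P"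
    if "P \<in> pts" "py P \<noteq> 0" "py (dbl P) \<noteq> 0" for P
  proof -
    have "py (dbl P) ^ N * (k (dbl P) * g P) = k (dbl P) * (py (dbl P) ^ N * g P)"
      by (simp add: mult_ac)
    then show ?thesis unfolding c(2)[OF that] fibre_poly_eq by (simp add: algebra_simps)
  qed
  moreover have "polyfun (\<lambda>Q. k Q * c i Q)" for i by (intro polyfun_mult assms c)
  ultimately show ?thesis
    unfolding cubic_over_double_def by (intro exI[of _ N] exI[of _ "\<lambda>i Q. k Q * c i Q"]) simp
qed

lemma cubic_over_double_px:
  assumes "cubic_over_double g"
  shows "cubic_over_double (\<lambda>P. px P * g P)"
proof -
  obtain N c where c: "\<And>i. polyfun (c i)"
    "\<And>P. P \<in> pts \<Longrightarrow> py P \<noteq> 0 \<Longrightarrow> py (dbl P) \<noteq> 0 \<Longrightarrow> py (dbl P) ^ N * g P = fibre_poly c P"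
    using assms unfolding cubic_over_double_def by blast
  define k where "k = - (a ^ 2)"
  define d where "d i = (if i = 0 then (\<lambda>Q. (4 * b * px Q + k) * c 3 Q)
    else if i = 1 then (\<lambda>Q. c 0 Q + (8 * b + 4 * a * px Q) * c 3 Q)
    else if i = 2 then (\<lambda>Q. c 1 Q + 2 * a * c 3 Q)
    else (\<lambda>Q. c 2 Q + 4 * px Q * c 3 Q))" for i :: nat
  have "polyfun (d i)" for i
    unfolding d_def by (simp, intro conjI impI polyfun_add polyfun_mult polyfun_px c polyfun_const)
  moreover have "py (dbl P) ^ N * (px P * g P) = fibre_poly d P"
    if "P \<in> pts" "py P \<noteq> 0" "py (dbl P) \<noteq> 0" for P
  proof -
    define u x where "u = px (dbl P)" and "x = px P"
    have "u * (4 * (x ^ 3 + a * x + b)) = (3 * x ^ 2 + a) ^ 2 - 8 * x * (x ^ 3 + a * x + b)"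
      unfolding u_def x_def by (rule dbl_coordinates(1)[OF that(1,2)])
    then have x4: "x ^ 4 = 4 * b * u + - (a ^ 2) + (8 * b + 4 * a * u) * x + 2 * a * x ^ 2 + 4 * u * x ^ 3"
      by (simp add: algebra_simps power2_eq_square power3_eq_cube power4_eq_xxxx)
    have "py (dbl P) ^ N * (px P * g P) = px P * fibre_poly c P"
      unfolding c(2)[OF that, symmetric] by (simp add: mult_ac)
    also have "\<dots> = c 0 (dbl P) * x + c 1 (dbl P) * x ^ 2 + c 2 (dbl P) * x ^ 3 + c 3 (dbl P) * x ^ 4"
      unfolding fibre_poly_eq x_def
      by (simp add: algebra_simps power2_eq_square power3_eq_cube power4_eq_xxxx)
    also have "\<dots> = fibre_poly d P"
      unfolding x4 unfolding fibre_poly_eq d_def k_def u_def x_def by (simp add: algebra_simps)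
    finally show ?thesis .
  qed
  ultimately show ?thesis unfolding cubic_over_double_def by blast
qed

lemma cubic_over_double_cancel:
  assumes "cubic_over_double h"
    and eq: "\<And>P. P \<in> pts \<Longrightarrow> py P \<noteq> 0 \<Longrightarrow> py (dbl P) \<noteq> 0 \<Longrightarrow> py (dbl P) ^ M * g P = h P"
  shows "cubic_over_double g"
proof -
  obtain N c where c: "\<And>i. polyfun (c i)"
    "\<And>P. P \<in> pts \<Longrightarrow> py P \<noteq> 0 \<Longrightarrow> py (dbl P) \<noteq> 0 \<Longrightarrow> py (dbl P) ^ N * h P = fibre_poly c P"
    using assms(1) unfolding cubic_over_double_def by blast
  have "py (dbl P) ^ (N + M) * g P = fibre_poly c P"
    if "P \<in> pts" "py P \<noteq> 0" "py (dbl P) \<noteq> 0" for P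
    unfolding c(2)[OF that, symmetric] eq[OF that, symmetric] by (simp add: power_add mult_ac)
  then show ?thesis using c(1) unfolding cubic_over_double_def by blast
qed

lemma cubic_over_double_const: "cubic_over_double (\<lambda>P. k)"
proof -
  have "polyfun (if i = 0 then (\<lambda>P. k) else (\<lambda>P. 0))" for i :: nat by (simp add: polyfun_const)
  then show ?thesis
    unfolding cubic_over_double_def
    by (intro exI[of _ "0 :: nat"] exI[of _ "\<lambda>i. if i = 0 then (\<lambda>P. k) else (\<lambda>P. 0)"]) (simp add: fibre_poly_eq)
qed

lemma cubic_over_double_sum:
  "(\<And>i. i \<in> A \<Longrightarrow> cubic_over_double (g i)) \<Longrightarrow> cubic_over_double (\<lambda>P. \<Sum>i\<in>A. g i P)"
  by (induction A rule: infinite_finite_induct) (auto intro: cubic_over_double_const cubic_over_double_add)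

lemma cubic_over_double_px_power:
  "cubic_over_double g \<Longrightarrow> cubic_over_double (\<lambda>P. px P ^ n * g P)"
  by (induction n) (auto simp: mult.assoc dest: cubic_over_double_px)

lemma cubic_over_double_polyfun: "polyfun g \<Longrightarrow> cubic_over_double g"
proof (induction rule: polyfun.induct)
  case (polyfun_const k)
  show ?case by (rule cubic_over_double_const)
next
  case polyfun_px
  show ?case using cubic_over_double_px[OF cubic_over_double_const[of 1]] by simp
next
  case polyfun_py
  \<comment> \<open>The tangent at \<open>P\<close> passes through \<open>- 2 P\<close>; solved for the ordinate of \<open>P\<close>, this divides by the
    ordinate of \<open>2 P\<close>.\<close>
  have 1: "cubic_over_double (\<lambda>P. px P ^ n)" for n
    using cubic_over_double_px_power[OF cubic_over_double_const[of 1]] by simp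
  have u: "cubic_over_double (\<lambda>P. (- 3 / 2 * px (dbl P)) * px P ^ 2)"
    "cubic_over_double (\<lambda>P. (- a / 2) * px P ^ 1)" "cubic_over_double (\<lambda>P. (1 / 2) * px P ^ 3)"
    "cubic_over_double (\<lambda>P. (- b + - a / 2 * px (dbl P)) * 1)"
    using cubic_over_double_scale[of "\<lambda>Q. - 3 / 2 * px Q", OF _ 1[of 2]]
      cubic_over_double_scale[of "\<lambda>Q. - a / 2", OF _ 1[of 1]] cubic_over_double_scale[of "\<lambda>Q. 1 / 2", OF _ 1[of 3]]
      cubic_over_double_scale[of "\<lambda>Q. - b + - a / 2 * px Q", OF _ cubic_over_double_const[of 1]]
    by (simp_all only: polyfun.intros)
  show ?case
  proof (rule cubic_over_double_cancel)
    show "cubic_over_double (\<lambda>P. ((- 3 / 2 * px (dbl P)) * px P ^ 2 + (- a / 2) * px P ^ 1) +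
        ((1 / 2) * px P ^ 3 + (- b + - a / 2 * px (dbl P)) * 1))"
      by (intro cubic_over_double_add u)
    fix P assume P: "P \<in> pts" "py P \<noteq> 0"
    have "py (dbl P) ^ 1 * py P = (2 * py P * py (dbl P)) / 2" by simp
    also have "\<dots> = ((- 3 / 2 * px (dbl P)) * px P ^ 2 + (- a / 2) * px P ^ 1) +
        ((1 / 2) * px P ^ 3 + (- b + - a / 2 * px (dbl P)) * 1)"
      unfolding dbl_coordinates(2)[OF P] by (simp add: field_simps power2_eq_square power3_eq_cube)
    finally show "py (dbl P) ^ 1 * py P = ((- 3 / 2 * px (dbl P)) * px P ^ 2 + (- a / 2) * px P ^ 1) +
        ((1 / 2) * px P ^ 3 + (- b + - a / 2 * px (dbl P)) * 1)" .
  qed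
next
  case (polyfun_add g h)
  then show ?case by (intro cubic_over_double_add)
next
  case (polyfun_mult g h)
  obtain N c where c: "\<And>i. polyfun (c i)"
    "\<And>P. P \<in> pts \<Longrightarrow> py P \<noteq> 0 \<Longrightarrow> py (dbl P) \<noteq> 0 \<Longrightarrow> py (dbl P) ^ N * g P = fibre_poly c P"
    using polyfun_mult.IH(1) unfolding cubic_over_double_def by blast
  show ?case
  proof (rule cubic_over_double_cancel)
    show "cubic_over_double (\<lambda>P. \<Sum>i<4. c i (dbl P) * (px P ^ i * h P))"
      by (intro cubic_over_double_sum cubic_over_double_scale cubic_over_double_px_power c polyfun_mult.IH)
    fix P assume P: "P \<in> pts" "py P \<noteq> 0" "py (dbl P) \<noteq> 0"
    have "py (dbl P) ^ N * (g P * h P) = fibre_poly c P * h P"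
      unfolding c(2)[OF P, symmetric] by (simp add: mult_ac)
    then show "py (dbl P) ^ N * (g P * h P) = (\<Sum>i<4. c i (dbl P) * (px P ^ i * h P))"
      unfolding fibre_poly_def sum_distrib_right by (simp only: mult.assoc)
  qed
qed

lemma cubic_over_double_common:
  assumes "polyfun g1" "polyfun g2" "polyfun g3"
  obtains N c1 c2 c3 where "\<And>i. polyfun (c1 i)" "\<And>i. polyfun (c2 i)" "\<And>i. polyfun (c3 i)"
    "\<And>P. P \<in> pts \<Longrightarrow> py P \<noteq> 0 \<Longrightarrow> py (dbl P) \<noteq> 0 \<Longrightarrow>
      py (dbl P) ^ N * g1 P = fibre_poly c1 P \<and> py (dbl P) ^ N * g2 P = fibre_poly c2 P \<and>
      py (dbl P) ^ N * g3 P = fibre_poly c3 P"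
proof -
  have raise: "\<exists>N. \<forall>M\<ge>N. \<exists>c. (\<forall>i. polyfun (c i)) \<and> (\<forall>P\<in>pts. py P \<noteq> 0 \<longrightarrow> py (dbl P) \<noteq> 0 \<longrightarrow>
      py (dbl P) ^ M * g P = fibre_poly c P)" if gp: "polyfun g" for g
  proof -
    obtain N c where c: "\<And>i. polyfun (c i)"
      "\<And>P. P \<in> pts \<Longrightarrow> py P \<noteq> 0 \<Longrightarrow> py (dbl P) \<noteq> 0 \<Longrightarrow> py (dbl P) ^ N * g P = fibre_poly c P"
      using cubic_over_double_polyfun[OF gp] unfolding cubic_over_double_def by blast
    have "\<exists>c. (\<forall>i. polyfun (c i)) \<and> (\<forall>P\<in>pts. py P \<noteq> 0 \<longrightarrow> py (dbl P) \<noteq> 0 \<longrightarrow>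
      py (dbl P) ^ M * g P = fibre_poly c P)" if "M \<ge> N" for M
    proof (intro exI[of _ "\<lambda>i Q. py Q ^ (M - N) * c i Q"] conjI allI ballI impI)
      show "polyfun (\<lambda>Q. py Q ^ (M - N) * c i Q)" for i
        by (intro polyfun_mult polyfun_power polyfun_py c)
      fix P assume P: "P \<in> pts" "py P \<noteq> 0" "py (dbl P) \<noteq> 0"
      have "py (dbl P) ^ M = py (dbl P) ^ (M - N) * py (dbl P) ^ N"
        using that by (simp flip: power_add)
      then have "py (dbl P) ^ M * g P = py (dbl P) ^ (M - N) * fibre_poly c P"
        unfolding c(2)[OF P, symmetric] by (simp add: mult_ac)
      then show "py (dbl P) ^ M * g P = fibre_poly (\<lambda>i Q. py Q ^ (M - N) * c i Q) P"
        by (simp add: fibre_poly_eq algebra_simps)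
    qed
    then show ?thesis by blast
  qed
  obtain N1 where N1:
    "\<forall>M\<ge>N1. \<exists>c. (\<forall>i. polyfun (c i)) \<and> (\<forall>P\<in>pts. py P \<noteq> 0 \<longrightarrow> py (dbl P) \<noteq> 0 \<longrightarrow> py (dbl P) ^ M * g1 P = fibre_poly c P)"
    using raise[OF assms(1)] by blast
  obtain N2 where N2:
    "\<forall>M\<ge>N2. \<exists>c. (\<forall>i. polyfun (c i)) \<and> (\<forall>P\<in>pts. py P \<noteq> 0 \<longrightarrow> py (dbl P) \<noteq> 0 \<longrightarrow> py (dbl P) ^ M * g2 P = fibre_poly c P)"
    using raise[OF assms(2)] by blast
  obtain N3 where N3:
    "\<forall>M\<ge>N3. \<exists>c. (\<forall>i. polyfun (c i)) \<and> (\<forall>P\<in>pts. py P \<noteq> 0 \<longrightarrow> py (dbl P) \<noteq> 0 \<longrightarrow> py (dbl P) ^ M * g3 P = fibre_poly c P)"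
    using raise[OF assms(3)] by blast
  have le: "N1 \<le> N1 + N2 + N3" "N2 \<le> N1 + N2 + N3" "N3 \<le> N1 + N2 + N3" by auto
  obtain c1 where c1: "(\<forall>i. polyfun (c1 i)) \<and> (\<forall>P\<in>pts. py P \<noteq> 0 \<longrightarrow> py (dbl P) \<noteq> 0 \<longrightarrow>
      py (dbl P) ^ (N1 + N2 + N3) * g1 P = fibre_poly c1 P)"
    using N1[rule_format, OF le(1)] by blast
  obtain c2 where c2: "(\<forall>i. polyfun (c2 i)) \<and> (\<forall>P\<in>pts. py P \<noteq> 0 \<longrightarrow> py (dbl P) \<noteq> 0 \<longrightarrow>
      py (dbl P) ^ (N1 + N2 + N3) * g2 P = fibre_poly c2 P)"
    using N2[rule_format, OF le(2)] by blast
  obtain c3 where c3: "(\<forall>i. polyfun (c3 i)) \<and> (\<forall>P\<in>pts. py P \<noteq> 0 \<longrightarrow> py (dbl P) \<noteq> 0 \<longrightarrow>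
      py (dbl P) ^ (N1 + N2 + N3) * g3 P = fibre_poly c3 P)"
    using N3[rule_format, OF le(3)] by blast
  show ?thesis by (intro that[of c1 c2 c3 "N1 + N2 + N3"]) (use c1 c2 c3 in auto)
qed

text \<open>
  The four points of a fibre of doubling have distinct abscissae, so a cubic polynomial vanishing
  on the fibre is zero.
\<close>

lemma fibre_poly_vanishes:
  assumes P: "P \<in> pts" "py (dbl P) \<noteq> 0"
    and zero: "\<And>P'. P' \<in> pts \<Longrightarrow> dbl P' = dbl P \<Longrightarrow> d0 + d1 * px P' + d2 * px P' ^ 2 + d3 * px P' ^ 3 = 0"
  shows "d0 = 0 \<and> d1 = 0 \<and> d2 = 0 \<and> d3 = (0 :: 'a)"
proof -
  obtain e1 e2 e3 where e: "e1 \<noteq> e2" "e1 \<noteq> e3" "e2 \<noteq> e3"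
    "Affine e1 0 \<in> pts" "Affine e2 0 \<in> pts" "Affine e3 0 \<in> pts" by (rule three_roots)
  define T where "T = {Infinity, Affine e1 0, Affine e2 0, Affine e3 0}"
  have T: "card T = 4" "T \<subseteq> pts" "\<And>t. t \<in> T \<Longrightarrow> dbl t = Infinity"
    using e by (auto simp: T_def)
  have ddP: "dbl (dbl P) \<noteq> Infinity"
    using dbl_eq_Infinity_iff[of "dbl P"] P by (metis padd_in_pts py.simps(2))
  have inj: "inj_on (\<lambda>t. px (P \<boxplus> t)) T"
  proof (rule inj_onI)
    fix s t assume st: "s \<in> T" "t \<in> T" "px (P \<boxplus> s) = px (P \<boxplus> t)"
    then have in': "s \<in> pts" "t \<in> pts" using T by auto
    have d: "dbl (P \<boxplus> s) = dbl P" "dbl (P \<boxplus> t) = dbl P" using in' T st P by (simp_all add: dbl_padd)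
    then have "P \<boxplus> s \<noteq> Infinity" "P \<boxplus> t \<noteq> Infinity" using ddP by auto
    then have "P \<boxplus> s = P \<boxplus> t \<or> P \<boxplus> s = neg (P \<boxplus> t)"
      using px_eq_iff[of "P \<boxplus> s" "P \<boxplus> t"] in' P st by simp
    moreover have "P \<boxplus> s \<noteq> neg (P \<boxplus> t)"
    proof
      assume "P \<boxplus> s = neg (P \<boxplus> t)"
      then have "dbl (P \<boxplus> s) = neg (dbl (P \<boxplus> t))" using neg_padd[of "P \<boxplus> t" "P \<boxplus> t"] in' P by simp
      then have "neg (dbl P) = dbl P" using d by simp
      then show False using ddP neg_eq_iff_dbl[of "dbl P"] P by simp
    qed
    ultimately show "s = t" using in' P by simp
  qed
  define p where "p = [:d0, d1, d2, d3:]"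
  have "poly p (px (P \<boxplus> t)) = 0" if "t \<in> T" for t
  proof -
    have "P \<boxplus> t \<in> pts" "dbl (P \<boxplus> t) = dbl P" using that T P by (auto simp: dbl_padd subset_iff)
    from zero[OF this] show ?thesis by (simp add: p_def algebra_simps power2_eq_square power3_eq_cube)
  qed
  then have sub: "(\<lambda>t. px (P \<boxplus> t)) ` T \<subseteq> {x. poly p x = 0}" by auto
  have "p = 0"
  proof (rule ccontr)
    assume p: "p \<noteq> 0"
    have "card ((\<lambda>t. px (P \<boxplus> t)) ` T) = 4" using card_image[OF inj] T by simp
    then have "4 \<le> card {x. poly p x = 0}" using card_mono[OF poly_roots_finite[OF p] sub] by simp
    also have "\<dots> \<le> Polynomial.degree p" using card_poly_roots_bound[OF p] .
    also have "\<dots> \<le> 3" by (simp add: p_def)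
    finally show False by simp
  qed
  then show ?thesis by (simp add: p_def)
qed

lemma parallel_vectors:
  fixes f g h r1 r2 r3 :: 'a
  assumes "(r1, r2, r3) \<noteq> (0, 0, 0)" "f * r2 = g * r1" "f * r3 = h * r1" "g * r3 = h * r2"
  shows "\<exists>t. (f, g, h) = (t * r1, t * r2, t * r3)"
proof -
  consider "r1 \<noteq> 0" | "r2 \<noteq> 0" | "r3 \<noteq> 0" using assms(1) by auto
  then show ?thesis
  proof cases
    case 1 then show ?thesis using assms by (intro exI[of _ "f / r1"]) (auto simp: field_simps)
  next
    case 2 then show ?thesis using assms by (intro exI[of _ "g / r2"]) (auto simp: field_simps)
  next
    case 3 then show ?thesis using assms by (intro exI[of _ "h / r3"]) (auto simp: field_simps)
  qed
qed

text \<open>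
  The map \<open>\<beta> Q = \<gamma> (Q / 2)\<close> is well defined, and it has to be shown that it is a morphism. With
  \<open>2 P = Q\<close>, the forms for \<open>\<gamma>\<close> at \<open>P\<close> are cubic polynomials in the abscissa of \<open>P\<close> with coefficients
  that are functions of \<open>Q\<close>. The point \<open>\<gamma> P\<close> being the same for all four \<open>P\<close> in a fibre, the
  coefficients of each power of the abscissa are themselves proportional to the coordinates of
  \<open>\<beta> Q\<close>. This gives forms at one point, and translations carry them to all points.
\<close>

theorem divisible_by_two:
  assumes maps: "\<And>P. P \<in> pts \<Longrightarrow> \<gamma> P \<in> pts"
    and add: "\<And>P Q. P \<in> pts \<Longrightarrow> Q \<in> pts \<Longrightarrow> \<gamma> (P \<boxplus> Q) = \<gamma> P \<boxplus> \<gamma> Q"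
    and forms: "\<And>P. P \<in> pts \<Longrightarrow> local_forms E \<gamma> P"
    and kill: "\<And>T. T \<in> pts \<Longrightarrow> dbl T = Infinity \<Longrightarrow> \<gamma> T = Infinity"
  shows "\<exists>\<beta>. (\<forall>P\<in>pts. \<beta> P \<in> pts) \<and> (\<forall>P\<in>pts. \<forall>Q\<in>pts. \<beta> (P \<boxplus> Q) = \<beta> P \<boxplus> \<beta> Q) \<and>
    (\<forall>P\<in>pts. local_forms E \<beta> P) \<and> (\<forall>P\<in>pts. dbl (\<beta> P) = \<gamma> P)"
proof -
  define half where "half Q = (SOME P. P \<in> pts \<and> dbl P = Q)" for Q
  have half: "half Q \<in> pts" "dbl (half Q) = Q" if "Q \<in> pts" for Q
    using someI_ex[of "\<lambda>P. P \<in> pts \<and> dbl P = Q"] dbl_surj[OF that] unfolding half_def by auto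
  define \<beta> where "\<beta> Q = \<gamma> (half Q)" for Q
  have \<beta>_pts: "\<beta> Q \<in> pts" if "Q \<in> pts" for Q using half that maps by (simp add: \<beta>_def)
  have \<beta>: "\<beta> (dbl P) = \<gamma> P" if P: "P \<in> pts" for P
  proof -
    define H where "H = half (dbl P)"
    have H: "H \<in> pts" "dbl H = dbl P" using half P by (auto simp: H_def)
    have "dbl (H \<boxplus> neg P) = Infinity" using H P by (simp add: dbl_padd neg_padd[symmetric])
    then have "\<gamma> (H \<boxplus> neg P) = Infinity" using kill H P by simp
    then have "\<gamma> ((H \<boxplus> neg P) \<boxplus> P) = \<gamma> P" using add[of "H \<boxplus> neg P" P] H P by simp
    moreover have "(H \<boxplus> neg P) \<boxplus> P = H" using padd_cancel[of H "neg P"] H P by simp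
    ultimately show ?thesis by (simp add: \<beta>_def H_def)
  qed
  have \<beta>_add: "\<beta> (P \<boxplus> Q) = \<beta> P \<boxplus> \<beta> Q" if "P \<in> pts" "Q \<in> pts" for P Q
  proof -
    have "P \<boxplus> Q = dbl (half P \<boxplus> half Q)" using half that by (simp add: dbl_padd)
    then have "\<beta> (P \<boxplus> Q) = \<gamma> (half P \<boxplus> half Q)" using \<beta> half that by simp
    then show ?thesis using add half that by (simp add: \<beta>_def)
  qed
  have \<beta>_dbl: "dbl (\<beta> P) = \<gamma> P" if "P \<in> pts" for P using \<beta>_add[OF that that] \<beta>[OF that] by simp
  have \<beta>_neg: "\<beta> (neg P) = neg (\<beta> P)" if "P \<in> pts" for P
  proof -
    have "\<beta> P \<boxplus> \<beta> (neg P) = \<beta> Infinity" using \<beta>_add[of P "neg P"] that by simp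
    also have "\<beta> Infinity = Infinity" using \<beta>[of Infinity] kill[of Infinity] by simp
    finally show ?thesis using padd_eq_Infinity_iff \<beta>_pts that by simp
  qed
  have hcP: "\<exists>\<Phi> d. form_map d \<Phi> \<and> (\<exists>P\<in>pts. P \<noteq> Infinity \<and> \<Phi> (homogeneous_coords P) \<noteq> (0, 0, 0)) \<and>
    (\<forall>Q\<in>pts. \<Phi> (homogeneous_coords Q) \<noteq> (0, 0, 0) \<longrightarrow>
        (\<exists>t. t \<noteq> 0 \<and> \<Phi> (homogeneous_coords Q) = vscale t (homogeneous_coords (\<gamma> Q))))"
  proof -
    obtain P where "P \<in> pts" "P \<noteq> Infinity" using point_avoiding[of "{Infinity}"] by auto
    then show ?thesis using forms[of P] unfolding local_forms_def by blast
  qed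
  then obtain \<Phi> d P0 where \<Phi>: "form_map d \<Phi>" "P0 \<in> pts" "P0 \<noteq> Infinity"
    "\<Phi> (homogeneous_coords P0) \<noteq> (0, 0, 0)" and
    \<gamma>\<Phi>: "\<And>Q. Q \<in> pts \<Longrightarrow> \<Phi> (homogeneous_coords Q) \<noteq> (0, 0, 0) \<Longrightarrow>
        \<exists>t. t \<noteq> 0 \<and> \<Phi> (homogeneous_coords Q) = vscale t (homogeneous_coords (\<gamma> Q))"
    by blast
  obtain g1 g2 g3 where g: "polyfun g1" "polyfun g2" "polyfun g3" and
    \<Phi>g: "\<And>P. P \<noteq> Infinity \<Longrightarrow> \<Phi> (homogeneous_coords P) = (g1 P, g2 P, g3 P)"
  proof -
    obtain g1 g2 g3 where "polyfun g1 \<and> (\<forall>P. P \<noteq> Infinity \<longrightarrow> fst (\<Phi> (homogeneous_coords P)) = g1 P)"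
      "polyfun g2 \<and> (\<forall>P. P \<noteq> Infinity \<longrightarrow> fst (snd (\<Phi> (homogeneous_coords P))) = g2 P)"
      "polyfun g3 \<and> (\<forall>P. P \<noteq> Infinity \<longrightarrow> snd (snd (\<Phi> (homogeneous_coords P))) = g3 P)"
      using \<Phi>(1) form_polyfun[of d "\<lambda>v. fst (\<Phi> v)"] form_polyfun[of d "\<lambda>v. fst (snd (\<Phi> v))"]
        form_polyfun[of d "\<lambda>v. snd (snd (\<Phi> v))"] unfolding form_map_def by blast
    then show ?thesis by (intro that[of g1 g2 g3]) (auto simp: prod_eq_iff)
  qed
  define Z where "Z = {P \<in> pts. P \<noteq> Infinity \<and> (g1 P, g2 P, g3 P) = (0, 0, 0)}"
  have "finite Z"
  proof -
    have "g1 P0 \<noteq> 0 \<or> g2 P0 \<noteq> 0 \<or> g3 P0 \<noteq> 0" using \<Phi> \<Phi>g by auto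
    then obtain g where "g = g1 \<or> g = g2 \<or> g = g3" "polyfun g" "g P0 \<noteq> 0" using g by blast
    then have "finite {P \<in> pts. P \<noteq> Infinity \<and> g P = 0}"
      using polyfun_finite_zeros[of g P0] \<Phi>(2,3) by blast
    moreover have "Z \<subseteq> {P \<in> pts. P \<noteq> Infinity \<and> g P = 0}"
      using \<open>g = g1 \<or> g = g2 \<or> g = g3\<close> by (auto simp: Z_def)
    ultimately show ?thesis by (rule rev_finite_subset)
  qed
  obtain N c1 c2 c3 where c: "\<And>i. polyfun (c1 i)" "\<And>i. polyfun (c2 i)" "\<And>i. polyfun (c3 i)" and
    cP: "\<And>P. P \<in> pts \<Longrightarrow> py P \<noteq> 0 \<Longrightarrow> py (dbl P) \<noteq> 0 \<Longrightarrow>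
      py (dbl P) ^ N * g1 P = fibre_poly c1 P \<and> py (dbl P) ^ N * g2 P = fibre_poly c2 P \<and>
      py (dbl P) ^ N * g3 P = fibre_poly c3 P"
    by (rule cubic_over_double_common[OF g]) blast
  \<comment> \<open>The finitely many points of which a half is a common zero of the forms, or for which the
    description of the fibre degenerates.\<close>
  define Bad where "Bad = {Q \<in> pts. Q \<noteq> Infinity \<and> (py Q = 0 \<or> Q \<in> dbl ` Z)}"
  have fin: "finite Bad"
  proof -
    have "Bad \<subseteq> {Q \<in> pts. Q \<noteq> Infinity \<and> py Q = 0} \<union> dbl ` Z" by (auto simp: Bad_def)
    then show ?thesis using finite_two_torsion \<open>finite Z\<close> by (meson finite_UnI finite_imageI finite_subset)
  qed
  have fibre: "py P \<noteq> 0" "P \<notin> Z" "P \<noteq> Infinity" "py (dbl P) \<noteq> 0"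
    if "P \<in> pts" "dbl P \<notin> Bad" "dbl P \<noteq> Infinity" for P
  proof -
    show "P \<noteq> Infinity" using that(3) by auto
    then show "py P \<noteq> 0" using that dbl_eq_Infinity_iff by blast
    show "P \<notin> Z" "py (dbl P) \<noteq> 0" using that by (auto simp: Bad_def)
  qed
  have key: "\<exists>t. (c1 i Q, c2 i Q, c3 i Q) = vscale t (homogeneous_coords (\<beta> Q))"
    if Q: "Q \<in> pts" "Q \<notin> Bad" "Q \<noteq> Infinity" and i: "i < 4" for Q i
  proof -
    obtain r1 r2 r3 where r: "homogeneous_coords (\<beta> Q) = (r1, r2, r3)" by (cases "homogeneous_coords (\<beta> Q)")
    obtain P where P: "P \<in> pts" "dbl P = Q" using dbl_surj Q by blast
    have eqs: "fibre_poly c1 P' * r2 = fibre_poly c2 P' * r1" "fibre_poly c1 P' * r3 = fibre_poly c3 P' * r1"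
      "fibre_poly c2 P' * r3 = fibre_poly c3 P' * r2" if P': "P' \<in> pts" "dbl P' = dbl P" for P'
    proof -
      have f: "py P' \<noteq> 0" "P' \<notin> Z" "P' \<noteq> Infinity" "py (dbl P') \<noteq> 0"
        using fibre[OF P'(1)] P'(2) P(2) Q by auto
      then have "\<Phi> (homogeneous_coords P') \<noteq> (0, 0, 0)" using \<Phi>g P' by (auto simp: Z_def)
      then obtain t where "\<Phi> (homogeneous_coords P') = vscale t (homogeneous_coords (\<gamma> P'))"
        using \<gamma>\<Phi>[OF P'(1)] by blast
      moreover have "\<gamma> P' = \<beta> Q" using \<beta>[OF P'(1)] P' P by simp
      ultimately have *: "g1 P' = t * r1" "g2 P' = t * r2" "g3 P' = t * r3" using \<Phi>g[OF f(3)] r by auto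
      have f': "fibre_poly c1 P' = py (dbl P') ^ N * (t * r1)" "fibre_poly c2 P' = py (dbl P') ^ N * (t * r2)"
        "fibre_poly c3 P' = py (dbl P') ^ N * (t * r3)"
        using cP[OF P'(1) f(1,4)] unfolding * by auto
      show "fibre_poly c1 P' * r2 = fibre_poly c2 P' * r1" "fibre_poly c1 P' * r3 = fibre_poly c3 P' * r1"
        "fibre_poly c2 P' * r3 = fibre_poly c3 P' * r2"
        unfolding f' by (simp_all add: mult_ac)
    qed
    have pd: "py (dbl P) \<noteq> 0" using fibre[OF P(1)] P(2) Q by auto
    have cross: "c i Q * s = c' i Q * s'" if eq: "\<And>P'. P' \<in> pts \<Longrightarrow> dbl P' = dbl P \<Longrightarrow> fibre_poly c P' * s = fibre_poly c' P' * s'"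
      for c c' :: "nat \<Rightarrow> 'a point \<Rightarrow> 'a" and s s'
    proof -
      have "(c 0 Q * s - c' 0 Q * s') + (c 1 Q * s - c' 1 Q * s') * px P' + (c 2 Q * s - c' 2 Q * s') * px P' ^ 2 +
          (c 3 Q * s - c' 3 Q * s') * px P' ^ 3 = 0" if "P' \<in> pts" "dbl P' = dbl P" for P'
        using eq[OF that] that P unfolding fibre_poly_eq by (simp add: algebra_simps)
      from fibre_poly_vanishes[OF P(1) pd this] have z: "c 0 Q * s = c' 0 Q * s'" "c 1 Q * s = c' 1 Q * s'"
        "c 2 Q * s = c' 2 Q * s'" "c 3 Q * s = c' 3 Q * s'" by auto
      have "i = 0 \<or> i = 1 \<or> i = 2 \<or> i = 3" using i by auto
      then show ?thesis using z by metis
    qed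
    have "(r1, r2, r3) \<noteq> (0, 0, 0)" using r homogeneous_coords_nonzero by metis
    then obtain t where "(c1 i Q, c2 i Q, c3 i Q) = (t * r1, t * r2, t * r3)"
      using parallel_vectors[OF _ cross[OF eqs(1)] cross[OF eqs(2)] cross[OF eqs(3)]] by blast
    then show ?thesis using r by auto
  qed
  have "finite (insert Infinity Bad)" using fin by simp
  from point_avoiding[OF this] obtain Q1 where Q1: "Q1 \<in> pts" "Q1 \<notin> Bad" "Q1 \<noteq> Infinity" by blast
  have "\<exists>i<4. (c1 i Q1, c2 i Q1, c3 i Q1) \<noteq> (0, 0, 0)"
  proof (rule ccontr)
    assume "\<not> (\<exists>i<4. (c1 i Q1, c2 i Q1, c3 i Q1) \<noteq> (0, 0, 0))"
    then have z: "c1 i Q1 = 0 \<and> c2 i Q1 = 0 \<and> c3 i Q1 = 0" if "i < 4" for i using that by auto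
    obtain P where P: "P \<in> pts" "dbl P = Q1" using dbl_surj Q1 by blast
    have f: "py P \<noteq> 0" "P \<notin> Z" "P \<noteq> Infinity" "py (dbl P) \<noteq> 0" using fibre[OF P(1)] P(2) Q1 by auto
    have "fibre_poly c1 P = 0" "fibre_poly c2 P = 0" "fibre_poly c3 P = 0"
      using z P unfolding fibre_poly_eq by auto
    then have "g1 P = 0" "g2 P = 0" "g3 P = 0" using cP[OF P(1) f(1,4)] f(4) by auto
    then show False using f P by (auto simp: Z_def)
  qed
  then obtain i where i: "i < 4" "(c1 i Q1, c2 i Q1, c3 i Q1) \<noteq> (0, 0, 0)" by blast
  have "local_forms E \<beta> Q1"
  proof -
    obtain d1 F1 where F1: "ternary_form d1 F1" "\<And>P. P \<noteq> Infinity \<Longrightarrow> F1 (homogeneous_coords P) = c1 i P"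
      using polyfun_form[OF c(1)] by blast
    obtain d2 F2 where F2: "ternary_form d2 F2" "\<And>P. P \<noteq> Infinity \<Longrightarrow> F2 (homogeneous_coords P) = c2 i P"
      using polyfun_form[OF c(2)] by blast
    obtain d3 F3 where F3: "ternary_form d3 F3" "\<And>P. P \<noteq> Infinity \<Longrightarrow> F3 (homogeneous_coords P) = c3 i P"
      using polyfun_form[OF c(3)] by blast
    define z :: "'a \<times> 'a \<times> 'a \<Rightarrow> 'a" where "z v = snd (snd v)" for v
    have zf: "ternary_form n (\<lambda>v. z v ^ n)" for n
      using form_power[OF form_coord(3), of n] by (simp add: z_def)
    define \<Psi> where "\<Psi> v = (z v ^ (d2 + d3) * F1 v, z v ^ (d1 + d3) * F2 v, z v ^ (d1 + d2) * F3 v)" for v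
    have \<Psi>: "form_map (d1 + d2 + d3) \<Psi>"
      unfolding form_map_def \<Psi>_def fst_conv snd_conv
      using form_mult[OF zf[of "d2 + d3"] F1(1)] form_mult[OF zf[of "d1 + d3"] F2(1)] form_mult[OF zf[of "d1 + d2"] F3(1)]
      by (simp add: ac_simps)
    have \<Psi>c: "\<Psi> (homogeneous_coords P) = (c1 i P, c2 i P, c3 i P)" if "P \<noteq> Infinity" for P
      using that F1 F2 F3 by (simp add: \<Psi>_def z_def hc_affine)
    \<comment> \<open>A line through \<open>R\<close> that does not contain \<open>Q1\<close>. The product of these lines, multiplied to the
      forms, excludes the bad points from the condition.\<close>
    define L where "L R v = (if px R \<noteq> px Q1 then fst v - px R * snd (snd v) else fst (snd v) - py R * snd (snd v))"
      for R and v :: "'a \<times> 'a \<times> 'a"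
    have Lf: "ternary_form 1 (L R)" for R
    proof -
      have "ternary_form 1 (\<lambda>v. fst v - px R * snd (snd v))" "ternary_form 1 (\<lambda>v. fst (snd v) - py R * snd (snd v))"
        by (intro form_diff form_scale form_coord)+
      then show ?thesis unfolding L_def by (cases "px R = px Q1") (simp_all only: if_True if_False not_False_eq_True simp_thms)
    qed
    have LR: "L R (homogeneous_coords R) = 0" if "R \<noteq> Infinity" for R using that by (simp add: L_def hc_affine)
    have LQ: "L R (homogeneous_coords Q1) \<noteq> 0" if "R \<in> Bad" for R
    proof -
      have "R \<noteq> Q1" "R \<noteq> Infinity" using that Q1 by (auto simp: Bad_def)
      then have "px R = px Q1 \<longrightarrow> py R \<noteq> py Q1" using Q1(3) by (metis Affine_px_py)
      then show ?thesis using Q1(3) by (auto simp: L_def hc_affine)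
    qed
    define K where "K v = z v * (\<Prod>R\<in>Bad. L R v)" for v
    have Kf: "ternary_form (1 + card Bad) K"
      unfolding K_def z_def by (intro form_mult form_prod fin Lf form_coord)
    show ?thesis
      unfolding local_forms_def
    proof (intro exI[of _ "1 + card Bad + (d1 + d2 + d3)"] exI[of _ "\<lambda>v. vscale (K v) (\<Psi> v)"] conjI ballI impI)
      show "form_map (1 + card Bad + (d1 + d2 + d3)) (\<lambda>v. vscale (K v) (\<Psi> v))"
        by (rule form_map_scale[OF \<Psi> Kf])
      have "K (homogeneous_coords Q1) \<noteq> 0" using LQ fin Q1(3) by (simp add: K_def z_def hc_affine)
      then show "vscale (K (homogeneous_coords Q1)) (\<Psi> (homogeneous_coords Q1)) \<noteq> (0, 0, 0)"
        using i(2) \<Psi>c[OF Q1(3)] by (simp add: vscale_eq_0)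
    next
      fix Q assume Q: "Q \<in> pts" and nz: "vscale (K (homogeneous_coords Q)) (\<Psi> (homogeneous_coords Q)) \<noteq> (0, 0, 0)"
      then have K: "K (homogeneous_coords Q) \<noteq> 0" "\<Psi> (homogeneous_coords Q) \<noteq> (0, 0, 0)" by (auto simp: vscale_eq_0)
      have "Q \<noteq> Infinity" using K(1) by (auto simp: K_def z_def)
      moreover have "Q \<notin> Bad" using K(1) LR fin \<open>Q \<noteq> Infinity\<close> by (auto simp: K_def)
      ultimately obtain t where t: "\<Psi> (homogeneous_coords Q) = vscale t (homogeneous_coords (\<beta> Q))"
        using key[OF Q _ _ i(1)] \<Psi>c by metis
      then have "t \<noteq> 0" using K(2) by (auto simp: vscale_eq)
      then show "\<exists>t. t \<noteq> 0 \<and> vscale (K (homogeneous_coords Q)) (\<Psi> (homogeneous_coords Q)) =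
          vscale t (homogeneous_coords (\<beta> Q))"
        using K t by (intro exI[of _ "K (homogeneous_coords Q) * t"]) (simp add: vscale_vscale)
    qed
  qed
  have "local_forms E \<beta> Q" if Q: "Q \<in> pts" for Q
  proof -
    define V where "V = neg Q \<boxplus> Q1"
    have V: "V \<in> pts" "Q \<boxplus> V = Q1" using padd_cancel'[of Q1 "neg Q"] Q Q1 by (auto simp: V_def)
    have 1: "local_forms E (\<lambda>R. R \<boxplus> V) Q"
      by (rule local_forms_translate[OF local_forms_id _ Q V(1)])
    have 2: "local_forms E (\<lambda>R. \<beta> (R \<boxplus> V)) Q"
    proof (rule local_forms_compose[OF 1 _ Q])
      show "local_forms E \<beta> (Q \<boxplus> V)" using \<open>local_forms E \<beta> Q1\<close> V(2) by simp
    qed (rule padd_in_pts[OF _ V(1)])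
    have l: "local_forms E (\<lambda>R. \<beta> (R \<boxplus> V) \<boxplus> neg (\<beta> V)) Q"
    proof (rule local_forms_translate[OF 2 _ Q])
      show "neg (\<beta> V) \<in> pts" using \<beta>_pts V by simp
    qed (rule \<beta>_pts[OF padd_in_pts[OF _ V(1)]])
    show ?thesis
      by (rule local_forms_cong[OF l]) (use V \<beta>_pts in \<open>simp add: \<beta>_add padd_cancel\<close>)
  qed
  then show ?thesis using \<beta>_pts \<beta>_add \<beta>_dbl by blast
qed

end


section \<open>Orders of even discriminant\<close>

lemma quadratic_relation_real:
  fixes x :: complex
  assumes x: "x \<notin> \<real>" and eq: "of_real r + of_real s * x = 0"
  shows "r = 0 \<and> s = 0"
proof (cases "s = 0")
  case False
  then have "x = - (of_real r / of_real s)" using eq by (simp add: field_simps add_eq_0_iff)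
  also have "\<dots> = of_real (- (r / s))" by simp
  finally have "x \<in> \<real>" by (metis Reals_of_real)
  with x show ?thesis by simp
qed (use eq in simp)

lemma poly_of_int_simps:
  fixes x :: complex
  shows "poly (map_poly of_int (p + q)) x = poly (map_poly of_int p) x + poly (map_poly of_int q) x"
    and "poly (map_poly of_int (Polynomial.smult k p)) x = of_int k * poly (map_poly of_int p) x"
    and "poly (map_poly of_int (p * q)) x = poly (map_poly of_int p) x * poly (map_poly of_int q) x"
proof -
  have pCons: "poly (map_poly of_int (pCons c p)) x = of_int c + x * poly (map_poly of_int p) x" for c p
    by (simp add: map_poly_pCons)
  show add: "poly (map_poly of_int (p + q)) x = poly (map_poly of_int p) x + poly (map_poly of_int q) x" for p q
    by (induction p q rule: poly_induct2) (simp_all add: pCons algebra_simps)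
  show smult: "poly (map_poly of_int (Polynomial.smult k p)) x = of_int k * poly (map_poly of_int p) x" for k p
    by (induction p) (simp_all add: pCons algebra_simps)
  show "poly (map_poly of_int (p * q)) x = poly (map_poly of_int p) x * poly (map_poly of_int q) x"
    by (induction p) (simp_all add: pCons add smult algebra_simps)
qed

text \<open>
  By the lemma of Gauss, the primitive integral quadratic polynomial with root \<open>x\<close> divides a monic
  integral polynomial with root \<open>x\<close>, so its leading coefficient is a unit. Hence \<open>c\<close> is the content
  of the given polynomial up to sign.
\<close>

lemma algebraic_int_quadratic:
  fixes x :: complex
  assumes x: "x \<notin> \<real>" and int: "algebraic_int x"
    and eq: "of_int c * x ^ 2 + of_int t * x + of_int n = 0" and c: "c \<noteq> 0"
  shows "c dvd t \<and> c dvd n"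
proof -
  let ?e = "\<lambda>p. poly (map_poly of_int p) x :: complex"
  define q where "q = [:n, t, c:]"
  have q0: "q \<noteq> 0" using c by (simp add: q_def)
  have eq0: "?e q = 0" using eq by (simp add: q_def map_poly_pCons algebra_simps power2_eq_square)
  define g where "g = primitive_part q"
  have cg: "content g = 1" using q0 by (simp add: g_def)
  have qg: "q = Polynomial.smult (content q) g" by (simp add: g_def)
  have cq: "content q \<noteq> 0" using q0 by simp
  have g0: "?e g = 0" using eq0 cq unfolding arg_cong[OF qg, of ?e] poly_of_int_simps by simp
  have dg: "Polynomial.degree g = 2" using c by (simp add: g_def q_def)
  define l where "l = poly.coeff g 2"
  have l0: "l \<noteq> 0" using dg by (metis l_def leading_coeff_0_iff degree_0 zero_neq_numeral)
  obtain f where f: "?e f = 0" "lead_coeff f = 1" using int by (auto simp: algebraic_int_altdef_ipoly)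
  obtain Q R where QR: "pseudo_divmod f g = (Q, R)" by (cases "pseudo_divmod f g")
  define k where "k = Suc (Polynomial.degree f) - Polynomial.degree g"
  have gn: "g \<noteq> 0" using cg by auto
  have *: "Polynomial.smult (l ^ k) f = g * Q + R" "R = 0 \<or> Polynomial.degree R < 2"
    using pseudo_divmod[OF gn QR] by (simp_all add: l_def k_def dg)
  have "?e R = 0"
    using arg_cong[OF *(1), of ?e] f g0 by (simp add: poly_of_int_simps)
  define r0 r1 where "r0 = poly.coeff R 0" and "r1 = poly.coeff R 1"
  have R: "R = [:r0, r1:]"
    using *(2) by (intro poly_eqI) (auto simp: r0_def r1_def coeff_pCons coeff_eq_0 split: nat.splits)
  have "of_int r0 + of_int r1 * x = 0"
    using \<open>?e R = 0\<close> unfolding R by (simp add: map_poly_pCons mult.commute)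
  then have "of_int r0 = (0 :: real) \<and> of_int r1 = (0 :: real)"
    by (intro quadratic_relation_real[OF x]) simp
  then have "R = 0" using R by simp
  then have eq: "Polynomial.smult (l ^ k) f = g * Q" using * by simp
  have "content f dvd 1" using content_dvd_coeff[of f "Polynomial.degree f"] unfolding f(2) .
  then have "content f = 1" unfolding is_unit_content_iff .
  then have cQ: "content Q = \<bar>l ^ k\<bar>" using arg_cong[OF eq, of content] cg by (simp add: content_mult)
  have "l ^ k = lead_coeff (g * Q)" unfolding eq[symmetric] using f by simp
  also have "\<dots> = l * lead_coeff Q" by (simp add: lead_coeff_mult l_def dg)
  also have "lead_coeff Q = content Q * lead_coeff (primitive_part Q)"
    by (metis content_times_primitive_part lead_coeff_smult)
  finally have "\<bar>l ^ k\<bar> * 1 = \<bar>l ^ k\<bar> * (\<bar>l\<bar> * \<bar>lead_coeff (primitive_part Q)\<bar>)"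
    unfolding cQ by (metis abs_abs abs_mult mult.left_commute mult_1_right)
  then have "\<bar>l\<bar> * \<bar>lead_coeff (primitive_part Q)\<bar> = 1" using l0 by simp
  then have "\<bar>l\<bar> = 1" using abs_zmult_eq_1[of l "lead_coeff (primitive_part Q)"] by (simp add: abs_mult)
  moreover have "c = content q * l" using arg_cong[OF qg, of "\<lambda>p. poly.coeff p 2"] by (simp add: q_def l_def eval_nat_numeral)
  ultimately have "c dvd content q" by (metis abs_dvd_iff abs_mult dvd_refl mult_1_right dvd_abs_iff)
  moreover have "content q dvd t" "content q dvd n"
    using content_dvd_coeff[of q 1] content_dvd_coeff[of q 0] by (simp_all add: q_def)
  ultimately show ?thesis using dvd_trans by blast
qed

lemma complex_ring_simps [simp]:
  "carrier complex_ring = UNIV" "x \<otimes>\<^bsub>complex_ring\<^esub> y = x * y" "x \<oplus>\<^bsub>complex_ring\<^esub> y = x + y"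
  "\<zero>\<^bsub>complex_ring\<^esub> = 0" "\<one>\<^bsub>complex_ring\<^esub> = 1"
  by (simp_all add: complex_ring_def ring_of_type_algebra_def)

lemma field_complex_ring: "field complex_ring"
  unfolding complex_ring_def by (rule field_from_type_algebra)

interpretation CR: ring complex_ring
  unfolding complex_ring_def by (rule ring_from_type_algebra)

lemma complex_ring_a_inv [simp]: "\<ominus>\<^bsub>complex_ring\<^esub> x = - x"
  by (rule CR.minus_equality) auto

lemma complex_ring_inv: "x \<noteq> 0 \<Longrightarrow> inv\<^bsub>complex_ring\<^esub> x = inverse x"
  by (rule CR.inv_char) auto

lemma subfield_Rats: "subfield \<rat> complex_ring"
  by (rule field.subfieldI'[OF field_complex_ring]) (auto intro!: CR.subringI simp: complex_ring_inv)

lemma line_extension_complex: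
  "CR.line_extension K u V = {k * u + v | k v. k \<in> K \<and> v \<in> V}"
  by (auto simp: CR.line_extension_def r_coset_def set_add_def set_mult_def)

lemma of_rat_eq_of_real: "(of_rat r :: complex) = of_real (of_rat r)"
  by (cases r) (simp add: of_rat_rat)

lemma quadratic_field_span:
  assumes K: "imaginary_quadratic_field K" and \<theta>: "\<theta> \<in> K" "\<theta> \<notin> \<real>"
  shows "K = {of_rat p + of_rat q * \<theta> | p q. True}"
proof -
  have sf: "subfield K complex_ring" and dim: "CR.dimension 2 \<rat> K"
    using K by (auto simp: imaginary_quadratic_field_def)
  have "1 \<in> K" using subringE(3)[OF subfieldE(1)[OF sf]] by simp
  have span1: "CR.Span \<rat> [1] = \<rat>" by (auto simp: line_extension_complex)
  have "\<theta> \<notin> \<rat>" using \<theta> by (auto simp: Rats_def of_rat_eq_of_real)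
  moreover have "CR.independent \<rat> [1]" by (intro CR.li_Cons) auto
  ultimately have "CR.independent \<rat> [\<theta>, 1]" using span1 by (intro CR.li_Cons) auto
  then have "CR.Span \<rat> [\<theta>, 1] = K"
    using CR.independent_length_eq_dimension[OF subfield_Rats dim, of "[\<theta>, 1]"] \<theta> \<open>1 \<in> K\<close> by simp
  moreover have "CR.Span \<rat> [\<theta>, 1] = {k * \<theta> + v | k v. k \<in> \<rat> \<and> v \<in> \<rat>}"
    using span1 by (simp add: line_extension_complex)
  moreover have "\<dots> = {of_rat p + of_rat q * \<theta> | p q. True}"
  proof (intro Set.set_eqI iffI)
    fix x assume "x \<in> {k * \<theta> + v | k v. k \<in> \<rat> \<and> v \<in> \<rat>}"
    then obtain p q where "x = of_rat q * \<theta> + of_rat p" by (auto elim!: Rats_cases)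
    then show "x \<in> {of_rat p + of_rat q * \<theta> | p q. True}" by (auto simp: add.commute)
  next
    fix x assume "x \<in> {of_rat p + of_rat q * \<theta> | p q. True}"
    then obtain p q where x: "x = of_rat q * \<theta> + of_rat p" by (auto simp: add.commute)
    show "x \<in> {k * \<theta> + v | k v. k \<in> \<rat> \<and> v \<in> \<rat>}"
      unfolding x by (intro CollectI exI[of _ "of_rat q"] exI[of _ "of_rat p"]) auto
  qed
  ultimately show ?thesis by simp
qed


lemma imaginary_square_root:
  fixes s :: complex
  assumes "s ^ 2 = - of_nat m" "m > 0"
  shows "cnj s = - s" "s \<notin> \<real>"
proof -
  have re: "Re s ^ 2 - Im s ^ 2 = - real m" and im: "Re s * Im s = 0"
    using assms(1) by (auto simp: complex_eq_iff power2_eq_square)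
  have "Im s \<noteq> 0"
  proof
    assume "Im s = 0"
    then have "Re s ^ 2 = - real m" using re by simp
    then show False using assms(2) zero_le_power2[of "Re s"] by linarith
  qed
  then show "cnj s = - s" "s \<notin> \<real>" using im by (auto simp: complex_eq_iff complex_is_Real_iff)
qed

text \<open>
  Completing the square and removing square factors from the resulting integer.
\<close>

lemma quadratic_field_generator:
  assumes K: "imaginary_quadratic_field K"
  obtains m :: nat and s :: complex
  where "m > 0" "squarefree m" "s ^ 2 = - of_nat m" "K = {of_rat p + of_rat q * s | p q. True}"
proof -
  obtain \<theta> where \<theta>: "\<theta> \<in> K" "\<theta> \<notin> \<real>" using K by (auto simp: imaginary_quadratic_field_def)
  note span = quadratic_field_span[OF K \<theta>]
  have sf: "subfield K complex_ring" using K by (simp add: imaginary_quadratic_field_def)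
  have "\<theta> * \<theta> \<in> K" using subringE(6)[OF subfieldE(1)[OF sf] \<theta>(1) \<theta>(1)] by simp
  then obtain P Q where PQ: "\<theta> * \<theta> = of_rat P + of_rat Q * \<theta>" using span by auto
  define \<rho> where "\<rho> = P + Q ^ 2 / 4"
  have sq: "(\<theta> - of_rat (Q / 2)) ^ 2 = of_rat \<rho>"
  proof -
    define h where "h = (of_rat (Q / 2) :: complex)"
    have Qh: "of_rat Q = 2 * h" by (simp add: h_def of_rat_divide)
    have "(\<theta> - h) ^ 2 = \<theta> * \<theta> - 2 * h * \<theta> + h ^ 2" by (simp add: algebra_simps power2_eq_square)
    also have "\<dots> = of_rat P + h ^ 2" unfolding PQ Qh by simp
    also have "\<dots> = of_rat \<rho>"
      by (simp add: \<rho>_def h_def of_rat_add of_rat_power of_rat_divide power_divide)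
    finally show ?thesis by (simp add: h_def)
  qed
  obtain N d where Nd: "\<rho> = Rat.Fract N d" "d > 0" by (cases \<rho>) auto
  define r where "r = of_int d * (\<theta> - of_rat (Q / 2))"
  have r2: "r ^ 2 = of_int (N * d)"
    unfolding r_def power_mult_distrib sq using Nd by (simp add: of_rat_rat power2_eq_square)
  have r_real: "r \<notin> \<real>"
  proof
    assume "r \<in> \<real>"
    then have "r / of_int d + of_real (of_rat (Q / 2)) \<in> \<real>"
      by (intro Reals_add Reals_divide Reals_of_int Reals_of_real)
    moreover have "r / of_int d + of_real (of_rat (Q / 2)) = \<theta>"
      using Nd by (simp add: r_def of_rat_eq_of_real)
    ultimately show False using \<theta> by simp
  qed
  have neg: "N * d < 0"
  proof (rule ccontr)
    assume "\<not> N * d < 0"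
    then have "sqrt (real_of_int (N * d)) ^ 2 = of_int (N * d)" by (intro real_sqrt_pow2) linarith
    then have "r ^ 2 = of_real (sqrt (of_int (N * d))) ^ 2"
      unfolding r2 of_real_power[symmetric] by simp
    then have "r = of_real (sqrt (of_int (N * d))) \<or> r = - of_real (sqrt (of_int (N * d)))"
      by (simp only: power2_eq_iff)
    then show False using r_real by (metis Reals_of_real Reals_minus)
  qed
  define n where "n = nat (- (N * d))"
  have n: "n > 0" "r ^ 2 = - of_nat n" using neg r2 by (auto simp: n_def)
  define m k where "m = squarefree_part n" and "k = square_part n"
  have nmk: "n = m * k ^ 2" unfolding m_def k_def by (rule squarefree_decompose)
  have "m \<noteq> 0" by (simp add: m_def)
  moreover have "squarefree m" unfolding m_def by (rule squarefree_squarefree_part)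
  moreover have "k \<noteq> 0" using n(1) nmk by (intro notI) simp
  ultimately have m: "m > 0" "squarefree m" "k > 0" by simp_all
  define s where "s = r / of_nat k"
  have s2: "s ^ 2 = - of_nat m" using n nmk m by (simp add: s_def power_divide)
  have "s = of_rat (- (of_int d * Q / 2) / of_nat k) + of_rat (of_int d / of_nat k) * \<theta>"
    using m by (simp add: s_def r_def of_rat_divide of_rat_mult of_rat_minus field_simps)
  then have "s \<in> K" using span by blast
  then have "K = {of_rat p + of_rat q * s | p q. True}"
    using quadratic_field_span[OF K] imaginary_square_root[OF s2 m(1)] by blast
  then show ?thesis using that m s2 by blast
qed

lemma squarefree_dvd_square:
  fixes c u :: int and m :: nat
  assumes m: "squarefree m" and dvd: "c ^ 2 dvd int m * u ^ 2" and c: "c \<noteq> 0"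
  shows "c dvd u"
proof -
  obtain c' u' where *: "c = gcd c u * c'" "u = gcd c u * u'" "Rings.coprime c' u'"
    using gcd_coprime_exists[of c u] c by (metis gcd_eq_0_iff mult.commute)
  have "gcd c u \<noteq> 0" using c by simp
  have "(gcd c u) ^ 2 * c' ^ 2 dvd (gcd c u) ^ 2 * (int m * u' ^ 2)"
    using dvd *(1,2) by (metis mult.left_commute power_mult_distrib)
  then have "c' ^ 2 dvd int m * u' ^ 2" using c by simp
  moreover have "Rings.coprime (c' ^ 2) (u' ^ 2)" using *(3) by simp
  ultimately have "c' ^ 2 dvd int m" by (simp add: coprime_dvd_mult_left_iff)
  then have "int (nat \<bar>c'\<bar> ^ 2) dvd int m" by simp
  then have "nat \<bar>c'\<bar> ^ 2 dvd m" by (simp only: int_dvd_int_iff)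
  then have "nat \<bar>c'\<bar> dvd 1" using m by (rule squarefreeD[rotated])
  then have "\<bar>c'\<bar> = 1" by simp
  then have "c' dvd 1" by auto
  then show ?thesis using * by (metis dvd_triv_left mult_dvd_mono dvd_refl mult_1_right dvd_trans)
qed

context
  fixes K :: "complex set" and m :: nat and s :: complex
  assumes m: "m > 0" "squarefree m" and s: "s ^ 2 = - of_nat m"
    and K: "K = {of_rat p + of_rat q * s | p q. True}"
begin

lemma s_nonreal: "s \<notin> \<real>" and cnj_s: "cnj s = - s"
  using imaginary_square_root[OF s m(1)] by auto

text \<open>
  Integrality of the trace and of the norm. The denominator of the coefficient of \<open>s\<close> divides two
  because \<open>m\<close> is squarefree.
\<close>

lemma ring_of_integers_iff:
  "x \<in> ring_of_integers K \<longleftrightarrow>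
     (\<exists>A B :: int. x = (of_int A + of_int B * s) / 2 \<and> 4 dvd A ^ 2 + int m * B ^ 2)"
proof
  assume "x \<in> ring_of_integers K"
  then obtain p q where pq: "x = of_rat p + of_rat q * s" and int: "algebraic_int x"
    using K by (auto simp: ring_of_integers_def)
  show "\<exists>A B :: int. x = (of_int A + of_int B * s) / 2 \<and> 4 dvd A ^ 2 + int m * B ^ 2"
  proof (cases "q = 0")
    case True
    then have "x \<in> \<int>" using pq int by (intro rational_algebraic_int_is_int) auto
    then obtain k where "x = of_int k" by (auto elim: Ints_cases)
    then show ?thesis by (intro exI[of _ "2 * k"] exI[of _ 0]) (auto simp: power_mult_distrib)
  next
    case False
    obtain a c where ac: "p = Rat.Fract a c" "c > 0" by (cases p) auto
    obtain b e where be: "q = Rat.Fract b e" "e > 0" by (cases q) auto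
    define u v w where "u = a * e" and "v = b * c" and "w = c * e"
    have w: "w > 0" using ac be by (simp add: w_def)
    have x: "of_int w * x = of_int u + of_int v * s"
      using ac be unfolding pq by (simp add: of_rat_rat u_def v_def w_def field_simps)
    have "v \<noteq> 0" using False be ac by (auto simp: v_def Zero_rat_def eq_rat)
    have "x \<notin> \<real>"
    proof
      assume "x \<in> \<real>"
      then have "(of_int w * x - of_int u) / of_int v \<in> \<real>" by (intro Reals_divide Reals_diff Reals_mult Reals_of_int)
      moreover have "(of_int w * x - of_int u) / of_int v = s" using x \<open>v \<noteq> 0\<close> by simp
      ultimately show False using s_nonreal by simp
    qed
    have "of_int (w ^ 2) * x ^ 2 + of_int (- (2 * u * w)) * x + of_int (u ^ 2 + int m * v ^ 2) =
        (of_int w * x - of_int u) ^ 2 + of_nat m * of_int v ^ 2"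
      by (simp add: algebra_simps power2_eq_square)
    also have "\<dots> = (of_int v * s) ^ 2 + of_nat m * of_int v ^ 2" unfolding x by simp
    also have "\<dots> = 0" by (simp add: power_mult_distrib s)
    finally have rel: "of_int (w ^ 2) * x ^ 2 + of_int (- (2 * u * w)) * x + of_int (u ^ 2 + int m * v ^ 2) = 0" .
    have "w ^ 2 \<noteq> 0" using w by simp
    note dvd = algebraic_int_quadratic[OF \<open>x \<notin> \<real>\<close> int rel this]
    then have "w dvd 2 * u" using w by (simp add: power2_eq_square)
    then obtain A where A: "2 * u = w * A" by (elim dvdE)
    have "w ^ 2 dvd 4 * (u ^ 2 + int m * v ^ 2)" using dvd by (intro dvd_mult) blast
    also have "4 * (u ^ 2 + int m * v ^ 2) = (w * A) ^ 2 + int m * (2 * v) ^ 2"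
      unfolding A[symmetric] by (simp add: power_mult_distrib)
    finally have "w ^ 2 dvd int m * (2 * v) ^ 2" by (simp add: power_mult_distrib dvd_add_right_iff)
    then have "w dvd 2 * v" by (rule squarefree_dvd_square[OF m(2)]) (use w in simp)
    then obtain B where B: "2 * v = w * B" by (elim dvdE)
    have "of_int w * (2 * x) = 2 * (of_int w * x)" by simp
    also have "\<dots> = of_int (2 * u) + of_int (2 * v) * s" unfolding x by (simp add: algebra_simps)
    also have "\<dots> = of_int w * (of_int A + of_int B * s)" unfolding A B by (simp add: algebra_simps)
    finally have "2 * x = of_int A + of_int B * s" using w by simp
    then have "x = (of_int A + of_int B * s) / 2" by (simp add: mult.commute)
    moreover have "4 dvd A ^ 2 + int m * B ^ 2"
    proof -
      obtain z where z: "u ^ 2 + int m * v ^ 2 = w ^ 2 * z" using dvd by (elim conjE dvdE)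
      have "w ^ 2 * (A ^ 2 + int m * B ^ 2) = (w * A) ^ 2 + int m * (w * B) ^ 2"
        by (simp add: power_mult_distrib algebra_simps)
      also have "\<dots> = 4 * (u ^ 2 + int m * v ^ 2)"
        unfolding A[symmetric] B[symmetric] by (simp add: power_mult_distrib)
      finally have "w ^ 2 * (A ^ 2 + int m * B ^ 2) = w ^ 2 * (4 * z)" unfolding z by simp
      then show ?thesis using w by simp
    qed
    ultimately show ?thesis by blast
  qed
next
  assume "\<exists>A B :: int. x = (of_int A + of_int B * s) / 2 \<and> 4 dvd A ^ 2 + int m * B ^ 2"
  then obtain A B z where x: "x = (of_int A + of_int B * s) / 2" and z: "A ^ 2 + int m * B ^ 2 = 4 * z"
    by (elim exE conjE dvdE)
  have "x = of_rat (of_int A / 2) + of_rat (of_int B / 2) * s"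
    unfolding x by (simp add: of_rat_divide field_simps)
  then have "x \<in> K" using K by blast
  moreover have "algebraic_int x"
  proof (rule algebraic_int.intros)
    have "4 * (x ^ 2 - of_int A * x + of_int z) = (2 * x - of_int A) ^ 2 - of_int (A ^ 2) + of_int (4 * z)"
      by (simp add: algebra_simps power2_eq_square)
    also have "\<dots> = (of_int B * s) ^ 2 - of_int (A ^ 2) + of_int (A ^ 2 + int m * B ^ 2)"
      unfolding z[symmetric] unfolding x by simp
    also have "\<dots> = 0" by (simp add: power_mult_distrib s)
    finally have "x ^ 2 - of_int A * x + of_int z = 0" by (metis mult_eq_0_iff zero_neq_numeral)
    then show "poly [:of_int z, - of_int A, 1:] x = 0" by (simp add: algebra_simps power2_eq_square)
  qed (auto simp: coeff_pCons split: nat.splits)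
  ultimately show "x \<in> ring_of_integers K" by (simp add: ring_of_integers_def)
qed

lemma integral_basisI:
  assumes ring: "ring_of_integers K = {of_int a + of_int b * w | a b. True}" and w: "w \<notin> \<real>"
    and d: "of_int d = (cnj w - w) ^ 2"
  shows "field_discriminant K = d"
proof (rule field_discriminant_eqI[of K 1 w])
  have "inj (\<lambda>(a :: int, b :: int). of_int a * 1 + of_int b * w)"
  proof (rule injI, clarify)
    fix a b a' b' :: int assume "of_int a * 1 + of_int b * w = of_int a' * 1 + of_int b' * w"
    then have "of_real (of_int (a - a')) + of_real (of_int (b - b')) * w = 0" by (simp add: algebra_simps)
    from quadratic_relation_real[OF w this] show "a = a' \<and> b = b'" by simp
  qed
  moreover have "range (\<lambda>(a :: int, b :: int). of_int a * 1 + of_int b * w) = ring_of_integers K"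
    unfolding ring by auto
  ultimately show "integral_basis K 1 w" by (simp add: integral_basis_def bij_betw_def)
qed (use d in simp)

lemma mod4_cases:
  fixes A B :: int
  assumes "4 dvd A ^ 2 + int m * B ^ 2"
  shows "m mod 4 \<noteq> 3 \<Longrightarrow> even A \<and> even B" "m mod 4 = 3 \<Longrightarrow> even (A - B)"
proof -
  have m0: "m mod 4 \<noteq> 0"
  proof
    assume "m mod 4 = 0"
    then have "2 ^ 2 dvd m" by auto
    then show False using m(2) squarefreeD[of m 2] by auto
  qed
  have sq: "even C \<Longrightarrow> C ^ 2 mod 4 = 0" "odd C \<Longrightarrow> C ^ 2 mod 4 = 1" for C :: int
  proof -
    show "C ^ 2 mod 4 = 0" if "even C" using that by (auto elim!: evenE simp: power_mult_distrib)
    assume "odd C"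
    then obtain b where "C = 2 * b + 1" by (elim oddE)
    then have "C ^ 2 = 4 * (b * b + b) + 1" by (simp add: algebra_simps power2_eq_square)
    moreover define t where "t = b * b + b"
    ultimately have "C ^ 2 = 4 * t + 1" by simp
    then show "C ^ 2 mod 4 = 1" by simp
  qed
  have *: "(A ^ 2 mod 4 + (int m mod 4) * (B ^ 2 mod 4)) mod 4 = 0"
  proof -
    have "(A ^ 2 mod 4 + (int m mod 4) * (B ^ 2 mod 4)) mod 4 =
        (A ^ 2 mod 4 + ((int m mod 4) * (B ^ 2 mod 4)) mod 4) mod 4" by (simp only: mod_add_right_eq)
    also have "\<dots> = (A ^ 2 + int m * B ^ 2) mod 4" by (simp only: mod_mult_eq mod_add_eq)
    also have "\<dots> = 0" using assms by (rule dvd_imp_mod_0)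
    finally show ?thesis .
  qed
  have im: "int m mod 4 = int (m mod 4)" by (simp add: zmod_int)
  have "m mod 4 = 1 \<or> m mod 4 = 2 \<or> m mod 4 = 3" using m0 by linarith
  then show "m mod 4 \<noteq> 3 \<Longrightarrow> even A \<and> even B" "m mod 4 = 3 \<Longrightarrow> even (A - B)"
    using * sq[of A] sq[of B] unfolding im by (cases "even A"; cases "even B"; auto)+
qed

text \<open>
  If \<open>m\<close> is not \<open>3\<close> modulo \<open>4\<close>, the ring of integers is \<open>\<int>[s]\<close>, and \<open>w = f s\<close>. Otherwise the
  discriminant of the field is the odd number \<open>- m\<close>, so that \<open>f = 2 g\<close> is even. Then
  \<open>f (1 + s) / 2 = g + g s\<close>, and \<open>w = g s\<close>.
\<close>

lemma order_even_discriminant: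
  assumes f: "f \<ge> 1" and ev: "even (field_discriminant K * int f ^ 2)"
  shows "\<exists>(w :: complex) D :: nat. w ^ 2 = - of_nat D \<and> w \<notin> \<real> \<and>
    order_of_conductor K f = {of_int a + of_int b * w | a b. True}"
proof (cases "m mod 4 = 3")
  case False
  have "ring_of_integers K = {of_int a + of_int b * s | a b. True}"
  proof (intro Set.set_eqI iffI)
    fix x assume "x \<in> ring_of_integers K"
    then obtain A B :: int where x: "x = (of_int A + of_int B * s) / 2" "4 dvd A ^ 2 + int m * B ^ 2"
      using ring_of_integers_iff by blast
    then obtain a b where "A = 2 * a" "B = 2 * b" using mod4_cases(1)[OF x(2) False] by (auto elim!: evenE)
    then have "x = of_int a + of_int b * s" using x(1) by simp
    then show "x \<in> {of_int a + of_int b * s | a b. True}" by blast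
  next
    fix x assume "x \<in> {of_int a + of_int b * s | a b. True}"
    then obtain a b :: int where "x = of_int a + of_int b * s" by blast
    then have "x = (of_int (2 * a) + of_int (2 * b) * s) / 2" by simp
    moreover have "4 dvd (2 * a) ^ 2 + int m * (2 * b) ^ 2" by (simp add: power_mult_distrib)
    ultimately show "x \<in> ring_of_integers K" using ring_of_integers_iff by blast
  qed
  then have "order_of_conductor K f = {of_int a + of_int b * (of_nat f * s) | a b. True}"
  proof -
    assume r: "ring_of_integers K = {of_int a + of_int b * s | a b. True}"
    show ?thesis
    proof (intro Set.set_eqI iffI)
      fix x assume "x \<in> order_of_conductor K f"
      then obtain a b c :: int where "x = of_int a + of_nat f * (of_int b + of_int c * s)"
        unfolding order_of_conductor_def r by auto
      then have "x = of_int (a + int f * b) + of_int c * (of_nat f * s)" by (simp add: algebra_simps)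
      then show "x \<in> {of_int a + of_int b * (of_nat f * s) | a b. True}" by blast
    next
      fix x assume "x \<in> {of_int a + of_int b * (of_nat f * s) | a b. True}"
      then obtain a b :: int where "x = of_int a + of_int b * (of_nat f * s)" by blast
      then have "x = of_int a + of_nat f * (of_int 0 + of_int b * s)" by simp
      then show "x \<in> order_of_conductor K f" unfolding order_of_conductor_def r by blast
    qed
  qed
  moreover have w: "(of_nat f * s) ^ 2 = - of_nat (f ^ 2 * m)" using s by (simp add: power_mult_distrib)
  moreover have "of_nat f * s \<notin> \<real>" using imaginary_square_root(2)[OF w] f m by simp
  ultimately show ?thesis by blast
next
  case True
  define \<omega> where "\<omega> = (1 + s) / 2"
  have \<omega>2: "2 * \<omega> = 1 + s" by (simp add: \<omega>_def)
  have r: "ring_of_integers K = {of_int a + of_int b * \<omega> | a b. True}"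
  proof (intro Set.set_eqI iffI)
    fix x assume "x \<in> ring_of_integers K"
    then obtain A B :: int where x: "x = (of_int A + of_int B * s) / 2" "4 dvd A ^ 2 + int m * B ^ 2"
      using ring_of_integers_iff by blast
    then obtain a where "A - B = 2 * a" using mod4_cases(2)[OF x(2) True] by (elim evenE)
    then have "A = 2 * a + B" by simp
    then have "x = of_int a + of_int B * \<omega>" using x(1) by (simp add: \<omega>_def field_simps)
    then show "x \<in> {of_int a + of_int b * \<omega> | a b. True}" by blast
  next
    fix x assume "x \<in> {of_int a + of_int b * \<omega> | a b. True}"
    then obtain a b :: int where "x = of_int a + of_int b * \<omega>" by blast
    then have "x = (of_int (2 * a + b) + of_int b * s) / 2" by (simp add: \<omega>_def field_simps)
    moreover have "4 dvd (2 * a + b) ^ 2 + int m * b ^ 2"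
    proof -
      have m3: "int m = 4 * (int m div 4) + 3" using True by presburger
      have "(2 * a + b) ^ 2 + int m * b ^ 2 = 4 * (a ^ 2 + a * b + b ^ 2 * (int m div 4 + 1))"
        by (subst m3) (simp add: algebra_simps power2_eq_square)
      then show ?thesis by simp
    qed
    ultimately show "x \<in> ring_of_integers K" using ring_of_integers_iff by blast
  qed
  have "\<omega> \<notin> \<real>"
  proof
    assume "\<omega> \<in> \<real>"
    then have "2 * \<omega> - 1 \<in> \<real>" by (intro Reals_diff Reals_mult) auto
    then show False using s_nonreal by (simp add: \<omega>_def)
  qed
  moreover have "of_int (- int m) = (cnj \<omega> - \<omega>) ^ 2"
    using s by (simp add: \<omega>_def cnj_s field_simps power2_eq_square)
  ultimately have "field_discriminant K = - int m" by (rule integral_basisI[OF r])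
  moreover have "odd m" using True by presburger
  ultimately have "even f" using ev by simp
  then obtain g where g: "f = 2 * g" by (auto elim: evenE)
  have "order_of_conductor K f = {of_int a + of_int b * (of_nat g * s) | a b. True}"
  proof (intro Set.set_eqI iffI)
    fix x assume "x \<in> order_of_conductor K f"
    then obtain a b c :: int where "x = of_int a + of_nat f * (of_int b + of_int c * \<omega>)"
      unfolding order_of_conductor_def r by auto
    moreover have "of_nat f * (of_int b + of_int c * \<omega>) = of_nat g * (2 * of_int b + of_int c * (2 * \<omega>))"
      by (simp add: g algebra_simps)
    ultimately have "x = of_int (a + int f * b + int g * c) + of_int c * (of_nat g * s)"
      unfolding \<omega>2 by (simp add: g algebra_simps)
    then show "x \<in> {of_int a + of_int b * (of_nat g * s) | a b. True}" by blast
  next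
    fix x assume "x \<in> {of_int a + of_int b * (of_nat g * s) | a b. True}"
    then obtain a b :: int where "x = of_int a + of_int b * (of_nat g * s)" by blast
    moreover have "of_nat f * (of_int 0 + of_int b * \<omega>) = of_nat g * (of_int b * (2 * \<omega>))"
      by (simp add: g algebra_simps)
    ultimately have "x = of_int (a - int g * b) + of_nat f * (of_int 0 + of_int b * \<omega>)"
      unfolding \<omega>2 by (simp add: algebra_simps)
    then show "x \<in> order_of_conductor K f" unfolding order_of_conductor_def r by blast
  qed
  moreover have w: "(of_nat g * s) ^ 2 = - of_nat (g ^ 2 * m)" using s by (simp add: power_mult_distrib)
  moreover have "of_nat g * s \<notin> \<real>" using imaginary_square_root(2)[OF w] f m g by simp
  ultimately show ?thesis by blast
qed

end

text \<open>
  Evenness of the discriminant enters the argument in this form only: the order is \<open>\<int>[w]\<close> with \<open>w\<close> of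
  trace zero.
\<close>

theorem even_order_generator:
  assumes "imaginary_quadratic_field K" "f \<ge> 1" "even (field_discriminant K * int f ^ 2)"
  shows "\<exists>(w :: complex) D :: nat. w ^ 2 = - of_nat D \<and> w \<notin> \<real> \<and>
    order_of_conductor K f = {of_int a + of_int b * w | a b. True}"
proof -
  obtain m s where "m > 0" "squarefree m" "s ^ 2 = - of_nat m" "K = {of_rat p + of_rat q * s | p q. True}"
    by (rule quadratic_field_generator[OF assms(1)])
  from order_even_discriminant[OF this assms(2,3)] show ?thesis .
qed


section \<open>Automorphisms acting on two-power torsion\<close>

lemma field_automorphism_simps:
  assumes "field_automorphism \<sigma>"
  shows "\<sigma> (x + y) = \<sigma> x + \<sigma> y" "\<sigma> (x * y) = \<sigma> x * \<sigma> y" "\<sigma> 0 = 0" "\<sigma> 1 = 1"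
    "\<sigma> (- x) = - \<sigma> x" "\<sigma> (x - y) = \<sigma> x - \<sigma> y" "\<sigma> (x ^ n) = \<sigma> x ^ n" "\<sigma> (inverse x) = inverse (\<sigma> x)"
    "\<sigma> (x / y) = \<sigma> x / \<sigma> y" "\<sigma> x = \<sigma> y \<longleftrightarrow> x = y" "\<sigma> x = 0 \<longleftrightarrow> x = 0" "\<sigma> (numeral k) = numeral k"
proof -
  have add: "\<sigma> (x + y) = \<sigma> x + \<sigma> y" and mult: "\<sigma> (x * y) = \<sigma> x * \<sigma> y" for x y
    using assms unfolding field_automorphism_def by auto
  show "\<sigma> (x + y) = \<sigma> x + \<sigma> y" "\<sigma> (x * y) = \<sigma> x * \<sigma> y" by (rule add, rule mult)
  show inj: "\<sigma> x = \<sigma> y \<longleftrightarrow> x = y" for x y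
    using assms unfolding field_automorphism_def bij_def by (auto dest: injD)
  have "\<sigma> 0 + \<sigma> 0 = \<sigma> 0 + 0" using add[of 0 0] by simp
  then show 0: "\<sigma> 0 = 0" by (simp only: add_left_cancel)
  show z: "\<sigma> x = 0 \<longleftrightarrow> x = 0" for x using inj[of x 0] 0 by simp
  have "\<sigma> 1 * \<sigma> 1 = \<sigma> 1" using mult[of 1 1] by simp
  then show 1: "\<sigma> 1 = 1" using z[of 1] by simp
  have "\<sigma> x + \<sigma> (- x) = 0" for x using add[of x "- x"] 0 by simp
  then show minus: "\<sigma> (- x) = - \<sigma> x" for x by (metis minus_unique)
  show "\<sigma> (x - y) = \<sigma> x - \<sigma> y" using add[of x "- y"] minus by simp
  show "\<sigma> (x ^ n) = \<sigma> x ^ n" by (induction n) (simp_all add: 1 mult)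
  have inv: "\<sigma> (inverse y) = inverse (\<sigma> y)" for y
  proof (cases "y = 0")
    case False
    then have "\<sigma> y * \<sigma> (inverse y) = 1" using mult[of y "inverse y"] 1 by simp
    then show ?thesis by (metis inverse_unique)
  qed (simp add: 0)
  then show "\<sigma> (inverse x) = inverse (\<sigma> x)" .
  show "\<sigma> (x / y) = \<sigma> x / \<sigma> y" by (simp add: divide_inverse mult inv)
  show "\<sigma> (numeral k) = numeral k"
    by (induction k) (simp_all only: numeral.simps 1 add)
qed

text \<open>
  A root of unity \<open>Z\<close> of exact order \<open>2 ^ (n + 1)\<close> generates all roots of unity of this order: take
  square roots inductively, the sign being \<open>Z ^ (2 ^ n)\<close>.
\<close>

lemma root_of_unity_power:
  fixes Z :: "'a :: field_char_0"
  assumes "Z ^ (2 ^ n) = - 1" "\<zeta> ^ (2 ^ Suc n) = 1"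
  shows "\<exists>i. \<zeta> = Z ^ i"
  using assms
proof (induction n arbitrary: Z \<zeta>)
  case 0
  then have "\<zeta> = 1 \<or> \<zeta> = - 1" by (simp add: power2_eq_1_iff)
  then show ?case
  proof
    assume "\<zeta> = 1" then show ?thesis by (intro exI[of _ 0]) simp
  next
    assume "\<zeta> = - 1" then show ?thesis using 0 by (intro exI[of _ 1]) simp
  qed
next
  case (Suc n)
  have "(Z ^ 2) ^ (2 ^ n) = - 1" "(\<zeta> ^ 2) ^ (2 ^ Suc n) = 1"
    using Suc.prems by (simp_all flip: power_mult)
  from Suc.IH[OF this] obtain i where "\<zeta> ^ 2 = (Z ^ i) ^ 2" by (auto simp: power_mult[symmetric] mult.commute)
  then have "\<zeta> = Z ^ i \<or> \<zeta> = - (Z ^ i)" by (simp only: power2_eq_iff)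
  moreover have "- (Z ^ i) = Z ^ (2 ^ Suc n + i)" using Suc.prems(1) by (simp add: power_add)
  ultimately show ?case by metis
qed

context short_curve
begin

primrec smul :: "nat \<Rightarrow> 'a point \<Rightarrow> 'a point" where
  "smul 0 P = Infinity"
| "smul (Suc n) P = smul n P \<boxplus> P"

lemma smul_in_pts [simp]: "P \<in> pts \<Longrightarrow> smul n P \<in> pts"
  by (induction n) auto

lemma smul_add: "P \<in> pts \<Longrightarrow> smul (m + n) P = smul m P \<boxplus> smul n P"
  by (induction n) (simp_all add: padd_assoc)

lemma smul_two_power: "P \<in> pts \<Longrightarrow> smul (2 ^ n) P = (dbl ^^ n) P"
  by (induction n) (simp_all add: mult_2 smul_add)

lemma smul_padd: "P \<in> pts \<Longrightarrow> Q \<in> pts \<Longrightarrow> smul n (P \<boxplus> Q) = smul n P \<boxplus> smul n Q"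
  by (induction n) (simp_all add: padd_rearrange)

lemma smul_two_torsion:
  assumes "T \<in> pts" "dbl T = Infinity"
  shows "smul n T = (if even n then Infinity else T)"
  using assms by (induction n) auto

lemma dbl_pow_padd: "P \<in> pts \<Longrightarrow> Q \<in> pts \<Longrightarrow> (dbl ^^ n) (P \<boxplus> Q) = (dbl ^^ n) P \<boxplus> (dbl ^^ n) Q"
  by (induction n) (simp_all add: dbl_padd)

text \<open>
  The abscissae of the nonzero two-torsion points are roots of a cubic polynomial, so there are at
  most three of these points.
\<close>

lemma two_torsion_group:
  assumes T: "T \<in> pts" "dbl T = Infinity" "T \<noteq> Infinity" and U: "U \<in> pts" "dbl U = Infinity" "U \<noteq> Infinity"
    and TU: "T \<noteq> U" and V: "V \<in> pts" "dbl V = Infinity"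
  shows "V = Infinity \<or> V = T \<or> V = U \<or> V = T \<boxplus> U"
proof (rule ccontr)
  assume *: "\<not> ?thesis"
  define S where "S = {T, U, T \<boxplus> U, V}"
  have TUs: "T \<boxplus> U \<in> pts" "dbl (T \<boxplus> U) = Infinity" using T U by (simp_all add: dbl_padd)
  have nT: "neg T = T" using T neg_eq_iff_dbl by simp
  have TU0: "T \<boxplus> U \<noteq> Infinity" using padd_eq_Infinity_iff[OF T(1) U(1)] nT TU by simp
  have TU1: "T \<boxplus> U \<noteq> T" using padd_left_cancel[OF T(1) U(1), of Infinity] U(3) by simp
  have TU2: "T \<boxplus> U \<noteq> U"
    using padd_left_cancel[OF U(1) T(1), of Infinity] T(3) padd_comm[OF T(1) U(1)] by simp
  have S: "P \<in> pts" "dbl P = Infinity" "P \<noteq> Infinity" if "P \<in> S" for P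
    using that T U V TUs TU0 * by (auto simp: S_def)
  have card: "card S = 4" using * TU TU1 TU2 by (auto simp: S_def)
  have inj: "inj_on px S"
  proof (rule inj_onI)
    fix P Q assume "P \<in> S" "Q \<in> S" "px P = px Q"
    then show "P = Q" using S[of P] S[of Q] px_eq_iff[of P Q] neg_eq_iff_dbl[of Q] by auto
  qed
  have c0: "cubic \<noteq> 0" by (simp add: cubic_def)
  have sub: "px ` S \<subseteq> {x. poly cubic x = 0}"
  proof
    fix x assume "x \<in> px ` S"
    then obtain P where "P \<in> S" "x = px P" by auto
    then show "x \<in> {x. poly cubic x = 0}"
      using S[of P] dbl_eq_Infinity_iff[of P] curve_eq[of P] by (simp add: poly_cubic)
  qed
  have "4 = card (px ` S)" using card_image[OF inj] card by simp
  also have "\<dots> \<le> card {x. poly cubic x = 0}" using card_mono[OF poly_roots_finite[OF c0] sub] .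
  also have "\<dots> \<le> Polynomial.degree cubic" by (rule card_poly_roots_bound[OF c0])
  also have "\<dots> = 3" by (simp add: cubic_def)
  finally show False by simp
qed

text \<open>
  Each of the two translations changes the sign of the pairing.
\<close>

lemma pairing_two_translates:
  assumes b: "basis (Suc k) P Q"
    and S: "S \<in> pts" "dbl S = Infinity" "S \<noteq> Infinity" "S \<noteq> (dbl ^^ Suc k) Q"
    and S': "S' \<in> pts" "dbl S' = Infinity" "S' \<noteq> Infinity" "S' \<noteq> (dbl ^^ Suc k) P"
  shows "pairing (Suc k) (P \<boxplus> S) (Q \<boxplus> S') = pairing (Suc k) P Q"
proof -
  have y: "py S = 0" "py S' = 0" using dbl_eq_Infinity_iff S S' by auto
  note 1 = pairing_translate[OF b S(1,3) y(1) S(4)]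
  have P: "P \<in> pts" using b by (simp add: basis_def exact_order_def)
  have "(dbl ^^ Suc k) (P \<boxplus> S) = (dbl ^^ Suc k) P"
    using dbl_padd[OF P S(1)] P S(2) unfolding dbl_pow_Suc by simp
  then have "S' \<noteq> (dbl ^^ Suc k) (P \<boxplus> S)" using S'(4) by simp
  note 2 = pairing_translate(2)[OF basis_sym[OF 1(1)] S'(1,3) y(2) this]
  have "pairing (Suc k) (P \<boxplus> S) (Q \<boxplus> S') = inverse (- pairing (Suc k) Q (P \<boxplus> S))"
    using pairing_swap[of "Suc k" "P \<boxplus> S" "Q \<boxplus> S'"] 2 by simp
  also have "\<dots> = - pairing (Suc k) (P \<boxplus> S) Q" using pairing_swap[of "Suc k" "P \<boxplus> S" Q] by simp
  also have "\<dots> = pairing (Suc k) P Q" using 1 by simp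
  finally show ?thesis .
qed

text \<open>
  An automorphism that fixes the coefficients of the curve acts on its points. Addition and pairing
  are given by rational expressions with these coefficients, so they are equivariant.
\<close>

context
  fixes \<sigma> :: "'a \<Rightarrow> 'a"
  assumes \<sigma>: "field_automorphism \<sigma>" and fix_ab: "\<sigma> a = a" "\<sigma> b = b"
begin

abbreviation sg :: "'a point \<Rightarrow> 'a point" where "sg \<equiv> map_point \<sigma>"

lemmas \<sigma>_simps = field_automorphism_simps[OF \<sigma>]

lemma sg_in_pts [simp]: "sg P \<in> pts \<longleftrightarrow> P \<in> pts"
proof (cases P)
  case (Affine x y)
  have "\<sigma> (y ^ 2) = \<sigma> (x ^ 3 + a * x + b) \<longleftrightarrow> y ^ 2 = x ^ 3 + a * x + b" by (rule \<sigma>_simps)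
  then show ?thesis using Affine by (simp add: Affine_in_pts \<sigma>_simps fix_ab)
qed simp

lemma sg_Infinity_iff [simp]: "sg P = Infinity \<longleftrightarrow> P = Infinity"
  by (cases P) auto

lemma sg_neg: "sg (neg P) = neg (sg P)"
  by (cases P) (auto simp: \<sigma>_simps)

lemma sg_padd: "sg (P \<boxplus> Q) = sg P \<boxplus> sg Q"
proof (cases P; cases Q)
  fix x1 y1 x2 y2 assume pq: "P = Affine x1 y1" "Q = Affine x2 y2"
  have "\<sigma> y1 + \<sigma> y2 = 0 \<longleftrightarrow> y1 + y2 = 0" using \<sigma>_simps(11)[of "y1 + y2"] by (simp add: \<sigma>_simps)
  then show ?thesis unfolding pq by (simp add: Let_def \<sigma>_simps fix_ab)
qed auto

lemma px_sg: "px (sg P) = \<sigma> (px P)" and py_sg: "py (sg P) = \<sigma> (py P)"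
  by (cases P; simp add: \<sigma>_simps)+

lemma miller_sg: "miller (sg P) (sg Q) = \<sigma> (miller P Q)"
  unfolding miller_def tang_def slope_def sg_padd[symmetric] px_sg py_sg by (simp add: \<sigma>_simps fix_ab)

lemma millerF_sg: "millerF k (sg P) (sg Q) = \<sigma> (millerF k P Q)"
  by (induction k arbitrary: P) (simp_all add: \<sigma>_simps miller_sg flip: sg_padd)

lemma pairing_sg: "pairing k (sg P) (sg Q) = \<sigma> (pairing k P Q)"
  unfolding pairing_def sg_neg[symmetric] millerF_sg by (simp add: \<sigma>_simps)

end

end

context alg_short_curve
begin

lemma dbl_pow_surj: "Q \<in> pts \<Longrightarrow> \<exists>P\<in>pts. (dbl ^^ n) P = Q"
proof (induction n)
  case (Suc n)
  then obtain R where R: "R \<in> pts" "(dbl ^^ n) R = Q" by blast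
  then obtain P where "P \<in> pts" "dbl P = R" using dbl_surj by blast
  then show ?case using R unfolding dbl_pow_Suc by (intro bexI[of _ P]) auto
qed auto

lemma exact_orderI:
  assumes "P \<in> pts" "(dbl ^^ n) P = T" "dbl T = Infinity" "T \<noteq> Infinity"
  shows "exact_order (Suc n) P"
proof -
  have "(dbl ^^ j) P \<noteq> Infinity" if "j < Suc n" for j
  proof
    assume "(dbl ^^ j) P = Infinity"
    then have "(dbl ^^ (n - j)) ((dbl ^^ j) P) = Infinity" by simp
    then show False using that assms unfolding dbl_pow_add by simp
  qed
  then show ?thesis using assms by (simp add: exact_order_def)
qed

text \<open>
  The idea is to find a basis \<open>P\<close>, \<open>Q\<close> of the torsion of order \<open>2 ^ (n + 1)\<close> such that \<open>\<sigma>\<close> preserves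
  the pairing of \<open>P\<close> and \<open>Q\<close>, a primitive root of unity. As \<open>\<sigma>\<close> fixes the torsion of order \<open>2 ^ n\<close>, the
  difference \<open>\<sigma> P - P\<close> is a two-torsion point that depends on \<open>2 ^ n P\<close> only, which defines an
  endomorphism \<open>M\<close> of the two-torsion. There the map \<open>\<nu> = \<alpha> + D\<close> is not zero, but its square is, because
  \<open>\<alpha>\<^sup>2 = - D\<close>; and \<open>M\<close> commutes with \<open>\<nu>\<close>. Over a field with two elements this leaves for \<open>M\<close> only
  \<open>0\<close>, \<open>\<nu>\<close>, \<open>1\<close> and \<open>1 + \<nu>\<close>. In the other cases than \<open>0\<close>, \<open>P\<close> and \<open>Q\<close> can be chosen such that passing
  from \<open>P\<close> to \<open>\<sigma> P\<close> and from \<open>Q\<close> to \<open>\<sigma> Q\<close> changes the sign of the pairing twice.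
\<close>

theorem automorphism_fixes_roots_of_unity:
  fixes \<alpha> :: "'a point \<Rightarrow> 'a point"
  assumes \<alpha>: "\<And>P. P \<in> pts \<Longrightarrow> \<alpha> P \<in> pts"
    and \<alpha>_add: "\<And>P Q. P \<in> pts \<Longrightarrow> Q \<in> pts \<Longrightarrow> \<alpha> (P \<boxplus> Q) = \<alpha> P \<boxplus> \<alpha> Q"
    and \<alpha>_square: "\<And>P. P \<in> pts \<Longrightarrow> \<alpha> (\<alpha> P) \<boxplus> smul D P = Infinity"
    and \<nu>: "\<exists>T\<in>pts. dbl T = Infinity \<and> \<alpha> T \<boxplus> smul D T \<noteq> Infinity"
    and \<sigma>: "field_automorphism \<sigma>" and fix_ab: "\<sigma> a = a" "\<sigma> b = b"
    and comm: "(\<forall>P\<in>pts. map_point \<sigma> (\<alpha> P) = \<alpha> (map_point \<sigma> P)) \<or>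
      (\<forall>P\<in>pts. map_point \<sigma> (\<alpha> P) = neg (\<alpha> (map_point \<sigma> P)))"
    and n: "n \<ge> 2" and fixed: "\<And>P. P \<in> pts \<Longrightarrow> (dbl ^^ n) P = Infinity \<Longrightarrow> map_point \<sigma> P = P"
    and \<zeta>: "\<zeta> ^ (2 ^ Suc n) = 1"
  shows "\<sigma> \<zeta> = \<zeta>"
proof -
  let ?s = "map_point \<sigma>"
  note s_pts = sg_in_pts[OF \<sigma> fix_ab] and s_add = sg_padd[OF \<sigma> fix_ab] and s_neg = sg_neg[OF \<sigma> fix_ab]
  have \<alpha>0: "\<alpha> Infinity = Infinity"
    using \<alpha>_add[of Infinity Infinity] padd_left_cancel[of "\<alpha> Infinity" "\<alpha> Infinity" Infinity] \<alpha>[of Infinity] by simp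
  have \<alpha>_dbl: "(dbl ^^ k) (\<alpha> P) = \<alpha> ((dbl ^^ k) P)" if "P \<in> pts" for k P
    using that by (induction k) (simp_all add: \<alpha>_add)
  define \<nu>' where "\<nu>' P = \<alpha> P \<boxplus> smul D P" for P
  have \<nu>_pts: "\<nu>' P \<in> pts" if "P \<in> pts" for P using that \<alpha> by (simp add: \<nu>'_def)
  have \<nu>_add: "\<nu>' (P \<boxplus> Q) = \<nu>' P \<boxplus> \<nu>' Q" if "P \<in> pts" "Q \<in> pts" for P Q
    using that \<alpha> by (simp add: \<nu>'_def \<alpha>_add smul_padd padd_rearrange)
  have \<nu>_dbl: "(dbl ^^ k) (\<nu>' P) = \<nu>' ((dbl ^^ k) P)" if "P \<in> pts" for k P
    using that by (induction k) (simp_all add: \<nu>_add)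
  have \<nu>_Infinity: "\<nu>' Infinity = Infinity" using \<nu>_dbl[of Infinity] by (simp add: \<nu>'_def \<alpha>0 smul_two_torsion)
  have \<alpha>T: "\<alpha> T \<in> pts" "dbl (\<alpha> T) = Infinity" if "T \<in> pts" "dbl T = Infinity" for T
    using that \<alpha> \<alpha>_dbl[of T 1] \<alpha>0 by auto
  have \<nu>\<nu>: "\<nu>' (\<nu>' T) = Infinity" if T: "T \<in> pts" "dbl T = Infinity" for T
  proof (cases "even D")
    case True
    then have "\<nu>' (\<nu>' T) = \<alpha> (\<alpha> T)" using T \<alpha>T[OF T] by (simp add: \<nu>'_def smul_two_torsion)
    then show ?thesis using \<alpha>_square[OF T(1)] T True by (simp add: smul_two_torsion)
  next
    case False
    have t: "\<alpha> T \<boxplus> T \<in> pts" "dbl (\<alpha> T \<boxplus> T) = Infinity"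
      using dbl_padd[OF \<alpha>T(1)[OF T] T(1)] \<alpha>T[OF T] T by simp_all
    have "\<nu>' T = \<alpha> T \<boxplus> T" unfolding \<nu>'_def smul_two_torsion[OF T] using False by simp
    then have "\<nu>' (\<nu>' T) = (\<alpha> (\<alpha> T) \<boxplus> \<alpha> T) \<boxplus> (\<alpha> T \<boxplus> T)"
      unfolding \<nu>'_def using smul_two_torsion[OF t] False \<alpha>_add[OF \<alpha>T(1)[OF T] T(1)] by simp
    also have "\<dots> = (\<alpha> (\<alpha> T) \<boxplus> T) \<boxplus> dbl (\<alpha> T)"
      using T \<alpha>T[OF T] \<alpha> padd_rearrange[of "\<alpha> (\<alpha> T)" T "\<alpha> T" "\<alpha> T"] padd_comm[of "\<alpha> T" T] by simp
    also have "\<dots> = Infinity"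
      using \<alpha>_square[OF T(1)] \<alpha>T[OF T] T False by (simp add: smul_two_torsion)
    finally show ?thesis .
  qed
  obtain T1 where T1: "T1 \<in> pts" "dbl T1 = Infinity" "\<nu>' T1 \<noteq> Infinity" using \<nu> by (auto simp: \<nu>'_def)
  define T0 where "T0 = \<nu>' T1"
  have T0: "T0 \<in> pts" "dbl T0 = Infinity" "T0 \<noteq> Infinity" "\<nu>' T0 = Infinity"
    using T1 \<nu>_pts \<nu>_dbl[of T1 1] \<nu>\<nu>[OF T1(1,2)] \<nu>_Infinity by (auto simp: T0_def)
  have T10: "T1 \<noteq> Infinity" "T1 \<noteq> T0" using T1 T0 \<nu>_Infinity by auto
  define T2 where "T2 = T0 \<boxplus> T1"
  have T2: "T2 \<in> pts" "dbl T2 = Infinity" using T0 T1 by (simp_all add: T2_def dbl_padd)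
  have T2_ne: "T2 \<noteq> Infinity" "T2 \<noteq> T0" "T2 \<noteq> T1"
  proof -
    have "neg T0 = T0" using T0 neg_eq_iff_dbl by simp
    then show "T2 \<noteq> Infinity" using padd_eq_Infinity_iff[OF T0(1) T1(1)] T10 by (simp add: T2_def)
    show "T2 \<noteq> T0" using padd_left_cancel[OF T0(1) T1(1), of Infinity] T10 by (simp add: T2_def)
    show "T2 \<noteq> T1"
      using padd_left_cancel[OF T1(1) T0(1), of Infinity] T0 padd_comm[OF T0(1) T1(1)] by (simp add: T2_def)
  qed
  have E2: "V = Infinity \<or> V = T0 \<or> V = T1 \<or> V = T2" if "V \<in> pts" "dbl V = Infinity" for V
    using two_torsion_group[OF T0(1-3) T1(1,2) T10(1) _ that] T10 by (auto simp: T2_def)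
  have \<nu>T2: "\<nu>' T2 = T0" using \<nu>_add[OF T0(1) T1(1)] T0 by (simp add: T2_def T0_def[symmetric])
  \<comment> \<open>If the automorphism anticommuted with \<open>\<alpha>\<close>, then \<open>\<alpha>\<close> would kill the two-torsion, because the
    automorphism fixes the four-torsion.\<close>
  have comm: "?s (\<alpha> P) = \<alpha> (?s P)" if "P \<in> pts" for P
  proof -
    have False if anti: "\<forall>P\<in>pts. ?s (\<alpha> P) = neg (\<alpha> (?s P))"
    proof -
      have "\<alpha> T = Infinity" if T: "T \<in> pts" "dbl T = Infinity" for T
      proof -
        obtain P where P: "P \<in> pts" "dbl P = T" using dbl_surj T by blast
        have "n = (n - 2) + 2" using n by simp
        then have "(dbl ^^ n) P = (dbl ^^ (n - 2)) ((dbl ^^ 2) P)" unfolding dbl_pow_add by simp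
        then have P4: "(dbl ^^ n) P = Infinity" using P T by (simp add: eval_nat_numeral)
        then have "?s (\<alpha> P) = \<alpha> P" "?s P = P" using fixed \<alpha> \<alpha>_dbl P \<alpha>0 by auto
        then have "neg (\<alpha> P) = \<alpha> P" using anti P by metis
        then have "dbl (\<alpha> P) = Infinity" using neg_eq_iff_dbl \<alpha> P by blast
        then show ?thesis using \<alpha>_add[OF P(1) P(1)] P by simp
      qed
      then have "\<alpha> T1 = Infinity" using T1 by blast
      then have "\<nu>' T1 = Infinity" using \<alpha>_square[OF T1(1)] \<alpha>0 by (simp add: \<nu>'_def)
      then show False using T1 by simp
    qed
    then show ?thesis using comm that by blast
  qed
  have s_smul: "?s (smul k P) = smul k (?s P)" for k P by (induction k) (simp_all add: s_add)
  have \<nu>_s: "?s (\<nu>' P) = \<nu>' (?s P)" if "P \<in> pts" for P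
    using comm[OF that] by (simp add: \<nu>'_def s_add s_smul)
  \<comment> \<open>A choice of \<open>P\<close> with \<open>2 ^ n P = T\<close>, on which the difference \<open>\<sigma> P - P\<close> does not depend.\<close>
  define lift where "lift T = (SOME P. P \<in> pts \<and> (dbl ^^ n) P = T)" for T
  have lift: "lift T \<in> pts" "(dbl ^^ n) (lift T) = T" if "T \<in> pts" for T
    using someI_ex[of "\<lambda>P. P \<in> pts \<and> (dbl ^^ n) P = T"] dbl_pow_surj[OF that] unfolding lift_def by auto
  define M where "M T = ?s (lift T) \<boxplus> neg (lift T)" for T
  have M: "?s P = P \<boxplus> M T" if P: "P \<in> pts" "(dbl ^^ n) P = T" for P T
  proof -
    define H where "H = lift T"
    have H: "H \<in> pts" "(dbl ^^ n) H = T" using lift[of T] P by (auto simp: H_def)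
    have "(dbl ^^ n) (P \<boxplus> neg H) = Infinity" using H P by (simp add: dbl_pow_padd dbl_pow_neg)
    then have "?s (P \<boxplus> neg H) = P \<boxplus> neg H" using fixed H P by simp
    then have eq: "?s P \<boxplus> neg (?s H) = P \<boxplus> neg H" by (simp add: s_add s_neg)
    have "?s P = (?s P \<boxplus> neg (?s H)) \<boxplus> ?s H"
      using padd_cancel[of "?s P" "neg (?s H)"] s_pts H P by simp
    also have "\<dots> = P \<boxplus> (?s H \<boxplus> neg H)"
      unfolding eq using H P s_pts padd_comm[of "neg H" "?s H"] by (simp add: padd_assoc)
    finally show ?thesis by (simp add: M_def H_def)
  qed
  have M_pts: "M T \<in> pts" if "T \<in> pts" for T using lift[OF that] s_pts by (simp add: M_def)
  have M_tor: "dbl (M T) = Infinity" if T: "T \<in> pts" "dbl T = Infinity" for T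
  proof -
    have "(dbl ^^ n) (dbl (lift T)) = Infinity"
      unfolding dbl_pow_padd[OF lift(1)[OF T(1)] lift(1)[OF T(1)]] lift(2)[OF T(1)] by (rule T(2))
    then have "?s (dbl (lift T)) = dbl (lift T)" using fixed padd_in_pts lift(1)[OF T(1)] by blast
    then have d: "dbl (?s (lift T)) = dbl (lift T)" unfolding s_add .
    have p: "lift T \<in> pts" "?s (lift T) \<in> pts" "neg (lift T) \<in> pts" using lift(1)[OF T(1)] s_pts by simp_all
    show ?thesis
      unfolding M_def dbl_padd[OF p(2,3)] d neg_padd[OF p(1) p(1), symmetric] by (rule padd_neg)
  qed
  have M_\<nu>: "M (\<nu>' T) = \<nu>' (M T)" if T: "T \<in> pts" for T
  proof -
    define H where "H = lift T"
    have H: "H \<in> pts" "(dbl ^^ n) H = T" using lift T by (auto simp: H_def)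
    have "\<nu>' H \<boxplus> M (\<nu>' T) = ?s (\<nu>' H)" using M[of "\<nu>' H" "\<nu>' T"] \<nu>_pts \<nu>_dbl H by simp
    also have "\<dots> = \<nu>' (H \<boxplus> M T)" using \<nu>_s[OF H(1)] M[OF H] by simp
    also have "\<dots> = \<nu>' H \<boxplus> \<nu>' (M T)" using \<nu>_add H M_pts T by simp
    finally show ?thesis using padd_left_cancel H \<nu>_pts M_pts T by simp
  qed
  have M_add: "M (T \<boxplus> U) = M T \<boxplus> M U" if TU: "T \<in> pts" "U \<in> pts" for T U
  proof -
    define H G where "H = lift T" and "G = lift U"
    have H: "H \<in> pts" "(dbl ^^ n) H = T" "G \<in> pts" "(dbl ^^ n) G = U" using lift TU by (auto simp: H_def G_def)
    have "(H \<boxplus> G) \<boxplus> M (T \<boxplus> U) = ?s (H \<boxplus> G)" using M[of "H \<boxplus> G" "T \<boxplus> U"] H by (simp add: dbl_pow_padd)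
    also have "\<dots> = (H \<boxplus> M T) \<boxplus> (G \<boxplus> M U)" using M[OF H(1,2)] M[OF H(3,4)] by (simp add: s_add)
    also have "\<dots> = (H \<boxplus> G) \<boxplus> (M T \<boxplus> M U)" using padd_rearrange H M_pts TU by simp
    finally show ?thesis using padd_left_cancel H M_pts TU by simp
  qed
  have MT0: "M T0 = \<nu>' (M T1)" using M_\<nu>[OF T1(1)] by (simp add: T0_def)
  obtain k where k: "n = Suc k" using n by (cases n) auto
  have basisI: "basis n P Q" if "P \<in> pts" "(dbl ^^ n) P = S" "Q \<in> pts" "(dbl ^^ n) Q = S'"
    "S \<noteq> S'" "dbl S = Infinity" "dbl S' = Infinity" "S \<noteq> Infinity" "S' \<noteq> Infinity" for P Q S S'
    using exact_orderI[OF that(1,2,6,8)] exact_orderI[OF that(3,4,7,9)] that by (simp add: basis_def)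
  have twisted: "\<exists>P Q. basis n P Q \<and> pairing n (?s P) (?s Q) = pairing n P Q"
    if S: "S \<in> pts" "dbl S = Infinity" "S \<noteq> Infinity" and S': "S' \<in> pts" "dbl S' = Infinity" "S' \<noteq> Infinity"
      and SS': "S \<noteq> S'" and MS: "M S \<noteq> Infinity" "M S \<noteq> S'" and MS': "M S' \<noteq> Infinity" "M S' \<noteq> S" for S S'
  proof -
    obtain P Q where P: "P \<in> pts" "(dbl ^^ n) P = S" and Q: "Q \<in> pts" "(dbl ^^ n) Q = S'"
      using dbl_pow_surj[OF S(1)] dbl_pow_surj[OF S'(1)] by blast
    have b: "basis n P Q" by (rule basisI[OF P Q SS' S(2) S'(2) S(3) S'(3)])
    have "pairing n (P \<boxplus> M S) (Q \<boxplus> M S') = pairing n P Q"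
      unfolding k
      by (rule pairing_two_translates[OF b[unfolded k]])
        (use M_pts M_tor S S' MS MS' P(2) Q(2) in \<open>simp_all flip: k\<close>)
    then have "basis n P Q \<and> pairing n (?s P) (?s Q) = pairing n P Q"
      unfolding M[OF P] M[OF Q] using b by blast
    then show ?thesis by blast
  qed
  \<comment> \<open>The value at \<open>T1\<close> determines \<open>M\<close>, which is \<open>0\<close>, \<open>\<nu>\<close>, \<open>1\<close> or \<open>1 + \<nu>\<close> in this order.\<close>
  have "\<exists>P Q. basis n P Q \<and> pairing n (?s P) (?s Q) = pairing n P Q"
    using E2[OF M_pts[OF T1(1)] M_tor[OF T1(1,2)]]
  proof (elim disjE)
    assume M1: "M T1 = Infinity"
    then have M0: "M T0 = Infinity" using MT0 \<nu>_Infinity by simp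
    obtain P Q where P: "P \<in> pts" "(dbl ^^ n) P = T1" and Q: "Q \<in> pts" "(dbl ^^ n) Q = T0"
      using dbl_pow_surj[OF T1(1)] dbl_pow_surj[OF T0(1)] by blast
    have "basis n P Q" by (rule basisI[OF P Q]) (use T0 T1 T10 in auto)
    moreover have "?s P = P" "?s Q = Q" using M[OF P] M[OF Q] M0 M1 by simp_all
    ultimately show ?thesis by metis
  next
    assume M1: "M T1 = T0"
    then have "M T0 = Infinity" using MT0 T0 by simp
    then have "M T2 = T0" using M_add[OF T0(1) T1(1)] M1 by (simp add: T2_def)
    then show ?thesis
      by (intro twisted[of T1 T2]) (use M1 T0 T1 T2 T10 T2_ne in auto)
  next
    assume M1: "M T1 = T1"
    then have "M T0 = T0" using MT0 by (simp add: T0_def)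
    then show ?thesis
      by (intro twisted[of T1 T0]) (use M1 T0 T1 T10 in auto)
  next
    assume M1: "M T1 = T2"
    then have "M T0 = T0" using MT0 \<nu>T2 by simp
    then show ?thesis
      by (intro twisted[of T0 T1]) (use M1 T0 T1 T10 T2_ne in auto)
  qed
  then obtain P Q where b: "basis n P Q" and inv: "pairing n (?s P) (?s Q) = pairing n P Q" by blast
  have "\<sigma> (pairing n P Q) = pairing n P Q" using inv pairing_sg[OF \<sigma> fix_ab] by simp
  moreover obtain i where "\<zeta> = pairing n P Q ^ i"
    using root_of_unity_power[OF pairing_primitive[OF b] \<zeta>] by blast
  ultimately show ?thesis by (simp add: field_automorphism_simps[OF \<sigma>])
qed

end


section \<open>The endomorphism ring and its generator\<close>

lemma inv_field_automorphism:
  assumes "field_automorphism \<sigma>"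
  shows "\<sigma> (inv_into UNIV \<sigma> x) = x" "inv_into UNIV \<sigma> (\<sigma> x) = x" "field_automorphism (inv_into UNIV \<sigma>)"
proof -
  have bij: "bij \<sigma>" using assms by (simp add: field_automorphism_def)
  show 1: "\<sigma> (inv_into UNIV \<sigma> x) = x" for x using bij by (simp add: bij_is_surj surj_f_inv_f)
  show 2: "inv_into UNIV \<sigma> (\<sigma> x) = x" for x using bij by (simp add: bij_is_inj)
  have "inv_into UNIV \<sigma> (x + y) = inv_into UNIV \<sigma> x + inv_into UNIV \<sigma> y" for x y
    using 2[of "inv_into UNIV \<sigma> x + inv_into UNIV \<sigma> y"] unfolding field_automorphism_simps[OF assms] 1 .
  moreover have "inv_into UNIV \<sigma> (x * y) = inv_into UNIV \<sigma> x * inv_into UNIV \<sigma> y" for x y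
    using 2[of "inv_into UNIV \<sigma> x * inv_into UNIV \<sigma> y"] unfolding field_automorphism_simps[OF assms] 1 .
  ultimately show "field_automorphism (inv_into UNIV \<sigma>)"
    using bij_imp_bij_inv[OF bij] by (simp add: field_automorphism_def)
qed

definition map_triple :: "('a \<Rightarrow> 'a) \<Rightarrow> 'a \<times> 'a \<times> 'a \<Rightarrow> 'a \<times> 'a \<times> 'a" where
  "map_triple g v = (g (fst v), g (fst (snd v)), g (snd (snd v)))"

lemma map_triple_homogeneous:
  assumes "field_automorphism \<sigma>"
  shows "map_triple \<sigma> (homogeneous_coords P) = homogeneous_coords (map_point \<sigma> P)"
  by (cases P) (simp_all add: map_triple_def field_automorphism_simps[OF assms])

text \<open>
  The form whose coefficients are the images of those of \<open>F\<close>.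
\<close>

lemma ternary_form_conjugate:
  assumes \<sigma>: "field_automorphism \<sigma>" and F: "ternary_form d F"
  shows "ternary_form d (\<lambda>v. \<sigma> (F (map_triple (inv_into UNIV \<sigma>) v)))"
proof -
  obtain k where k: "F = (\<lambda>(x, y, z). \<Sum>(i, j) \<in> {(i, j). i + j \<le> d}. k i j * x ^ i * y ^ j * z ^ (d - i - j))"
    using F by (auto simp: ternary_form_def)
  note s = field_automorphism_simps[OF \<sigma>]
  have sum: "\<sigma> (sum g A) = (\<Sum>x\<in>A. \<sigma> (g x))" for g :: "nat \<times> nat \<Rightarrow> 'a" and A
    by (induction A rule: infinite_finite_induct) (simp_all add: s)
  show ?thesis
    unfolding ternary_form_def
  proof (intro exI[of _ "\<lambda>i j. \<sigma> (k i j)"] ext)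
    fix v :: "'a \<times> 'a \<times> 'a"
    obtain x y z where v: "v = (x, y, z)" by (cases v)
    show "\<sigma> (F (map_triple (inv_into UNIV \<sigma>) v)) =
        (case v of (x, y, z) \<Rightarrow> \<Sum>(i, j) \<in> {(i, j). i + j \<le> d}. \<sigma> (k i j) * x ^ i * y ^ j * z ^ (d - i - j))"
      unfolding k v map_triple_def fst_conv snd_conv prod.case sum
      by (intro sum.cong refl) (auto simp: s inv_field_automorphism[OF \<sigma>])
  qed
qed

lemma form_map_conjugate:
  assumes \<sigma>: "field_automorphism \<sigma>" and \<Phi>: "form_map d \<Phi>"
  shows "form_map d (\<lambda>v. map_triple \<sigma> (\<Phi> (map_triple (inv_into UNIV \<sigma>) v)))"
  using \<Phi> ternary_form_conjugate[OF \<sigma>, of d "\<lambda>v. fst (\<Phi> v)"]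
    ternary_form_conjugate[OF \<sigma>, of d "\<lambda>v. fst (snd (\<Phi> v))"]
    ternary_form_conjugate[OF \<sigma>, of d "\<lambda>v. snd (snd (\<Phi> v))"]
  unfolding form_map_def map_triple_def[of \<sigma>] by simp

lemma local_forms_conjugate:
  assumes \<sigma>: "field_automorphism \<sigma>"
    and C: "\<And>P. P \<in> curve_points C \<Longrightarrow> map_point (inv_into UNIV \<sigma>) P \<in> curve_points C"
    and \<phi>: "local_forms C \<phi> (map_point (inv_into UNIV \<sigma>) P)"
  shows "local_forms C (\<lambda>Q. map_point \<sigma> (\<phi> (map_point (inv_into UNIV \<sigma>) Q))) P"
proof -
  obtain d \<Phi> where \<Phi>: "form_map d \<Phi>" "\<Phi> (homogeneous_coords (map_point (inv_into UNIV \<sigma>) P)) \<noteq> (0, 0, 0)"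
    "\<And>Q. Q \<in> curve_points C \<Longrightarrow> \<Phi> (homogeneous_coords Q) \<noteq> (0, 0, 0) \<Longrightarrow>
      \<exists>t. t \<noteq> 0 \<and> \<Phi> (homogeneous_coords Q) = vscale t (homogeneous_coords (\<phi> Q))"
    using \<phi> unfolding local_forms_def by blast
  let ?\<Phi> = "\<lambda>v. map_triple \<sigma> (\<Phi> (map_triple (inv_into UNIV \<sigma>) v))"
  note s = field_automorphism_simps[OF \<sigma>] and i = inv_field_automorphism[OF \<sigma>]
  have nz: "map_triple \<sigma> v = (0, 0, 0) \<longleftrightarrow> v = (0, 0, 0)" for v
    by (cases v) (simp add: map_triple_def s)
  have sc: "map_triple \<sigma> (vscale t v) = vscale (\<sigma> t) (map_triple \<sigma> v)" for t v
    by (simp add: map_triple_def vscale_eq s)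
  show ?thesis
    unfolding local_forms_def
  proof (intro exI[of _ d] exI[of _ ?\<Phi>] conjI ballI impI)
    show "form_map d ?\<Phi>" by (rule form_map_conjugate[OF \<sigma> \<Phi>(1)])
    show "?\<Phi> (homogeneous_coords P) \<noteq> (0, 0, 0)"
      unfolding map_triple_homogeneous[OF i(3)] nz by (rule \<Phi>(2))
    fix Q assume Q: "Q \<in> curve_points C" "?\<Phi> (homogeneous_coords Q) \<noteq> (0, 0, 0)"
    then have "\<Phi> (homogeneous_coords (map_point (inv_into UNIV \<sigma>) Q)) \<noteq> (0, 0, 0)"
      unfolding map_triple_homogeneous[OF i(3)] nz by blast
    from \<Phi>(3)[OF C[OF Q(1)] this] obtain t where t: "t \<noteq> 0"
      "\<Phi> (homogeneous_coords (map_point (inv_into UNIV \<sigma>) Q)) = vscale t (homogeneous_coords (\<phi> (map_point (inv_into UNIV \<sigma>) Q)))"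
      by blast
    show "\<exists>t. t \<noteq> 0 \<and> ?\<Phi> (homogeneous_coords Q) =
        vscale t (homogeneous_coords (map_point \<sigma> (\<phi> (map_point (inv_into UNIV \<sigma>) Q))))"
      unfolding map_triple_homogeneous[OF i(3)] t(2) sc map_triple_homogeneous[OF \<sigma>]
      by (intro exI[of _ "\<sigma> t"]) (simp add: t s)
  qed
qed

context alg_short_curve
begin

definition endo :: "('a point \<Rightarrow> 'a point) \<Rightarrow> bool" where
  "endo \<phi> \<longleftrightarrow> (\<forall>P\<in>pts. \<phi> P \<in> pts) \<and> (\<forall>P\<in>pts. \<forall>Q\<in>pts. \<phi> (P \<boxplus> Q) = \<phi> P \<boxplus> \<phi> Q) \<and>
     (\<forall>P\<in>pts. local_forms E \<phi> P)"

lemma endo_maps: "endo \<phi> \<Longrightarrow> P \<in> pts \<Longrightarrow> \<phi> P \<in> pts"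
  and endo_add: "endo \<phi> \<Longrightarrow> P \<in> pts \<Longrightarrow> Q \<in> pts \<Longrightarrow> \<phi> (P \<boxplus> Q) = \<phi> P \<boxplus> \<phi> Q"
  and endo_forms: "endo \<phi> \<Longrightarrow> P \<in> pts \<Longrightarrow> local_forms E \<phi> P"
  by (simp_all add: endo_def)

lemma endo_const: "endo (\<lambda>P. Infinity)"
  by (simp add: endo_def local_forms_const)

lemma endo_id: "endo (\<lambda>P. P)"
  by (simp add: endo_def local_forms_id)

lemma endo_padd:
  assumes "endo \<phi>" "endo \<psi>"
  shows "endo (\<lambda>P. \<phi> P \<boxplus> \<psi> P)"
  unfolding endo_def
proof (intro conjI ballI)
  fix P assume P: "P \<in> pts"
  then show "\<phi> P \<boxplus> \<psi> P \<in> pts" using assms by (simp add: endo_maps)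
  show "local_forms E (\<lambda>P. \<phi> P \<boxplus> \<psi> P) P"
    by (rule local_forms_padd) (use assms P in \<open>auto intro: endo_maps endo_forms\<close>)
  fix Q assume Q: "Q \<in> pts"
  show "\<phi> (P \<boxplus> Q) \<boxplus> \<psi> (P \<boxplus> Q) = (\<phi> P \<boxplus> \<psi> P) \<boxplus> (\<phi> Q \<boxplus> \<psi> Q)"
    unfolding endo_add[OF assms(1) P Q] endo_add[OF assms(2) P Q]
    by (rule padd_rearrange) (use assms P Q in \<open>auto intro: endo_maps\<close>)
qed

lemma endo_compose:
  assumes "endo \<phi>" "endo \<psi>"
  shows "endo (\<lambda>P. \<phi> (\<psi> P))"
  unfolding endo_def
proof (intro conjI ballI)
  fix P assume P: "P \<in> pts"
  then show "\<phi> (\<psi> P) \<in> pts" using assms by (simp add: endo_maps)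
  show "local_forms E (\<lambda>P. \<phi> (\<psi> P)) P"
    by (rule local_forms_compose[where D = E]) (use assms P in \<open>auto intro: endo_maps endo_forms\<close>)
  fix Q assume Q: "Q \<in> pts"
  show "\<phi> (\<psi> (P \<boxplus> Q)) = \<phi> (\<psi> P) \<boxplus> \<phi> (\<psi> Q)"
    using assms P Q by (simp add: endo_add endo_maps)
qed

lemma endo_smul: "endo (smul n)"
  by (induction n) (use endo_padd[OF _ endo_id] in \<open>simp_all add: endo_const smul.simps[abs_def]\<close>)

lemma endo_conjugate:
  assumes \<phi>: "endo \<phi>" and \<sigma>: "field_automorphism \<sigma>" and fix_ab: "\<sigma> a = a" "\<sigma> b = b"
  shows "endo (\<lambda>P. map_point \<sigma> (\<phi> (map_point (inv_into UNIV \<sigma>) P)))"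
proof -
  note i = inv_field_automorphism[OF \<sigma>]
  have ab': "inv_into UNIV \<sigma> a = a" "inv_into UNIV \<sigma> b = b" using fix_ab i(2)[of a] i(2)[of b] by simp_all
  note p = sg_in_pts[OF \<sigma> fix_ab] sg_in_pts[OF i(3) ab']
  show ?thesis
    unfolding endo_def
  proof (intro conjI ballI)
    fix P assume P: "P \<in> pts"
    then show "map_point \<sigma> (\<phi> (map_point (inv_into UNIV \<sigma>) P)) \<in> pts" using \<phi> by (simp add: p endo_maps)
    show "local_forms E (\<lambda>P. map_point \<sigma> (\<phi> (map_point (inv_into UNIV \<sigma>) P))) P"
      by (rule local_forms_conjugate[OF \<sigma>]) (use P \<phi> in \<open>auto simp: p intro: endo_forms\<close>)
    fix Q assume Q: "Q \<in> pts"
    show "map_point \<sigma> (\<phi> (map_point (inv_into UNIV \<sigma>) (P \<boxplus> Q))) =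
        map_point \<sigma> (\<phi> (map_point (inv_into UNIV \<sigma>) P)) \<boxplus> map_point \<sigma> (\<phi> (map_point (inv_into UNIV \<sigma>) Q))"
      using P Q by (simp add: sg_padd[OF i(3) ab'] sg_padd[OF \<sigma> fix_ab] endo_add[OF \<phi>] p)
  qed
qed

text \<open>
  A ring isomorphism from the endomorphism ring to the set \<open>R\<close> of complex numbers, except that it
  takes as arguments all maps that restrict to endomorphisms of the curve.
\<close>

definition represents_endos :: "complex set \<Rightarrow> (('a point \<Rightarrow> 'a point) \<Rightarrow> complex) \<Rightarrow> bool" where
  "represents_endos R h \<longleftrightarrow> (\<forall>\<phi>. endo \<phi> \<longrightarrow> h \<phi> \<in> R) \<and> (\<forall>z\<in>R. \<exists>\<phi>. endo \<phi> \<and> h \<phi> = z) \<and>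
     h (\<lambda>P. P) = 1 \<and>
     (\<forall>\<phi> \<psi>. endo \<phi> \<longrightarrow> endo \<psi> \<longrightarrow> h (\<lambda>P. \<phi> P \<boxplus> \<psi> P) = h \<phi> + h \<psi> \<and> h (\<lambda>P. \<phi> (\<psi> P)) = h \<phi> * h \<psi> \<and>
       (h \<phi> = h \<psi> \<longleftrightarrow> (\<forall>P\<in>pts. \<phi> P = \<psi> P)))"

text \<open>
  The endomorphism \<open>\<alpha>\<close> that corresponds to \<open>w\<close> satisfies \<open>\<alpha>\<^sup>2 = - D\<close>. So does its conjugate by \<open>\<sigma>\<close>,
  and since the endomorphism ring has no zero divisors, the conjugate is \<open>\<alpha>\<close> or \<open>- \<alpha>\<close>.
\<close>

theorem represented_endos_fix_roots_of_unity:
  assumes h: "represents_endos {of_int x + of_int y * w | x y. True} h"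
    and w: "w ^ 2 = - of_nat D" "w \<notin> \<real>"
    and \<sigma>: "field_automorphism \<sigma>" and fix_ab: "\<sigma> a = a" "\<sigma> b = b"
    and n: "n \<ge> 2" and fixed: "\<And>P. P \<in> pts \<Longrightarrow> (dbl ^^ n) P = Infinity \<Longrightarrow> map_point \<sigma> P = P"
    and \<zeta>: "\<zeta> ^ (2 ^ Suc n) = 1"
  shows "\<sigma> \<zeta> = \<zeta>"
proof -
  have h_add: "h (\<lambda>P. \<phi> P \<boxplus> \<psi> P) = h \<phi> + h \<psi>" and h_mult: "h (\<lambda>P. \<phi> (\<psi> P)) = h \<phi> * h \<psi>"
    and h_eq: "h \<phi> = h \<psi> \<longleftrightarrow> (\<forall>P\<in>pts. \<phi> P = \<psi> P)" if "endo \<phi>" "endo \<psi>" for \<phi> \<psi>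
    using h that unfolding represents_endos_def by blast+
  have h_range: "\<exists>x y. h \<phi> = of_int x + of_int y * w" if "endo \<phi>" for \<phi>
    using h that unfolding represents_endos_def by blast
  have h_id: "h (\<lambda>P. P) = 1" using h unfolding represents_endos_def by blast
  have h_const: "h (\<lambda>P. Infinity) = 0" using h_add[OF endo_const endo_const] by simp
  have h_smul: "h (smul k) = of_nat k" for k
  proof (induction k)
    case (Suc k)
    have "smul (Suc k) = (\<lambda>P. smul k P \<boxplus> P)" by (rule ext) simp
    then show ?case using h_add[OF endo_smul endo_id] Suc h_id by simp
  next
    case 0
    have "smul 0 = (\<lambda>P. Infinity)" by (rule ext) simp
    then show ?case using h_const by simp
  qed
  have "of_int 0 + of_int 1 * w \<in> {of_int x + of_int y * w | x y. True}" by blast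
  then obtain \<alpha> where \<alpha>: "endo \<alpha>" "h \<alpha> = w" using h unfolding represents_endos_def by force
  have square: "h \<phi> ^ 2 = - of_nat D \<longleftrightarrow> (\<forall>P\<in>pts. \<phi> (\<phi> P) \<boxplus> smul D P = Infinity)" if \<phi>: "endo \<phi>" for \<phi>
  proof -
    have "h \<phi> ^ 2 = - of_nat D \<longleftrightarrow> h (\<lambda>P. \<phi> (\<phi> P) \<boxplus> smul D P) = h (\<lambda>P. Infinity)"
      unfolding h_add[OF endo_compose[OF \<phi> \<phi>] endo_smul] h_mult[OF \<phi> \<phi>] h_smul h_const
      by (simp add: power2_eq_square eq_neg_iff_add_eq_0)
    then show ?thesis
      unfolding h_eq[OF endo_padd[OF endo_compose[OF \<phi> \<phi>] endo_smul] endo_const] .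
  qed
  have \<alpha>_square: "\<alpha> (\<alpha> P) \<boxplus> smul D P = Infinity" if "P \<in> pts" for P
    using square[OF \<alpha>(1)] \<alpha> w that by simp
  \<comment> \<open>A map that kills the two-torsion is twice an endomorphism, but \<open>w + D\<close> is not divisible by two in the order.\<close>
  have \<nu>: "\<exists>T\<in>pts. dbl T = Infinity \<and> \<alpha> T \<boxplus> smul D T \<noteq> Infinity"
  proof (rule ccontr)
    assume *: "\<not> ?thesis"
    define \<gamma> where "\<gamma> P = \<alpha> P \<boxplus> smul D P" for P
    have \<gamma>: "endo \<gamma>" unfolding \<gamma>_def[abs_def] by (rule endo_padd[OF \<alpha>(1) endo_smul])
    obtain \<beta> where \<beta>: "\<forall>P\<in>pts. \<beta> P \<in> pts" "\<forall>P\<in>pts. \<forall>Q\<in>pts. \<beta> (P \<boxplus> Q) = \<beta> P \<boxplus> \<beta> Q"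
      "\<forall>P\<in>pts. local_forms E \<beta> P" "\<forall>P\<in>pts. dbl (\<beta> P) = \<gamma> P"
      using divisible_by_two[of \<gamma>] endo_maps[OF \<gamma>] endo_add[OF \<gamma>] endo_forms[OF \<gamma>] *
      unfolding \<gamma>_def by blast
    have e: "endo \<beta>" using \<beta> by (simp add: endo_def)
    have "h \<gamma> = h \<beta> + h \<beta>"
      using h_eq[OF endo_padd[OF e e] \<gamma>] \<beta>(4) h_add[OF e e] by simp
    moreover have "h \<gamma> = w + of_nat D"
      unfolding \<gamma>_def[abs_def] using h_add[OF \<alpha>(1) endo_smul] \<alpha>(2) h_smul by simp
    moreover obtain x y where "h \<beta> = of_int x + of_int y * w" using h_range[OF e] by blast
    ultimately have "of_real (2 * of_int x - of_nat D) + of_real (2 * of_int y - 1) * w = 0"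
      by (simp add: algebra_simps)
    from quadratic_relation_real[OF w(2) this] have "2 * y = 1" by linarith
    then show False by presburger
  qed
  have comm: "(\<forall>P\<in>pts. map_point \<sigma> (\<alpha> P) = \<alpha> (map_point \<sigma> P)) \<or>
      (\<forall>P\<in>pts. map_point \<sigma> (\<alpha> P) = neg (\<alpha> (map_point \<sigma> P)))"
  proof -
    note i = inv_field_automorphism[OF \<sigma>]
    have ab': "inv_into UNIV \<sigma> a = a" "inv_into UNIV \<sigma> b = b" using fix_ab i(2)[of a] i(2)[of b] by simp_all
    have ss: "map_point (inv_into UNIV \<sigma>) (map_point \<sigma> P) = P" "map_point \<sigma> (map_point (inv_into UNIV \<sigma>) P) = P" for P
      by (cases P; simp add: i)+
    note p = sg_in_pts[OF \<sigma> fix_ab] sg_in_pts[OF i(3) ab']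
    have s_smul: "map_point \<sigma> (smul k P) = smul k (map_point \<sigma> P)" for k P
      by (induction k) (simp_all add: sg_padd[OF \<sigma> fix_ab])
    define \<alpha>' where "\<alpha>' P = map_point \<sigma> (\<alpha> (map_point (inv_into UNIV \<sigma>) P))" for P
    have e: "endo \<alpha>'" unfolding \<alpha>'_def[abs_def] by (rule endo_conjugate[OF \<alpha>(1) \<sigma> fix_ab])
    have "\<alpha>' (\<alpha>' P) \<boxplus> smul D P = Infinity" if P: "P \<in> pts" for P
    proof -
      have "\<alpha>' (\<alpha>' P) \<boxplus> smul D P =
          map_point \<sigma> (\<alpha> (\<alpha> (map_point (inv_into UNIV \<sigma>) P)) \<boxplus> smul D (map_point (inv_into UNIV \<sigma>) P))"
        unfolding \<alpha>'_def ss sg_padd[OF \<sigma> fix_ab] s_smul ..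
      also have "\<dots> = Infinity" using \<alpha>_square P p by simp
      finally show ?thesis .
    qed
    then have "h \<alpha>' ^ 2 = w ^ 2" using square[OF e] w by simp
    then consider "h \<alpha>' = w" | "h \<alpha>' = - w" using power2_eq_iff by blast
    then show ?thesis
    proof cases
      case 1
      then have eq: "\<alpha>' P = \<alpha> P" if "P \<in> pts" for P using h_eq[OF e \<alpha>(1)] \<alpha>(2) that by simp
      have "map_point \<sigma> (\<alpha> P) = \<alpha> (map_point \<sigma> P)" if "P \<in> pts" for P
        using eq[of "map_point \<sigma> P"] that p unfolding \<alpha>'_def ss by blast
      then show ?thesis by blast
    next
      case 2
      then have "h (\<lambda>P. \<alpha> P \<boxplus> \<alpha>' P) = h (\<lambda>P. Infinity)" using h_add[OF \<alpha>(1) e] \<alpha>(2) h_const by simp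
      then have eq: "\<alpha> P \<boxplus> \<alpha>' P = Infinity" if "P \<in> pts" for P
        using h_eq[OF endo_padd[OF \<alpha>(1) e] endo_const] that by blast
      have "map_point \<sigma> (\<alpha> P) = neg (\<alpha> (map_point \<sigma> P))" if P: "P \<in> pts" for P
      proof -
        have q: "map_point \<sigma> P \<in> pts" using P p by blast
        have "\<alpha>' (map_point \<sigma> P) = neg (\<alpha> (map_point \<sigma> P))"
          using eq[OF q] padd_eq_Infinity_iff[OF endo_maps[OF \<alpha>(1) q] endo_maps[OF e q]] by blast
        then show ?thesis unfolding \<alpha>'_def ss .
      qed
      then show ?thesis by blast
    qed
  qed
  show ?thesis
    by (rule automorphism_fixes_roots_of_unity[OF endo_maps[OF \<alpha>(1)] endo_add[OF \<alpha>(1)] \<alpha>_square \<nu> \<sigma> fix_ab comm n fixed \<zeta>])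
qed

end


section \<open>Reduction to the short form\<close>

text \<open>
  Completing the square in \<open>y\<close> and the cube in \<open>x\<close> puts the equation into the form
  \<open>(y + u x + v)\<^sup>2 = (x + c)\<^sup>3 + a (x + c) + b\<close>, which is expanded here. The coefficients stay in the
  base field.
\<close>

lemma short_form_exists:
  fixes W :: "'a :: field_char_0 weierstrass"
  assumes "elliptic_curve W"
  shows "\<exists>a b u v c. 4 * a ^ 3 + 27 * b ^ 2 \<noteq> 0 \<and>
    W = Weierstrass (2 * u) (3 * c - u ^ 2) (2 * v) (a + 3 * c ^ 2 - 2 * u * v) (b + a * c + c ^ 3 - v ^ 2)"
proof -
  define u v c where "u = a1 W / 2" and "v = a3 W / 2" and "c = (a2 W + u ^ 2) / 3"
  define a b where "a = a4 W + 2 * u * v - 3 * c ^ 2" and "b = a6 W + v ^ 2 - a * c - c ^ 3"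
  have W: "W = Weierstrass (2 * u) (3 * c - u ^ 2) (2 * v) (a + 3 * c ^ 2 - 2 * u * v) (b + a * c + c ^ 3 - v ^ 2)"
  proof -
    have "3 * c = a2 W + u ^ 2" by (simp add: c_def)
    then have "2 * u = a1 W" "2 * v = a3 W" "3 * c - u ^ 2 = a2 W" by (simp_all add: u_def v_def)
    moreover have "a + 3 * c ^ 2 - 2 * u * v = a4 W" "b + a * c + c ^ 3 - v ^ 2 = a6 W"
      by (simp_all add: a_def b_def)
    ultimately show ?thesis by simp
  qed
  \<comment> \<open>The quantities in terms of which the discriminant is defined, for the expanded equation.\<close>
  have b2: "(2 * u) ^ 2 + 4 * (3 * c - u ^ 2) = 12 * c"
    and b4: "2 * (a + 3 * c ^ 2 - 2 * u * v) + 2 * u * (2 * v) = 2 * (a + 3 * c ^ 2)"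
    and b6: "(2 * v) ^ 2 + 4 * (b + a * c + c ^ 3 - v ^ 2) = 4 * (b + a * c + c ^ 3)"
    by (simp_all add: algebra_simps power2_eq_square)
  have b8: "(2 * u) ^ 2 * (b + a * c + c ^ 3 - v ^ 2) + 4 * (3 * c - u ^ 2) * (b + a * c + c ^ 3 - v ^ 2) -
      2 * u * (2 * v) * (a + 3 * c ^ 2 - 2 * u * v) + (3 * c - u ^ 2) * (2 * v) ^ 2 - (a + 3 * c ^ 2 - 2 * u * v) ^ 2 =
      12 * c * (b + a * c + c ^ 3) - (a + 3 * c ^ 2) ^ 2"
    by (simp add: algebra_simps power2_eq_square power3_eq_cube)
  have "curve_discriminant W = - 16 * (4 * a ^ 3 + 27 * b ^ 2)"
    unfolding curve_discriminant_def Let_def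
    apply (subst (1 2 3 4 5 6 7 8 9 10 11 12 13 14 15 16 17 18 19 20 21 22 23 24) W)
    unfolding weierstrass.sel b2 b4 b6 b8
    by (simp add: algebra_simps power2_eq_square power3_eq_cube)
  then have "4 * a ^ 3 + 27 * b ^ 2 \<noteq> 0" using assms unfolding elliptic_curve_def by (metis mult_zero_right)
  with W show ?thesis by blast
qed

locale weierstrass_curve = alg_short_curve a b
  for a b :: "'a :: {alg_closed_field, field_char_0}" +
  fixes u v c :: 'a
begin

definition C :: "'a weierstrass" where
  "C = Weierstrass (2 * u) (3 * c - u ^ 2) (2 * v) (a + 3 * c ^ 2 - 2 * u * v) (b + a * c + c ^ 3 - v ^ 2)"

fun to_short :: "'a point \<Rightarrow> 'a point" where
  "to_short Infinity = Infinity"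
| "to_short (Affine x y) = Affine (x + c) (y + u * x + v)"

fun from_short :: "'a point \<Rightarrow> 'a point" where
  "from_short Infinity = Infinity"
| "from_short (Affine x y) = Affine (x - c) (y - u * (x - c) - v)"

lemma to_from_short [simp]: "to_short (from_short P) = P" "from_short (to_short P) = P"
  by (cases P; simp)+

lemma to_short_in_pts [simp]: "to_short P \<in> pts \<longleftrightarrow> P \<in> curve_points C"
proof (cases P)
  case (Affine x y)
  have "(y + u * x + v) ^ 2 - ((x + c) ^ 3 + a * (x + c) + b) =
      y ^ 2 + 2 * u * x * y + 2 * v * y - (x ^ 3 + (3 * c - u ^ 2) * x ^ 2 +
        (a + 3 * c ^ 2 - 2 * u * v) * x + (b + a * c + c ^ 3 - v ^ 2))"
    by (simp add: algebra_simps power2_eq_square power3_eq_cube)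
  then have "(y + u * x + v) ^ 2 = (x + c) ^ 3 + a * (x + c) + b \<longleftrightarrow>
      y ^ 2 + 2 * u * x * y + 2 * v * y = x ^ 3 + (3 * c - u ^ 2) * x ^ 2 +
        (a + 3 * c ^ 2 - 2 * u * v) * x + (b + a * c + c ^ 3 - v ^ 2)"
    by (metis right_minus_eq)
  then show ?thesis
    unfolding Affine to_short.simps Affine_in_pts by (simp add: curve_points_def C_def)
qed (simp_all add: curve_points_def)

lemma from_short_in_curve [simp]: "from_short P \<in> curve_points C \<longleftrightarrow> P \<in> pts"
  using to_short_in_pts[of "from_short P"] by simp

text \<open>
  The change of coordinates maps lines to lines: it adds \<open>u\<close> to the slopes.
\<close>

lemma to_short_point_add:
  assumes P: "P \<in> curve_points C" and Q: "Q \<in> curve_points C"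
  shows "to_short (point_add C P Q) = to_short P \<boxplus> to_short Q"
proof (cases P)
  case P1: (Affine x1 y1)
  show ?thesis
  proof (cases Q)
    case Q1: (Affine x2 y2)
    have p: "Affine (x1 + c) (y1 + u * x1 + v) \<in> pts" and q: "Affine (x2 + c) (y2 + u * x2 + v) \<in> pts"
      using P Q unfolding P1 Q1 by (simp_all flip: to_short_in_pts)
    have opp: "x1 = x2 \<and> y1 + y2 + a1 C * x1 + a3 C = 0 \<longleftrightarrow>
        x1 + c = x2 + c \<and> (y1 + u * x1 + v) + (y2 + u * x2 + v) + 0 * (x1 + c) + 0 = 0"
      by (auto simp: C_def algebra_simps)
    show ?thesis
    proof (cases "x1 = x2 \<and> y1 + y2 + a1 C * x1 + a3 C = 0")
      case True
      show ?thesis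
        unfolding P1 Q1 to_short.simps point_add.simps weierstrass.sel if_P[OF True] if_P[OF True[unfolded opp]] ..
    next
      case False
      define l where "l = (if x1 = x2
          then (3 * x1 ^ 2 + 2 * a2 C * x1 + a4 C - a1 C * y1) / (2 * y1 + a1 C * x1 + a3 C)
          else (y2 - y1) / (x2 - x1))"
      define l' where "l' = (if x1 + c = x2 + c
          then (3 * (x1 + c) ^ 2 + 2 * 0 * (x1 + c) + a - 0 * (y1 + u * x1 + v)) /
            (2 * (y1 + u * x1 + v) + 0 * (x1 + c) + 0)
          else ((y2 + u * x2 + v) - (y1 + u * x1 + v)) / ((x2 + c) - (x1 + c)))"
      have l': "l' = l + u"
      proof (cases "x1 = x2")
        case True
        have "(y1 + u * x1 + v) ^ 2 = (y2 + u * x2 + v) ^ 2"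
          using p q True unfolding Affine_in_pts by simp
        moreover have "y1 + u * x1 + v \<noteq> - (y2 + u * x2 + v)"
        proof
          assume "y1 + u * x1 + v = - (y2 + u * x2 + v)"
          then have "(y1 + u * x1 + v) + (y2 + u * x2 + v) + 0 * (x1 + c) + 0 = 0"
            by (simp only: left_minus mult_zero_left add_0_right)
          moreover have "x1 + c = x2 + c" using True by simp
          ultimately show False using False opp by blast
        qed
        ultimately have y: "y2 = y1" using True by (simp add: power2_eq_iff)
        define s where "s = 2 * (y1 + u * x1 + v)"
        have s: "s \<noteq> 0" using False True y by (auto simp: s_def C_def algebra_simps)
        have "l = (3 * x1 ^ 2 + 2 * (3 * c - u ^ 2) * x1 + (a + 3 * c ^ 2 - 2 * u * v) - 2 * u * y1) / s"
          using True by (simp add: l_def C_def s_def algebra_simps)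
        then have "l + u = (3 * x1 ^ 2 + 2 * (3 * c - u ^ 2) * x1 + (a + 3 * c ^ 2 - 2 * u * v) - 2 * u * y1 + u * s) / s"
          using s by (simp add: add_divide_distrib)
        also have "\<dots> = (3 * (x1 + c) ^ 2 + a) / s"
          by (rule arg_cong[where f = "\<lambda>t. t / s"]) (simp add: s_def algebra_simps power2_eq_square)
        finally show ?thesis using True by (simp add: l'_def s_def)
      next
        case False
        then have "x2 - x1 \<noteq> 0" by simp
        then have "l + u = (y2 - y1 + u * (x2 - x1)) / (x2 - x1)"
          using False by (simp add: l_def add_divide_distrib)
        then show ?thesis using False by (simp add: l'_def algebra_simps)
      qed
      define x3 where "x3 = l ^ 2 + a1 C * l - a2 C - x1 - x2"
      have x3: "l' ^ 2 - (x1 + c) - (x2 + c) = x3 + c"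
        unfolding l' by (simp add: x3_def C_def algebra_simps power2_eq_square)
      have add: "point_add C P Q = Affine x3 (- (l + a1 C) * x3 - (y1 - l * x1) - a3 C)"
        unfolding P1 Q1 point_add.simps if_not_P[OF False] Let_def l_def[symmetric] x3_def by simp
      have add': "to_short P \<boxplus> to_short Q =
          Affine (l' ^ 2 - (x1 + c) - (x2 + c)) (- l' * (l' ^ 2 - (x1 + c) - (x2 + c)) - ((y1 + u * x1 + v) - l' * (x1 + c)))"
        unfolding P1 Q1 to_short.simps point_add.simps weierstrass.sel if_not_P[OF False[unfolded opp]] Let_def
          l'_def[symmetric] by simp
      show ?thesis
        unfolding add add' x3 to_short.simps by (simp add: l' C_def algebra_simps)
    qed
  qed (simp add: P1)
qed simp

lemma from_short_padd:
  "P \<in> pts \<Longrightarrow> Q \<in> pts \<Longrightarrow> from_short (P \<boxplus> Q) = point_add C (from_short P) (from_short Q)"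
  using arg_cong[where f = from_short, OF to_short_point_add[of "from_short P" "from_short Q"]] by simp

lemma local_forms_to_short: "local_forms C' to_short P"
proof -
  define \<Phi> :: "'a \<times> 'a \<times> 'a \<Rightarrow> 'a \<times> 'a \<times> 'a" where
    "\<Phi> w = (fst w + c * snd (snd w), (fst (snd w) + u * fst w) + v * snd (snd w), snd (snd w))" for w
  have "form_map 1 \<Phi>"
    unfolding form_map_def \<Phi>_def fst_conv snd_conv by (intro conjI form_add form_scale form_coord)
  moreover have "\<Phi> (homogeneous_coords Q) = vscale 1 (homogeneous_coords (to_short Q))" for Q
    by (cases Q) (simp_all add: \<Phi>_def)
  ultimately show ?thesis
    unfolding local_forms_def
    by (intro exI[of _ "1 :: nat"] exI[of _ \<Phi>]) (auto simp: vscale_eq_0 intro!: exI[of _ 1])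
qed

lemma local_forms_from_short: "local_forms C' from_short P"
proof -
  define \<Phi> :: "'a \<times> 'a \<times> 'a \<Rightarrow> 'a \<times> 'a \<times> 'a" where
    "\<Phi> w = (fst w - c * snd (snd w), (fst (snd w) - u * fst w) + (u * c - v) * snd (snd w), snd (snd w))" for w
  have "form_map 1 \<Phi>"
    unfolding form_map_def \<Phi>_def fst_conv snd_conv by (intro conjI form_add form_diff form_scale form_coord)
  moreover have "\<Phi> (homogeneous_coords Q) = vscale 1 (homogeneous_coords (from_short Q))" for Q
    by (cases Q) (simp_all add: \<Phi>_def algebra_simps)
  ultimately show ?thesis
    unfolding local_forms_def
    by (intro exI[of _ "1 :: nat"] exI[of _ \<Phi>]) (auto simp: vscale_eq_0 intro!: exI[of _ 1])
qed

definition transfer :: "('a point \<Rightarrow> 'a point) \<Rightarrow> 'a point \<Rightarrow> 'a point" where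
  "transfer \<phi> = (\<lambda>P\<in>curve_points C. from_short (\<phi> (to_short P)))"

lemma endomorphisms_iff:
  "g \<in> endomorphisms C \<longleftrightarrow> g \<in> extensional (curve_points C) \<and> (\<forall>P\<in>curve_points C. g P \<in> curve_points C) \<and>
     (\<forall>P\<in>curve_points C. local_forms C g P) \<and>
     (\<forall>P\<in>curve_points C. \<forall>Q\<in>curve_points C. g (point_add C P Q) = point_add C (g P) (g Q))"
  unfolding endomorphisms_def curve_morphism_iff hom_def point_group_def by auto

lemma transfer_in_endomorphisms:
  assumes \<phi>: "endo \<phi>"
  shows "transfer \<phi> \<in> endomorphisms C"
  unfolding endomorphisms_iff
proof (intro conjI ballI)
  show "transfer \<phi> \<in> extensional (curve_points C)" by (simp add: transfer_def)
  fix P assume P: "P \<in> curve_points C"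
  then show "transfer \<phi> P \<in> curve_points C" using \<phi> by (simp add: transfer_def endo_maps)
  have "local_forms C (\<lambda>P. \<phi> (to_short P)) P"
    by (rule local_forms_compose[where D = E])
      (use P \<phi> in \<open>auto intro: local_forms_to_short endo_forms\<close>)
  then have "local_forms C (\<lambda>P. from_short (\<phi> (to_short P))) P"
    by (rule local_forms_compose[where D = E])
      (use P \<phi> in \<open>auto intro: local_forms_from_short endo_maps\<close>)
  then show "local_forms C (transfer \<phi>) P" by (rule local_forms_cong) (simp add: transfer_def)
  fix Q assume Q: "Q \<in> curve_points C"
  have PQ: "point_add C P Q \<in> curve_points C"
    using to_short_in_pts[of "point_add C P Q"] to_short_point_add[OF P Q] P Q by simp
  show "transfer \<phi> (point_add C P Q) = point_add C (transfer \<phi> P) (transfer \<phi> Q)"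
    using P Q PQ \<phi>
    by (simp add: transfer_def to_short_point_add[OF P Q] endo_add endo_maps from_short_padd)
qed

lemma transfer_surj:
  assumes g: "g \<in> endomorphisms C"
  shows "\<exists>\<phi>. endo \<phi> \<and> transfer \<phi> = g"
proof (intro exI conjI)
  let ?\<phi> = "\<lambda>P. to_short (g (from_short P))"
  have g': "g \<in> extensional (curve_points C)" "\<And>P. P \<in> curve_points C \<Longrightarrow> g P \<in> curve_points C"
    "\<And>P. P \<in> curve_points C \<Longrightarrow> local_forms C g P"
    "\<And>P Q. P \<in> curve_points C \<Longrightarrow> Q \<in> curve_points C \<Longrightarrow> g (point_add C P Q) = point_add C (g P) (g Q)"
    using g unfolding endomorphisms_iff by blast+
  show "endo ?\<phi>"
    unfolding endo_def
  proof (intro conjI ballI)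
    fix P assume P: "P \<in> pts"
    then show "to_short (g (from_short P)) \<in> pts" using g'(2) by simp
    have "local_forms E (\<lambda>P. g (from_short P)) P"
      by (rule local_forms_compose[where D = C])
        (use P g' in \<open>auto intro: local_forms_from_short\<close>)
    then show "local_forms E (\<lambda>P. to_short (g (from_short P))) P"
      by (rule local_forms_compose[where D = C]) (use P g' in \<open>auto intro: local_forms_to_short\<close>)
    fix Q assume Q: "Q \<in> pts"
    show "to_short (g (from_short (P \<boxplus> Q))) = to_short (g (from_short P)) \<boxplus> to_short (g (from_short Q))"
      using P Q g' by (simp add: from_short_padd to_short_point_add)
  qed
  show "transfer ?\<phi> = g"
    unfolding transfer_def to_from_short using g'(1) by (rule extensional_restrict)
qed

lemma endomorphism_ring_represented:
  assumes "endomorphism_ring C \<simeq> complex_ring\<lparr>carrier := R\<rparr>"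
  shows "\<exists>h. represents_endos R h"
proof -
  obtain H where H: "H \<in> ring_iso (endomorphism_ring C) (complex_ring\<lparr>carrier := R\<rparr>)"
    using assms unfolding is_ring_iso_def by blast
  have bij: "bij_betw H (endomorphisms C) R"
    using H by (simp add: ring_iso_def endomorphism_ring_def)
  have H_add: "H (\<lambda>P\<in>curve_points C. point_add C (f P) (g P)) = H f + H g"
    and H_mult: "H (compose (curve_points C) f g) = H f * H g"
    if "f \<in> endomorphisms C" "g \<in> endomorphisms C" for f g
    using H that by (auto simp: ring_iso_def ring_hom_def endomorphism_ring_def)
  have H_one: "H (\<lambda>P\<in>curve_points C. P) = 1"
    using H by (auto simp: ring_iso_def ring_hom_def endomorphism_ring_def)
  note t = transfer_in_endomorphisms
  show ?thesis
    unfolding represents_endos_def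
  proof (intro exI[of _ "\<lambda>\<phi>. H (transfer \<phi>)"] conjI allI impI ballI)
    show "H (transfer \<phi>) \<in> R" if "endo \<phi>" for \<phi> using bij_betwE[OF bij] t[OF that] by blast
    show "\<exists>\<phi>. endo \<phi> \<and> H (transfer \<phi>) = z" if z: "z \<in> R" for z
    proof -
      obtain g where g: "g \<in> endomorphisms C" "H g = z"
        using bij z unfolding bij_betw_def by blast
      then show ?thesis using transfer_surj[OF g(1)] by blast
    qed
    have "transfer (\<lambda>P. P) = (\<lambda>P\<in>curve_points C. P)" by (simp add: transfer_def)
    then show "H (transfer (\<lambda>P. P)) = 1" using H_one by simp
    fix \<phi> \<psi> assume e: "endo \<phi>" "endo \<psi>"
    have "transfer (\<lambda>P. \<phi> P \<boxplus> \<psi> P) = (\<lambda>P\<in>curve_points C. point_add C (transfer \<phi> P) (transfer \<psi> P))"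
      using e by (intro ext) (simp add: transfer_def from_short_padd endo_maps)
    then show "H (transfer (\<lambda>P. \<phi> P \<boxplus> \<psi> P)) = H (transfer \<phi>) + H (transfer \<psi>)"
      using H_add[OF t[OF e(1)] t[OF e(2)]] by simp
    have "transfer (\<lambda>P. \<phi> (\<psi> P)) = compose (curve_points C) (transfer \<phi>) (transfer \<psi>)"
      using e by (intro ext) (simp add: transfer_def compose_def endo_maps)
    then show "H (transfer (\<lambda>P. \<phi> (\<psi> P))) = H (transfer \<phi>) * H (transfer \<psi>)"
      using H_mult[OF t[OF e(1)] t[OF e(2)]] by simp
    have "H (transfer \<phi>) = H (transfer \<psi>) \<longleftrightarrow> transfer \<phi> = transfer \<psi>"
      using bij t[OF e(1)] t[OF e(2)] unfolding bij_betw_def by (auto dest: inj_onD)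
    also have "\<dots> \<longleftrightarrow> (\<forall>P\<in>pts. \<phi> P = \<psi> P)"
    proof
      assume eq: "transfer \<phi> = transfer \<psi>"
      show "\<forall>P\<in>pts. \<phi> P = \<psi> P"
      proof
        fix P assume "P \<in> pts"
        then have "from_short (\<phi> P) = from_short (\<psi> P)"
          using fun_cong[OF eq, of "from_short P"] by (simp add: transfer_def)
        then show "\<phi> P = \<psi> P" using to_from_short(1) by metis
      qed
    next
      assume "\<forall>P\<in>pts. \<phi> P = \<psi> P"
      then show "transfer \<phi> = transfer \<psi>" by (intro ext) (simp add: transfer_def)
    qed
    finally show "H (transfer \<phi>) = H (transfer \<psi>) \<longleftrightarrow> (\<forall>P\<in>pts. \<phi> P = \<psi> P)" .
  qed
qed

lemma pow_point_group:
  assumes "P \<in> curve_points C"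
  shows "P [^]\<^bsub>point_group C\<^esub> (n :: nat) \<in> curve_points C \<and> to_short (P [^]\<^bsub>point_group C\<^esub> n) = smul n (to_short P)"
proof (induction n)
  case 0
  then show ?case using Infinity_in_pts from_short_in_curve[of Infinity] by (simp add: nat_pow_def point_group_def)
next
  case (Suc n)
  define R where "R = P [^]\<^bsub>point_group C\<^esub> n"
  have R: "R \<in> curve_points C" "to_short R = smul n (to_short P)" using Suc by (simp_all add: R_def)
  have "P [^]\<^bsub>point_group C\<^esub> Suc n = point_add C R P"
    by (simp add: R_def nat_pow_def point_group_def)
  moreover have "to_short (point_add C R P) = smul (Suc n) (to_short P)"
    using to_short_point_add[OF R(1) assms] R(2) by simp
  moreover have "smul (Suc n) (to_short P) \<in> pts" using assms by (intro smul_in_pts) simp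
  ultimately show ?case using to_short_in_pts by metis
qed

lemma two_power_torsion_iff:
  assumes "Q \<in> pts"
  shows "from_short Q [^]\<^bsub>point_group C\<^esub> (2 ^ n :: nat) = \<one>\<^bsub>point_group C\<^esub> \<longleftrightarrow> (dbl ^^ n) Q = Infinity"
proof -
  have "to_short (from_short Q [^]\<^bsub>point_group C\<^esub> (2 ^ n :: nat)) = (dbl ^^ n) Q"
    using pow_point_group[of "from_short Q" "2 ^ n"] assms smul_two_power[OF assms] by simp
  moreover have "\<one>\<^bsub>point_group C\<^esub> = Infinity" by (simp add: point_group_def)
  ultimately show ?thesis by (metis to_from_short(2) to_short.simps(1) from_short.simps(1))
qed

end

section \<open>Division fields\<close>

lemma qbar_ring_simps [simp]:
  "carrier qbar_ring = UNIV" "x \<otimes>\<^bsub>qbar_ring\<^esub> y = x * y" "x \<oplus>\<^bsub>qbar_ring\<^esub> y = x + y"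
  "\<zero>\<^bsub>qbar_ring\<^esub> = 0" "\<one>\<^bsub>qbar_ring\<^esub> = 1"
  by (simp_all add: qbar_ring_def ring_of_type_algebra_def)

interpretation QR: ring qbar_ring
  unfolding qbar_ring_def by (rule ring_from_type_algebra)

lemma qbar_ring_a_inv [simp]: "\<ominus>\<^bsub>qbar_ring\<^esub> x = - x"
  by (rule QR.minus_equality) auto

lemma qbar_ring_inv: "x \<noteq> 0 \<Longrightarrow> inv\<^bsub>qbar_ring\<^esub> x = inverse x"
  by (rule QR.inv_char) auto

lemma to_ac_in_rat_adjoin: "to_ac r \<in> rat_adjoin S"
  unfolding rat_adjoin_def by (rule generate_field.incl) simp

lemma is_subfield_rat_adjoin: "is_subfield (rat_adjoin S)"
  unfolding is_subfield_def
proof (intro conjI ballI)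
  show "1 \<in> rat_adjoin S" using to_ac_in_rat_adjoin[of 1] by simp
  fix x assume x: "x \<in> rat_adjoin S"
  show "inverse x \<in> rat_adjoin S"
  proof (cases "x = 0")
    case False
    then show ?thesis
      using generate_field.m_inv[of x qbar_ring] x qbar_ring_inv[of x] by (simp add: rat_adjoin_def)
  qed (use x in simp)
  fix y assume y: "y \<in> rat_adjoin S"
  show "x * y \<in> rat_adjoin S" using generate_field.eng_mult[of x qbar_ring _ y] x y by (simp add: rat_adjoin_def)
  show "x - y \<in> rat_adjoin S"
    using generate_field.eng_add[of x qbar_ring _ "- y"] generate_field.a_inv[of y qbar_ring] x y
    by (simp add: rat_adjoin_def)
qed

lemma rat_adjoin_minimal:
  assumes S: "S \<subseteq> rat_adjoin T"
  shows "rat_adjoin S \<subseteq> rat_adjoin T"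
proof
  fix x assume "x \<in> rat_adjoin S"
  then show "x \<in> rat_adjoin T"
    unfolding rat_adjoin_def[of S]
  proof (induction rule: generate_field.induct)
    case (incl h)
    then show ?case using S to_ac_in_rat_adjoin by blast
  qed (auto simp: rat_adjoin_def intro: generate_field.intros simp del: qbar_ring_simps qbar_ring_a_inv)
qed

lemma rat_adjoin_algebraic:
  "\<exists>p. p \<noteq> 0 \<and> (\<forall>i. poly.coeff p i \<in> rat_adjoin S) \<and> poly p x = 0"
proof -
  obtain p :: "rat poly" where p: "p \<noteq> 0" "poly (map_poly to_ac p) x = 0" by (rule alg_closure_algebraic)
  then show ?thesis
    by (intro exI[of _ "map_poly to_ac p"]) (simp add: map_poly_eq_0_iff coeff_map_poly to_ac_in_rat_adjoin)
qed

theorem theorem1p1: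
  fixes E :: "rat weierstrass" and K :: "complex set" and f n :: nat and \<zeta> :: qbar
  assumes "elliptic_curve E"
    and "imaginary_quadratic_field K" and "f \<ge> 1"
    and "has_CM_by E (order_of_conductor K f)"
    and "even (field_discriminant K * int f ^ 2)"
    and "n \<ge> 2"
    and "primitive_root_of_unity (2 ^ (n + 1)) \<zeta>"
  shows "rat_adjoin {\<zeta>} \<subseteq> division_field E (2 ^ n)"
proof -
  obtain a b u v c where ns: "4 * a ^ 3 + 27 * b ^ 2 \<noteq> 0" and
    E: "E = Weierstrass (2 * u) (3 * c - u ^ 2) (2 * v) (a + 3 * c ^ 2 - 2 * u * v) (b + a * c + c ^ 3 - v ^ 2)"
    using short_form_exists[OF assms(1)] by blast
  interpret S: weierstrass_curve "to_ac a" "to_ac b" "to_ac u" "to_ac v" "to_ac c"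
  proof
    have "to_ac (4 * a ^ 3 + 27 * b ^ 2) \<noteq> to_ac 0" using ns by (simp only: to_ac_eq_iff not_False_eq_True)
    then show "4 * to_ac a ^ 3 + 27 * to_ac b ^ 2 \<noteq> 0" by simp
  qed
  have base: "base_change E = S.C"
    by (simp add: E base_change_def S.C_def)
  obtain w D where w: "w ^ 2 = - of_nat D" "w \<notin> \<real>"
    and R: "order_of_conductor K f = {of_int x + of_int y * w | x y. True}"
    using even_order_generator[OF assms(2,3,5)] by blast
  obtain h where h: "S.represents_endos {of_int x + of_int y * w | x y. True} h"
    using S.endomorphism_ring_represented assms(4) unfolding has_CM_by_def base R by blast
  define L where "L = division_field E (2 ^ n)"
  have L: "to_ac r \<in> L" for r by (simp add: L_def division_field_def to_ac_in_rat_adjoin)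
  have coords: "set_point P \<subseteq> L" if "P \<in> torsion_points E (2 ^ n)" for P
    using that unfolding L_def division_field_def rat_adjoin_def by (blast intro: generate_field.incl)
  interpret A: algebraic_over L
    unfolding L_def division_field_def
    by unfold_locales (rule is_subfield_rat_adjoin, rule rat_adjoin_algebraic)
  have "\<zeta> \<in> L"
  proof (rule ccontr)
    assume "\<zeta> \<notin> L"
    then obtain \<sigma> where \<sigma>: "field_automorphism \<sigma>" "\<forall>x\<in>L. \<sigma> x = x" "\<sigma> \<zeta> \<noteq> \<zeta>"
      using A.automorphism_moving by blast
    have rat: "\<sigma> (to_ac r) = to_ac r" for r using \<sigma>(2) L by blast
    have "map_point \<sigma> P = P" if P: "P \<in> S.pts" "(S.dbl ^^ n) P = Infinity" for P
    proof (cases P)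
      case (Affine x y)
      have "S.from_short P \<in> torsion_points E (2 ^ n)"
        unfolding torsion_points_def base using P S.two_power_torsion_iff[OF P(1)] by simp
      from coords[OF this] have "x - to_ac c \<in> L" "y - to_ac u * (x - to_ac c) - to_ac v \<in> L"
        unfolding Affine by simp_all
      then have *: "\<sigma> (x - to_ac c) = x - to_ac c"
        "\<sigma> (y - to_ac u * (x - to_ac c) - to_ac v) = y - to_ac u * (x - to_ac c) - to_ac v"
        using \<sigma>(2) by blast+
      then have "\<sigma> x = x" by (simp add: field_automorphism_simps[OF \<sigma>(1)] rat)
      then show ?thesis using *(2) unfolding Affine by (simp add: field_automorphism_simps[OF \<sigma>(1)] rat)
    qed simp
    moreover have "\<zeta> ^ (2 ^ Suc n) = 1" using assms(7) by (simp add: primitive_root_of_unity_def)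
    ultimately have "\<sigma> \<zeta> = \<zeta>"
      using S.represented_endos_fix_roots_of_unity[OF h w \<sigma>(1) rat rat assms(6)] by blast
    then show False using \<sigma>(3) by simp
  qed
  then show ?thesis
    unfolding L_def division_field_def by (intro rat_adjoin_minimal) simp
qed

end
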